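(* Let $d\ge 1$ and let $\Lambda^{(i)}(\boldsymbol{\theta})$, $\boldsymbol{\theta}\in\mathbb{S}^d$, $i\in\mathbb{N}_0$, be a sequence of independent, jointly measurable random fields on $\mathbb{S}^d$ such that for every $i$: $P(\Lambda^{(i)}(\boldsymbol{\theta})\ge 0\ \forall\boldsymbol{\theta}\in\mathbb{S}^d)=1$, $E\Lambda^{(i)}(\boldsymbol{\theta})=1$ and $E(\Lambda^{(i)}(\boldsymbol{\theta}))^2<\infty$ for all $\boldsymbol{\theta}\in\mathbb{S}^d$. Let $k\ge 2$ be an integer and $\boldsymbol{p}=(p_1,\dots,p_k)$ with $p_j\ge 1$, $j=1,\dots,k$, and $\sum_{j=1}^k p_j=p\ge 2$. Suppose there exist a non-increasing function $\rho(\cdot,\boldsymbol{p})$ on $[0,\infty)$ and a constant $b>1$ such that $$\rho\Big(b^i\min_{m\ne h}d_{\mathbb{S}^d}(\boldsymbol{\theta}_m,\boldsymbol{\theta}_h),\boldsymbol{p}\Big)\ \ge\ E\Big(\prod_{j=1}^k(\Lambda^{(i)}(\boldsymbol{\theta}_j))^{p_j}\Big)$$ for all $i\in\mathbb{N}_0$ and all $\boldsymbol{\theta}_1,\dots,\boldsymbol{\theta}_k\in\mathbb{S}^d$, and suppose that $$b>\rho(0,\boldsymbol{p})^{1/d}\qquad\text{and}\qquad \sum_{i=0}^\infty\ln\big(\rho(b^i,\boldsymbol{p})\big)<\infty .$$ Let $\mathfrak{B}$ be a fixed finite or countable system of Borel subsets of $\mathbb{S}^d$. Then there exists a limiting (random)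 measure $\mu(\cdot)$ such that for all $B\in\mathfrak{B}$ it holds that $\mu_n(B)\to\mu(B)$ as $n\to\infty$, with probability $1$ and in the space $L_p$.
   Context: All random objects live on a fixed probability space $(\Omega,\mathcal{F},P)$. $\mathbb{N}_0=\{0,1,2,\dots\}$. $\mathbb{S}^d$ is the unit sphere centred at the origin in $\mathbb{R}^{d+1}$, with Borel $\sigma$-algebra $\mathcal{B}(\mathbb{S}^d)$, surface (Lebesgue) measure $\sigma$, and angular (great-circle) distance $d_{\mathbb{S}^d}(\cdot,\cdot)$. "Jointly measurable" means $\mathcal{B}(\mathbb{S}^d)\times\mathcal{F}$-measurable. The products and cumulative random measures are $$\Lambda_n(\boldsymbol{\theta})=\prod_{i=0}^n\Lambda^{(i)}(\boldsymbol{\theta}),\qquad \mu_n(B)=\int_B\Lambda_n(\boldsymbol{\theta})\,\sigma(d\boldsymbol{\theta}),\quad B\in\mathcal{B}(\mathbb{S}^d),\ n\in\mathbb{N}_0 .$$ *)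

theory Defs
  imports "HOL-Probability.Probability"
begin

text \<open>The unit sphere S^d is \<open>sphere 0 1\<close> in a Euclidean space of dimension d + 1.\<close>

abbreviation sphere_borel :: "'a::euclidean_space measure" where
  "sphere_borel \<equiv> restrict_space borel (sphere 0 1)"

text \<open>
  Surface measure, by integration in polar coordinates: \<open>\<sigma>(A)\<close> is d + 1 times the Lebesgue
  measure of the cone \<open>{x. 0 < norm x \<le> 1 \<and> x / norm x \<in> A}\<close>
  (see \<open>emeasure_sphere_measure\<close> below).
\<close>

definition sphere_measure :: "'a::euclidean_space measure" where
  "sphere_measure =
     scale_measure (of_nat DIM('a))
       (distr (restrict_space lborel (cball 0 1 - {0})) sphere_borel sgn)"

definition angular_dist :: "'a::euclidean_space \<Rightarrow> 'a \<Rightarrow> real" where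
  "angular_dist x y = arccos (x \<bullet> y)"

definition min_angular_dist :: "nat \<Rightarrow> (nat \<Rightarrow> 'a::euclidean_space) \<Rightarrow> real" where
  "min_angular_dist k \<theta> =
     Min {angular_dist (\<theta> m) (\<theta> h) | m h. m \<in> {1..k} \<and> h \<in> {1..k} \<and> m \<noteq> h}"

definition jointly_measurable ::
    "'w measure \<Rightarrow> ('a::euclidean_space \<Rightarrow> 'w \<Rightarrow> real) \<Rightarrow> bool" where
  "jointly_measurable M X \<longleftrightarrow>
     (\<lambda>(\<theta>, \<omega>). X \<theta> \<omega>) \<in> borel_measurable (sphere_borel \<Otimes>\<^sub>M M)"

text \<open>
  Independence of the fields as whole functions of \<open>\<theta>\<close>: each field is a random element of the
  product space over the sphere, so the sigma-algebra it generates is the one generated by all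
  its values.
\<close>

definition independent_fields ::
    "'w measure \<Rightarrow> (nat \<Rightarrow> 'a::euclidean_space \<Rightarrow> 'w \<Rightarrow> real) \<Rightarrow> bool" where
  "independent_fields M \<Lambda> \<longleftrightarrow>
     prob_space.indep_vars M (\<lambda>i. Pi\<^sub>M (sphere 0 1) (\<lambda>\<theta>. borel))
       (\<lambda>i \<omega>. \<lambda>\<theta>\<in>sphere 0 1. \<Lambda> i \<theta> \<omega>) UNIV"

definition field_prod :: "(nat \<Rightarrow> 'a \<Rightarrow> 'w \<Rightarrow> real) \<Rightarrow> nat \<Rightarrow> 'a \<Rightarrow> 'w \<Rightarrow> real" where
  "field_prod \<Lambda> n \<theta> \<omega> = (\<Prod>i=0..n. \<Lambda> i \<theta> \<omega>)"

text \<open>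
  The truncation of negative values by \<open>ennreal\<close> is immaterial: almost surely all
  the fields are nonnegative on the whole sphere.
\<close>

definition cumulative_measure ::
    "(nat \<Rightarrow> 'a::euclidean_space \<Rightarrow> 'w \<Rightarrow> real) \<Rightarrow> nat \<Rightarrow> 'w \<Rightarrow> 'a measure" where
  "cumulative_measure \<Lambda> n \<omega> =
     density sphere_measure (\<lambda>\<theta>. ennreal (field_prod \<Lambda> n \<theta> \<omega>))"

definition finite_random_measure :: "'w measure \<Rightarrow> 'a measure \<Rightarrow> ('w \<Rightarrow> 'a measure) \<Rightarrow> bool" where
  "finite_random_measure M N \<mu> \<longleftrightarrow>
     (\<forall>\<omega>\<in>space M. finite_measure (\<mu> \<omega>) \<and> sets (\<mu> \<omega>) = sets N) \<and>
     (\<forall>A\<in>sets N. (\<lambda>\<omega>. emeasure (\<mu> \<omega>) A) \<in> borel_measurable M)"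

definition in_Lp :: "'w measure \<Rightarrow> real \<Rightarrow> ('w \<Rightarrow> real) \<Rightarrow> bool" where
  "in_Lp M p X \<longleftrightarrow> X \<in> borel_measurable M \<and> integrable M (\<lambda>\<omega>. \<bar>X \<omega>\<bar> powr p)"

definition tendsto_in_Lp ::
    "'w measure \<Rightarrow> real \<Rightarrow> (nat \<Rightarrow> 'w \<Rightarrow> real) \<Rightarrow> ('w \<Rightarrow> real) \<Rightarrow> bool" where
  "tendsto_in_Lp M p X Y \<longleftrightarrow>
     (\<forall>n. in_Lp M p (X n)) \<and> in_Lp M p Y \<and>
     (\<lambda>n. \<integral>\<omega>. \<bar>X n \<omega> - Y \<omega>\<bar> powr p \<partial>M) \<longlonglongrightarrow> 0"

lemma space_sphere_measure [simp]:
  "space (sphere_measure :: 'a::euclidean_space measure) = sphere 0 1"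
  by (simp add: sphere_measure_def space_scale_measure space_restrict_space)

lemma sets_sphere_measure [simp, measurable_cong]: "sets sphere_measure = sets sphere_borel"
  by (simp add: sphere_measure_def)

lemma emeasure_sphere_measure:
  fixes A :: "'a::euclidean_space set"
  assumes "A \<in> sets sphere_borel"
  shows "emeasure sphere_measure A =
    of_nat DIM('a) * emeasure lborel {x. 0 < norm x \<and> norm x \<le> 1 \<and> sgn x \<in> A}"
proof -
  have m: "(sgn :: 'a \<Rightarrow> 'a) \<in> restrict_space lborel (cball 0 1 - {0}) \<rightarrow>\<^sub>M sphere_borel"
    unfolding sgn_div_norm
    by (rule measurable_restrict_space3) (auto simp: measurable_lborel1)
  have "emeasure (distr (restrict_space lborel (cball 0 1 - {0})) sphere_borel sgn) A =
      emeasure (restrict_space lborel (cball 0 1 - {0}))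
        (sgn -` A \<inter> space (restrict_space lborel (cball 0 1 - {0})))"
    by (rule emeasure_distr[OF m assms])
  also have "sgn -` A \<inter> space (restrict_space lborel (cball 0 1 - {0})) =
      {x. 0 < norm x \<and> norm x \<le> 1 \<and> sgn x \<in> A}"
    by (auto simp: space_restrict_space)
  also have "emeasure (restrict_space lborel (cball 0 1 - {0})) \<dots> = emeasure lborel \<dots>"
    by (rule emeasure_restrict_space) auto
  finally show ?thesis
    by (simp add: sphere_measure_def)
qed

end

theory Submission
  imports Defs
begin

text \<open>
  For a fixed Borel set \<open>B\<close> the masses \<open>\<mu>\<^sub>n(B)\<close> form a nonnegative martingale, since each new
  factor is independent of the previous ones and has mean 1.  Two things have to be shown: this
  martingale is bounded in \<open>L\<^sub>p\<close>, and its limits, each defined only outside a null set that depends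
  on \<open>B\<close>, come from one random measure.

  \<^emph>\<open>Boundedness.\<close>  By convexity \<open>\<mu>\<^sub>n(S)\<close> to the power \<open>p\<^sub>j\<close> is at most a constant times the
  integral of the \<open>p\<^sub>j\<close>-th power of the density.  Multiplying over \<open>j\<close> turns the \<open>p\<close>-th moment into an
  integral over \<open>k\<close> points of the sphere, and independence of the fields bounds the integrand by the
  product of \<open>\<rho>(b\<^sup>i t)\<close> over \<open>i \<le> n\<close>, where \<open>t\<close> is the least distance between the points
  (\<open>moment_mass_le\<close>).  Factors with \<open>b\<^sup>i t \<ge> 1\<close> are controlled by the convergent series of
  \<open>ln \<rho>(b\<^sup>i)\<close>, each of the other factors by \<open>\<rho>(0)\<close>; so the product is dominated by a sum of the
  terms \<open>\<rho>(0)\<^sup>n\<close> restricted to \<open>t < b\<^sup>1\<^sup>-\<^sup>n\<close> (\<open>prod_dilations_le\<close>).  Two points of the sphere are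
  closer than \<open>s\<close> on a set of measure \<open>O(s\<^sup>d)\<close> (\<open>sphere_measure_cap_le\<close>), hence integration yields a
  geometric series with ratio \<open>\<rho>(0) / b\<^sup>d < 1\<close> (\<open>moment_bounded\<close>).

  \<^emph>\<open>Convergence for one set.\<close>  As \<open>p \<ge> 2\<close>, the martingale is bounded in \<open>L\<^sub>2\<close>, its increments are
  orthogonal, and Kolmogorov's maximal inequality makes almost every path Cauchy.  The martingale
  is then the sequence of conditional expectations of its limit, so by Jensen's inequality and
  Fatou's lemma the \<open>p\<close>-th absolute moments converge to that of the limit, which upgrades almost
  sure convergence to convergence in \<open>L\<^sub>p\<close> (\<open>tendsto_in_Lp_Ylim\<close>).

  \<^emph>\<open>The limiting measure.\<close>  The sphere is coded by real numbers through a measurable injection with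
  a measurable left inverse (\<open>real_code_of_unit_ball\<close>).  The limits along the countably many
  half-lines with rational endpoint define, almost surely, a distribution function and so a
  measure on the line.  The expected limit mass of \<open>C\<close> is the countably additive \<open>\<sigma>(C)\<close>, so as
  soon as one inequality between the constructed measure and the limit is known, comparison of
  expectations turns it into almost sure equality; a Dynkin argument extends the agreement from
  half-lines to all Borel sets (\<open>random_measure_of_setwise_limits\<close>).
\<close>

section \<open>Spherical caps\<close>

text \<open>
  On the sphere the chord has length \<open>2 sin (a / 2)\<close>, where \<open>a\<close> is the angle, and the sine of
  \<open>a / 2\<close> is at most \<open>a / 2\<close>.
\<close>

lemma dist_le_angular_dist:
  fixes x y :: "'a::euclidean_space"
  assumes "x \<in> sphere 0 1" "y \<in> sphere 0 1"
  shows "dist x y \<le> angular_dist x y"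
proof -
  define a where "a = angular_dist x y"
  have n: "norm x = 1" "norm y = 1" using assms by auto
  have "\<bar>x \<bullet> y\<bar> \<le> 1" using Cauchy_Schwarz_ineq2[of x y] n by simp
  then have i: "-1 \<le> x \<bullet> y" "x \<bullet> y \<le> 1" by auto
  have a: "0 \<le> a" "cos a = x \<bullet> y"
    using i by (auto simp: a_def angular_dist_def arccos_lbound cos_arccos)
  have "(dist x y)\<^sup>2 = 2 - 2 * cos a"
    unfolding a dist_norm
    using n by (simp add: power2_norm_eq_inner inner_diff_left inner_diff_right inner_commute norm_eq_1)
  also have "\<dots> = (2 * sin (a/2))\<^sup>2"
    using cos_double_sin[of "a/2"] by (simp add: power_mult_distrib)
  also have "\<dots> \<le> a\<^sup>2"
    using abs_sin_le_one abs_sin_x_le_abs_x[of "a/2"] a(1) by (intro power2_le_iff_abs_le[THEN iffD2]) auto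
  finally show ?thesis
    using a(1) unfolding a_def[symmetric] by (rule power2_le_imp_le)
qed

text \<open>
  The function \<open>arccos\<close> is unspecified outside \<open>[-1, 1]\<close>.  Inner products of unit vectors lie in that
  interval, so \<open>arccos\<close> may be replaced by a continuous function on the whole line.
\<close>

lemma angular_dist_measurable:
  fixes f g :: "'n \<Rightarrow> 'a::euclidean_space"
  assumes f: "f \<in> N \<rightarrow>\<^sub>M sphere_measure" and g: "g \<in> N \<rightarrow>\<^sub>M sphere_measure"
  shows "(\<lambda>x. angular_dist (f x) (g x)) \<in> borel_measurable N"
proof -
  have "f \<in> N \<rightarrow>\<^sub>M sphere_borel" "g \<in> N \<rightarrow>\<^sub>M sphere_borel"
    using f g by (simp_all cong: measurable_cong_sets)
  then have [measurable]: "f \<in> N \<rightarrow>\<^sub>M borel" "g \<in> N \<rightarrow>\<^sub>M borel"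
    by (auto simp: measurable_restrict_space2_iff)
  have "continuous_on UNIV (\<lambda>t::real. arccos (max (-1) (min 1 t)))"
    by (intro continuous_intros) auto
  then have [measurable]: "(\<lambda>t::real. arccos (max (-1) (min 1 t))) \<in> borel_measurable borel"
    by (rule borel_measurable_continuous_onI)
  have "angular_dist (f x) (g x) = arccos (max (-1) (min 1 (f x \<bullet> g x)))" if "x \<in> space N" for x
  proof -
    have "norm (f x) = 1" "norm (g x) = 1"
      using measurable_space[OF f that] measurable_space[OF g that] by auto
    then have "\<bar>f x \<bullet> g x\<bar> \<le> 1" using Cauchy_Schwarz_ineq2[of "f x" "g x"] by simp
    then have "max (-1) (min 1 (f x \<bullet> g x)) = f x \<bullet> g x" by (simp add: abs_le_iff max_def min_def)
    then show ?thesis by (simp add: angular_dist_def)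
  qed
  moreover have "(\<lambda>x. arccos (max (-1) (min 1 (f x \<bullet> g x)))) \<in> borel_measurable N"
    by measurable
  ultimately show ?thesis by (simp cong: measurable_cong)
qed

text \<open>
  The cone over a cap of angular radius \<open>s\<close> lies within distance \<open>s\<close> of the segment from the origin
  to the centre of the cap.  About \<open>1 / s\<close> balls of radius \<open>2 s\<close> cover that neighbourhood, and
  each of them has volume of order \<open>s\<close> to the power \<open>d + 1\<close>.
\<close>

lemma sphere_measure_cap_le:
  fixes x :: "'a::euclidean_space"
  assumes x: "x \<in> sphere 0 1" and s: "0 < s" "s \<le> 1" and D: "DIM('a) = d + 1"
  shows "emeasure sphere_measure {y \<in> sphere 0 1. angular_dist y x < s}
           \<le> ennreal (DIM('a) * (3 * (unit_ball_vol DIM('a) * 2 ^ (d + 1))) * s ^ d)"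
proof -
  define m where "m = nat \<lceil>1/s\<rceil>"
  have m: "1/s \<le> real m" "real m \<le> 1/s + 1" "0 < m"
    using s unfolding m_def by (auto simp: le_of_int_ceiling)
  define V where "V = unit_ball_vol (real DIM('a))"
  have V: "0 \<le> V" by (simp add: V_def unit_ball_vol_nonneg)
  let ?A = "{y \<in> sphere 0 1. angular_dist y x < s}"
  let ?U = "{z::'a. 0 < norm z \<and> norm z \<le> 1 \<and> sgn z \<in> ?A}"
  \<comment> \<open>a point \<open>z\<close> of the cone is near \<open>norm z *\<^sub>R x\<close>, hence near the grid point with \<open>i = \<lfloor>m * norm z\<rfloor>\<close>\<close>
  have "?U \<subseteq> (\<Union>i\<in>{0..m}. ball ((real i / m) *\<^sub>R x) (2 * s))"
  proof
    fix z assume z: "z \<in> ?U"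
    define i where "i = nat \<lfloor>m * norm z\<rfloor>"
    have "real i = of_int \<lfloor>m * norm z\<rfloor>"
      unfolding i_def by simp
    then have "real i \<le> m * norm z" "m * norm z < i + 1"
      by linarith+
    then have "\<bar>real i - m * norm z\<bar> \<le> 1" by simp
    moreover have "real i / m - norm z = (real i - m * norm z) / m"
      using m(3) by (simp add: field_simps)
    ultimately have i: "\<bar>real i / m - norm z\<bar> \<le> 1/m"
      by (simp add: divide_right_mono)
    have "real i \<le> m" using \<open>real i \<le> m * norm z\<close> z m(3)
      by (smt (verit) mult_left_le of_nat_0_le_iff mem_Collect_eq)
    then have im: "i \<in> {0..m}" by simp
    have "z = norm z *\<^sub>R sgn z" using z by (simp add: sgn_div_norm)
    then have "dist (norm z *\<^sub>R x) z = norm z * dist x (sgn z)"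
      by (metis dist_scaleR abs_norm_cancel scaleR_right_diff_distrib norm_scaleR dist_norm)
    also have "\<dots> \<le> 1 * dist (sgn z) x"
      using z by (intro mult_mono) (auto simp: dist_commute)
    also have "\<dots> \<le> angular_dist (sgn z) x"
      using z x dist_le_angular_dist by auto
    also have "\<dots> < s" using z by auto
    finally have 1: "dist (norm z *\<^sub>R x) z < s" .
    have "dist ((real i / m) *\<^sub>R x) (norm z *\<^sub>R x) = \<bar>real i / m - norm z\<bar>"
      using x by (simp add: dist_norm flip: scaleR_left_diff_distrib)
    also have "\<dots> \<le> 1/m" by (fact i)
    also have "\<dots> \<le> s" using m s by (simp add: field_simps)
    finally have "dist ((real i / m) *\<^sub>R x) z < 2 * s"
      using 1 dist_triangle[of "(real i / m) *\<^sub>R x" z "norm z *\<^sub>R x"] by linarith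
    then show "z \<in> (\<Union>i\<in>{0..m}. ball ((real i / m) *\<^sub>R x) (2 * s))"
      using im by (intro UN_I[of i]) auto
  qed
  then have "emeasure lborel ?U \<le> emeasure lborel (\<Union>i\<in>{0..m}. ball ((real i / m) *\<^sub>R x) (2 * s))"
    by (intro emeasure_mono) auto
  also have "\<dots> \<le> (\<Sum>i\<in>{0..m}. emeasure lborel (ball ((real i / m) *\<^sub>R x) (2 * s)))"
    by (intro emeasure_subadditive_finite) auto
  also have "\<dots> = ennreal (real (m + 1) * (V * (2 * s) ^ (d + 1)))"
  proof -
    have "emeasure lborel (ball c (2 * s)) = ennreal (V * (2 * s) ^ (d + 1))" for c :: 'a
      using s by (simp add: emeasure_ball V_def D)
    then have "(\<Sum>i\<in>{0..m}. emeasure lborel (ball ((real i / m) *\<^sub>R x) (2 * s)))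
        = (\<Sum>i\<in>{0..m}. ennreal (V * (2 * s) ^ (d + 1)))" by simp
    also have "\<dots> = ennreal (\<Sum>i\<in>{0..m}. V * (2 * s) ^ (d + 1))"
      using V s by (intro sum_ennreal) simp
    finally show ?thesis by simp
  qed
  also have "\<dots> \<le> ennreal (3 / s * (V * (2 * s) ^ (d + 1)))"
  proof (intro ennreal_leI mult_right_mono)
    have "1 \<le> 1/s" using s by simp
    then show "real (m + 1) \<le> 3 / s" using m by (simp add: field_simps)
  qed (use V s in auto)
  also have "3 / s * (V * (2 * s) ^ (d + 1)) = 3 * (V * 2 ^ (d + 1)) * s ^ d"
    using s by (simp add: field_simps power_mult_distrib)
  finally have U: "emeasure lborel ?U \<le> ennreal (3 * (V * 2 ^ (d + 1)) * s ^ d)" .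
  have "(\<lambda>y. angular_dist y x) \<in> borel_measurable (sphere_measure :: 'a measure)"
    using x by (intro angular_dist_measurable) auto
  then have "{y \<in> space sphere_measure. angular_dist y x < s} \<in> sets (sphere_measure :: 'a measure)"
    by measurable
  then have "?A \<in> sets sphere_borel" by simp
  then have "emeasure sphere_measure ?A = of_nat DIM('a) * emeasure lborel ?U"
    by (rule emeasure_sphere_measure)
  also have "\<dots> \<le> of_nat DIM('a) * ennreal (3 * (V * 2 ^ (d + 1)) * s ^ d)"
    by (intro mult_left_mono U) auto
  also have "\<dots> = ennreal (DIM('a) * (3 * (V * 2 ^ (d + 1))) * s ^ d)"
    by (simp add: ennreal_of_nat_eq_real_of_nat algebra_simps flip: ennreal_mult')
  finally show ?thesis by (simp add: V_def)
qed

lemma finite_measure_sphere_measure: "finite_measure (sphere_measure :: 'a::euclidean_space measure)"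
proof
  have "emeasure (sphere_measure :: 'a measure) (sphere 0 1) \<le> of_nat DIM('a) * emeasure lborel (cball (0::'a) 1)"
    by (subst emeasure_sphere_measure)
      (auto simp: sets_restrict_space image_iff intro!: mult_left_mono emeasure_mono bexI[of _ UNIV])
  also have "\<dots> < \<infinity>"
    by (simp add: emeasure_cball ennreal_mult_less_top ennreal_of_nat_eq_real_of_nat)
  finally show "emeasure (sphere_measure :: 'a measure) (space sphere_measure) \<noteq> \<infinity>"
    by simp
qed

section \<open>Products of a function along dilations\<close>

text \<open>
  The \<open>i\<close>-th factor is at most \<open>r (b ^ (i - n))\<close> once \<open>b ^ n * t \<ge> 1\<close> and \<open>i \<ge> n\<close>, and at most
  \<open>r 0\<close> in any case.  So, if exactly the first \<open>n\<close> dilations \<open>b ^ i * t\<close> are below 1, the product is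
  at most \<open>K * r 0 ^ n\<close>.  Writing this bound as a sum of indicators over all scales makes it ready for
  integration in \<open>t\<close>.  The induction peels off the first factor and passes from \<open>t\<close> to \<open>b * t\<close>.
\<close>

lemma prod_dilations_le:
  fixes r :: "real \<Rightarrow> real"
  assumes r1: "\<And>x. 1 \<le> r x" and anti: "\<And>x y. 0 \<le> x \<Longrightarrow> x \<le> y \<Longrightarrow> r y \<le> r x" and b: "b > 1"
    and K: "\<And>N. (\<Prod>i<N. r (b ^ i)) \<le> K"
    and t: "0 \<le> t"
  shows "(\<Prod>i<N. r (b ^ i * t)) \<le> K * (1 + (\<Sum>n<N. r 0 ^ (Suc n) * of_bool (t * b ^ n < 1)))"
  using t
proof (induction N arbitrary: t)
  case 0
  then show ?case using K[of 0] by simp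
next
  case (Suc N)
  have r0: "0 \<le> r x" for x using r1[of x] by linarith
  have K0: "0 \<le> K" using K[of 0] by simp
  show ?case
  proof (cases "t < 1")
    case False
    have "(\<Prod>i<Suc N. r (b ^ i * t)) \<le> (\<Prod>i<Suc N. r (b ^ i))"
      using b False by (intro prod_mono conjI r0 anti) (auto simp: mult_le_cancel_left1)
    also have "\<dots> \<le> K" by (rule K)
    also have "\<dots> \<le> K * (1 + (\<Sum>n<Suc N. r 0 ^ (Suc n) * of_bool (t * b ^ n < 1)))"
      using K0 r0 by (auto simp: mult_le_cancel_left1 simp del: sum.lessThan_Suc sum_mult_of_bool_eq intro!: sum_nonneg)
    finally show ?thesis .
  next
    case True
    have "(\<Prod>i<Suc N. r (b ^ i * t)) = r t * (\<Prod>i<N. r (b ^ i * (b * t)))"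
      by (subst prod.lessThan_Suc_shift) (simp add: algebra_simps)
    also have "\<dots> \<le> r 0 * (K * (1 + (\<Sum>n<N. r 0 ^ (Suc n) * of_bool (b * t * b ^ n < 1))))"
      using Suc b by (intro mult_mono anti Suc.IH prod_nonneg r0) auto
    also have "\<dots> = K * (r 0 + (\<Sum>n<N. r 0 ^ (Suc (Suc n)) * of_bool (t * b ^ Suc n < 1)))"
      by (simp add: algebra_simps sum_distrib_left)
    also have "\<dots> = K * (\<Sum>n<Suc N. r 0 ^ (Suc n) * of_bool (t * b ^ n < 1))"
      using True by (subst sum.lessThan_Suc_shift) simp
    also have "\<dots> \<le> K * (1 + (\<Sum>n<Suc N. r 0 ^ (Suc n) * of_bool (t * b ^ n < 1)))"
      using K0 by (intro mult_left_mono) auto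
    finally show ?thesis .
  qed
qed

text \<open>
  Replacing \<open>r\<close> by its maximum with 1 does not destroy summability of the logarithms: either
  \<open>r\<close> is at least 1 along the whole sequence and nothing changes, or by monotonicity the
  maximum is eventually equal to 1.
\<close>

lemma bounded_prod_max_1:
  fixes r :: "real \<Rightarrow> real"
  assumes anti: "antimono_on {0..} r" and b: "b > 1" and sm: "summable (\<lambda>i. ln (r (b ^ i)))"
  obtains K where "\<And>N. (\<Prod>i<N. max 1 (r (b ^ i))) \<le> K"
proof -
  have mono: "r (b ^ j) \<le> r (b ^ i)" if "i \<le> j" for i j
    using anti b that by (auto simp: monotone_on_def intro: power_increasing)
  have "summable (\<lambda>i. ln (max 1 (r (b ^ i))))"
  proof (cases "\<forall>i. 1 \<le> r (b ^ i)")
    case True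
    then show ?thesis using sm by (simp add: max_def)
  next
    case False
    then obtain i where i: "r (b ^ i) < 1" by (auto simp: not_le)
    have "max 1 (r (b ^ j)) = 1" if "i \<le> j" for j using mono[OF that] i by simp
    then show ?thesis
      by (intro summable_comparison_test_ev[OF _ summable_zero] eventually_sequentiallyI[of i]) simp
  qed
  moreover have "(\<Prod>i<N. max 1 (r (b ^ i))) = exp (\<Sum>i<N. ln (max 1 (r (b ^ i))))" for N
    by (simp add: exp_sum)
  ultimately have "(\<Prod>i<N. max 1 (r (b ^ i))) \<le> exp (\<Sum>i. ln (max 1 (r (b ^ i))))" for N
    by (simp add: sum_le_suminf)
  then show thesis by (rule that)
qed

section \<open>Martingales bounded in an Lp space\<close>

text \<open>
  This is the convex function to which Jensen's inequality is applied.  On the open half-line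
  convexity follows from the second derivative; the boundary point 0 is covered by
  \<open>(t x)\<^sup>p \<le> t x\<^sup>p\<close>.
\<close>

lemma convex_abs_powr:
  assumes p: "1 \<le> p"
  shows "convex_on UNIV (\<lambda>x::real. \<bar>x\<bar> powr p)"
proof (rule convex_onI)
  have scale: "(t * x) powr p \<le> t * x powr p" if "0 < t" "t < 1" "0 \<le> x" for t x :: real
    using that powr_le_one_le[of t p] p powr_mult[of t x p] by (auto intro!: mult_right_mono)
  fix t x y :: real
  assume t: "0 < t" "t < 1"
  have "\<bar>(1 - t) *\<^sub>R x + t *\<^sub>R y\<bar> \<le> (1 - t) * \<bar>x\<bar> + t * \<bar>y\<bar>"
    using t abs_triangle_ineq[of "(1 - t) * x" "t * y"] by (simp add: abs_mult)
  then have "\<bar>(1 - t) *\<^sub>R x + t *\<^sub>R y\<bar> powr p \<le> ((1 - t) * \<bar>x\<bar> + t * \<bar>y\<bar>) powr p"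
    using p by (intro powr_mono2) auto
  also have "\<dots> \<le> (1 - t) * \<bar>x\<bar> powr p + t * \<bar>y\<bar> powr p"
  proof (cases "x = 0 \<or> y = 0")
    case True
    then show ?thesis
      using scale[of t "\<bar>y\<bar>"] scale[of "1 - t" "\<bar>x\<bar>"] t by auto
  next
    case False
    then show ?thesis
      using convex_onD[OF powr_convex[OF p], of t "\<bar>x\<bar>" "\<bar>y\<bar>"] t by simp
  qed
  finally show "\<bar>(1 - t) *\<^sub>R x + t *\<^sub>R y\<bar> powr p \<le> (1 - t) * \<bar>x\<bar> powr p + t * \<bar>y\<bar> powr p" .
qed simp

lemma abs_diff_powr_le:
  fixes x y p :: real
  assumes "0 \<le> p"
  shows "\<bar>x - y\<bar> powr p \<le> 2 powr p * (\<bar>x\<bar> powr p + \<bar>y\<bar> powr p)"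
proof -
  have "\<bar>x - y\<bar> powr p \<le> (2 * max \<bar>x\<bar> \<bar>y\<bar>) powr p"
    using assms by (intro powr_mono2) auto
  also have "\<dots> = 2 powr p * max \<bar>x\<bar> \<bar>y\<bar> powr p"
    by (simp add: powr_mult)
  also have "\<dots> \<le> 2 powr p * (\<bar>x\<bar> powr p + \<bar>y\<bar> powr p)"
    by (intro mult_left_mono) (auto simp: max_def)
  finally show ?thesis .
qed

lemma tendsto_abs_powr:
  fixes f :: "nat \<Rightarrow> real"
  assumes "f \<longlonglongrightarrow> a" "2 \<le> p"
  shows "(\<lambda>n. \<bar>f n\<bar> powr p) \<longlonglongrightarrow> \<bar>a\<bar> powr p"
  by (rule tendsto_powr2) (use assms in \<open>auto intro: tendsto_rabs\<close>)

text \<open>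
  Fatou's lemma in a form free of extended reals.
\<close>

lemma Fatou_integral_le:
  fixes X :: "nat \<Rightarrow> 'w \<Rightarrow> real"
  assumes int: "\<And>n. integrable M (X n)" and nn: "\<And>n. AE x in M. 0 \<le> X n x"
    and Z [measurable]: "Z \<in> borel_measurable M"
    and lim: "AE x in M. (\<lambda>n. X n x) \<longlonglongrightarrow> Z x"
    and le: "\<forall>\<^sub>F n in sequentially. (\<integral>x. X n x \<partial>M) \<le> c"
  shows "integrable M Z" and "(\<integral>x. Z x \<partial>M) \<le> c"
proof -
  have [measurable]: "X n \<in> borel_measurable M" for n using int by auto
  have c: "0 \<le> c"
    using eventually_happens[OF le] integral_nonneg_AE[OF nn] order_trans by (auto) 
  have nnZ: "AE x in M. 0 \<le> Z x"
  proof -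
    have "AE x in M. \<forall>n. 0 \<le> X n x" using nn by (simp add: AE_all_countable)
    with lim show ?thesis
      by eventually_elim (auto intro: LIMSEQ_le_const)
  qed
  have "(\<integral>\<^sup>+x. ennreal (Z x) \<partial>M) = (\<integral>\<^sup>+x. liminf (\<lambda>n. ennreal (X n x)) \<partial>M)"
  proof (intro nn_integral_cong_AE)
    show "AE x in M. ennreal (Z x) = liminf (\<lambda>n. ennreal (X n x))"
      using lim by eventually_elim (auto intro!: lim_imp_Liminf[symmetric] tendsto_ennrealI)
  qed
  also have "\<dots> \<le> liminf (\<lambda>n. \<integral>\<^sup>+x. ennreal (X n x) \<partial>M)"
    by (intro nn_integral_liminf) auto
  also have "\<dots> = liminf (\<lambda>n. ennreal (\<integral>x. X n x \<partial>M))"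
    by (simp add: nn_integral_eq_integral int nn)
  also have "\<dots> \<le> limsup (\<lambda>n. ennreal (\<integral>x. X n x \<partial>M))"
    by (intro Liminf_le_Limsup) auto
  also have "\<dots> \<le> ennreal c"
    using le by (intro Limsup_bounded) (auto elim!: eventually_mono intro!: ennreal_leI)
  finally have *: "(\<integral>\<^sup>+x. ennreal (Z x) \<partial>M) \<le> ennreal c" .
  then show i: "integrable M Z"
    using nnZ by (intro integrableI_nonneg) (auto simp: le_less_trans)
  show "(\<integral>x. Z x \<partial>M) \<le> c"
    using * c nnZ by (simp add: nn_integral_eq_integral i)
qed

lemma tendsto_in_Lp_cong_limit:
  assumes X: "tendsto_in_Lp M p X L" and L: "AE \<omega> in M. L \<omega> = L' \<omega>" and L' [measurable]: "L' \<in> borel_measurable M"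
  shows "tendsto_in_Lp M p X L'"
proof -
  have [measurable]: "L \<in> borel_measurable M" "X n \<in> borel_measurable M" for n
    using X by (auto simp: tendsto_in_Lp_def in_Lp_def)
  have "integrable M (\<lambda>\<omega>. \<bar>L' \<omega>\<bar> powr p) \<longleftrightarrow> integrable M (\<lambda>\<omega>. \<bar>L \<omega>\<bar> powr p)"
    by (rule integrable_cong_AE) (use L in \<open>auto elim: eventually_mono\<close>)
  moreover have "(\<integral>\<omega>. \<bar>X n \<omega> - L' \<omega>\<bar> powr p \<partial>M) = (\<integral>\<omega>. \<bar>X n \<omega> - L \<omega>\<bar> powr p \<partial>M)" for n
    by (rule integral_cong_AE) (use L in \<open>auto elim: eventually_mono\<close>)
  ultimately show ?thesis using X by (simp add: tendsto_in_Lp_def in_Lp_def)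
qed

text \<open>
  The martingale property is stated in integrated form, over the events of the past; this is what the
  independence of the factors delivers directly.  The exponent is at least 2, so \<open>L\<^sub>2\<close> methods
  apply.
\<close>

locale Lp_bounded_martingale = prob_space M for M :: "'w measure" +
  fixes F :: "nat \<Rightarrow> 'w measure" and Y :: "nat \<Rightarrow> 'w \<Rightarrow> real" and p C :: real
  assumes subalg: "\<And>n. subalgebra M (F n)"
    and filtration: "\<And>n. sets (F n) \<subseteq> sets (F (Suc n))"
    and adapted: "\<And>n. Y n \<in> borel_measurable (F n)"
    and martingale: "\<And>n A. A \<in> sets (F n) \<Longrightarrow>
          (\<integral>\<omega>. indicator A \<omega> * Y (Suc n) \<omega> \<partial>M) = (\<integral>\<omega>. indicator A \<omega> * Y n \<omega> \<partial>M)"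
    and p_ge_2: "2 \<le> p"
    and integrable_powr: "\<And>n. integrable M (\<lambda>\<omega>. \<bar>Y n \<omega>\<bar> powr p)"
    and bounded: "\<And>n. (\<integral>\<omega>. \<bar>Y n \<omega>\<bar> powr p \<partial>M) \<le> C"
begin

lemma filtration_mono: "n \<le> m \<Longrightarrow> sets (F n) \<subseteq> sets (F m)"
  by (rule lift_Suc_mono_le[of "\<lambda>n. sets (F n)"]) (use filtration in auto)

lemma space_F: "space (F n) = space M"
  using subalg[of n] by (simp add: subalgebra_def)

lemma measurable_later: "n \<le> m \<Longrightarrow> f \<in> borel_measurable (F n) \<Longrightarrow> f \<in> borel_measurable (F m)"
  using filtration_mono[of n m] by (auto simp: measurable_def space_F)

lemma measurable_M: "f \<in> borel_measurable (F n) \<Longrightarrow> f \<in> borel_measurable M"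
  using measurable_from_subalg[OF subalg] .

lemma Y_measurable [measurable]: "Y n \<in> borel_measurable M"
  using adapted measurable_M by auto

lemma sigma_finite_F: "sigma_finite_subalgebra M (F n)"
  using finite_measure_subalgebra_is_sigma_finite
    finite_measure_subalgebra.intro[OF finite_measure_axioms]
    finite_measure_subalgebra_axioms.intro[OF subalg] by blast

lemma sets_F_M: "A \<in> sets (F n) \<Longrightarrow> A \<in> sets M"
  using subalg[of n] by (auto simp: subalgebra_def)

lemma square_le_powr: "x\<^sup>2 \<le> 1 + \<bar>x\<bar> powr p" for x :: real
proof (cases "\<bar>x\<bar> \<le> 1")
  case True
  then have "x\<^sup>2 \<le> 1" by (simp add: abs_square_le_1)
  also have "\<dots> \<le> 1 + \<bar>x\<bar> powr p" by simp
  finally show ?thesis .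
next
  case False
  then have "\<bar>x\<bar> powr 2 \<le> \<bar>x\<bar> powr p" using p_ge_2 by (intro powr_mono) auto
  then show ?thesis using False by simp
qed

lemma square_integrable:
  assumes [measurable]: "X \<in> borel_measurable M" and "integrable M (\<lambda>\<omega>. \<bar>X \<omega>\<bar> powr p)"
  shows "integrable M (\<lambda>\<omega>. (X \<omega>)\<^sup>2)"
  by (rule Bochner_Integration.integrable_bound[of _ "\<lambda>\<omega>. 1 + \<bar>X \<omega>\<bar> powr p"])
     (use assms square_le_powr in auto)

lemma product_integrable:
  fixes X Z :: "'w \<Rightarrow> real"
  assumes [measurable]: "X \<in> borel_measurable M" "Z \<in> borel_measurable M"
    and "integrable M (\<lambda>\<omega>. (X \<omega>)\<^sup>2)" "integrable M (\<lambda>\<omega>. (Z \<omega>)\<^sup>2)"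
  shows "integrable M (\<lambda>\<omega>. X \<omega> * Z \<omega>)"
proof (rule Bochner_Integration.integrable_bound[of _ "\<lambda>\<omega>. (X \<omega>)\<^sup>2 + (Z \<omega>)\<^sup>2"])
  have "\<bar>x * z\<bar> \<le> x\<^sup>2 + z\<^sup>2" for x z :: real
    using sum_squares_bound[of "\<bar>x\<bar>" "\<bar>z\<bar>"] mult_nonneg_nonneg[of "\<bar>x\<bar>" "\<bar>z\<bar>"]
    by (simp add: abs_mult del: mult_nonneg_nonneg)
  then show "AE \<omega> in M. norm (X \<omega> * Z \<omega>) \<le> norm ((X \<omega>)\<^sup>2 + (Z \<omega>)\<^sup>2)" by simp
qed (use assms in auto)

lemma integrable_of_square:
  fixes X :: "'w \<Rightarrow> real"
  assumes "X \<in> borel_measurable M" "integrable M (\<lambda>\<omega>. (X \<omega>)\<^sup>2)"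
  shows "integrable M X"
  using product_integrable[OF assms(1) _ assms(2), of "\<lambda>_. 1"] by simp

lemma square_integrable_Y: "integrable M (\<lambda>\<omega>. (Y n \<omega>)\<^sup>2)"
  using square_integrable[OF Y_measurable integrable_powr] .

lemma integrable_Y: "integrable M (Y n)"
  by (rule integrable_of_square[OF _ square_integrable_Y]) simp

lemma square_integrable_diff:
  fixes X Z :: "'w \<Rightarrow> real"
  assumes [measurable]: "X \<in> borel_measurable M" "Z \<in> borel_measurable M"
    and "integrable M (\<lambda>\<omega>. (X \<omega>)\<^sup>2)" "integrable M (\<lambda>\<omega>. (Z \<omega>)\<^sup>2)"
  shows "integrable M (\<lambda>\<omega>. (X \<omega> - Z \<omega>)\<^sup>2)"
  unfolding power2_diff mult.assoc using assms product_integrable[OF assms] by auto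

lemma cond_exp_step: "AE \<omega> in M. real_cond_exp M (F n) (Y (Suc n)) \<omega> = Y n \<omega>"
proof -
  interpret sigma_finite_subalgebra M "F n" by (rule sigma_finite_F)
  show ?thesis
  proof (rule real_cond_exp_charact)
    fix A assume "A \<in> sets (F n)"
    then show "(\<integral>\<omega>\<in>A. Y (Suc n) \<omega> \<partial>M) = (\<integral>\<omega>\<in>A. Y n \<omega> \<partial>M)"
      unfolding set_lebesgue_integral_def real_scaleR_def by (rule martingale)
  qed (rule integrable_Y adapted)+
qed

lemma integral_mult_step:
  assumes U: "U \<in> borel_measurable (F n)" "integrable M (\<lambda>\<omega>. (U \<omega>)\<^sup>2)"
  shows "(\<integral>\<omega>. U \<omega> * Y (Suc n) \<omega> \<partial>M) = (\<integral>\<omega>. U \<omega> * Y n \<omega> \<partial>M)"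
proof -
  interpret sigma_finite_subalgebra M "F n" by (rule sigma_finite_F)
  have [measurable]: "U \<in> borel_measurable M" using U measurable_M by auto
  have "(\<integral>\<omega>. U \<omega> * Y (Suc n) \<omega> \<partial>M) = (\<integral>\<omega>. U \<omega> * real_cond_exp M (F n) (Y (Suc n)) \<omega> \<partial>M)"
    by (rule real_cond_exp_intg(2)[symmetric, OF product_integrable[OF _ _ U(2) square_integrable_Y] U(1)])
      simp_all
  also have "\<dots> = (\<integral>\<omega>. U \<omega> * Y n \<omega> \<partial>M)"
  proof (intro integral_cong_AE)
    show "AE \<omega> in M. U \<omega> * real_cond_exp M (F n) (Y (Suc n)) \<omega> = U \<omega> * Y n \<omega>"
      using cond_exp_step[of n] by eventually_elim simp
  qed measurable
  finally show ?thesis .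
qed

text \<open>
  This is the orthogonality of later increments to square-integrable functions of the past.
\<close>

lemma integral_mult_later:
  assumes U: "U \<in> borel_measurable (F n)" "integrable M (\<lambda>\<omega>. (U \<omega>)\<^sup>2)" and "n \<le> m"
  shows "(\<integral>\<omega>. U \<omega> * Y m \<omega> \<partial>M) = (\<integral>\<omega>. U \<omega> * Y n \<omega> \<partial>M)"
  using \<open>n \<le> m\<close>
proof (induction m rule: dec_induct)
  case (step m)
  then show ?case using integral_mult_step[of U m] measurable_later[of n m U] U by simp
qed simp

text \<open>
  Pythagoras: increments over disjoint ranges are orthogonal, so second moments increase.
\<close>

lemma integral_square_diff:
  assumes "n \<le> m"
  shows "(\<integral>\<omega>. (Y m \<omega> - Y n \<omega>)\<^sup>2 \<partial>M) = (\<integral>\<omega>. (Y m \<omega>)\<^sup>2 \<partial>M) - (\<integral>\<omega>. (Y n \<omega>)\<^sup>2 \<partial>M)"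
proof -
  have "(\<integral>\<omega>. (Y m \<omega> - Y n \<omega>)\<^sup>2 \<partial>M)
      = (\<integral>\<omega>. (Y m \<omega>)\<^sup>2 + (Y n \<omega>)\<^sup>2 - 2 * (Y n \<omega> * Y m \<omega>) \<partial>M)"
    by (simp add: power2_diff algebra_simps)
  also have "\<dots> = (\<integral>\<omega>. (Y m \<omega>)\<^sup>2 \<partial>M) + (\<integral>\<omega>. (Y n \<omega>)\<^sup>2 \<partial>M) - 2 * (\<integral>\<omega>. Y n \<omega> * Y m \<omega> \<partial>M)"
    using square_integrable_Y product_integrable[OF _ _ square_integrable_Y square_integrable_Y, of n m]
    by simp
  also have "(\<integral>\<omega>. Y n \<omega> * Y m \<omega> \<partial>M) = (\<integral>\<omega>. Y n \<omega> * Y n \<omega> \<partial>M)"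
    by (rule integral_mult_later) (auto simp: adapted square_integrable_Y assms)
  finally show ?thesis by (simp add: power2_eq_square)
qed

text \<open>
  Kolmogorov's maximal inequality, by induction on \<open>N\<close>.  On the event \<open>S N\<close>, which belongs to the
  past at time \<open>N\<close>, the next step can only increase the integral of the square, because the mixed term
  vanishes; on the event of a first exceedance at time \<open>N + 1\<close> the integrand is at least
  \<open>\<epsilon>\<^sup>2\<close>.
\<close>

lemma maximal_inequality:
  assumes e: "0 < \<epsilon>" and "m \<le> N"
  defines "S \<equiv> \<lambda>N. {\<omega> \<in> space M. \<exists>j\<in>{m..N}. \<epsilon> \<le> \<bar>Y j \<omega> - Y m \<omega>\<bar>}"
  shows "\<epsilon>\<^sup>2 * prob (S N) \<le> (\<integral>\<omega>. indicator (S N) \<omega> * (Y N \<omega> - Y m \<omega>)\<^sup>2 \<partial>M)"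
  using \<open>m \<le> N\<close>
proof (induction N rule: dec_induct)
  case base
  have "S m = {}" using e by (auto simp: S_def)
  then show ?case by simp
next
  case (step N)
  have SF: "S N \<in> sets (F N)"
  proof -
    have [measurable]: "Y j \<in> borel_measurable (F N)" if "j \<in> {m..N}" for j
      using that adapted measurable_later by auto
    have [measurable]: "Y m \<in> borel_measurable (F N)"
      using step adapted measurable_later by auto
    have "{\<omega> \<in> space (F N). \<exists>j\<in>{m..N}. \<epsilon> \<le> \<bar>Y j \<omega> - Y m \<omega>\<bar>} \<in> sets (F N)"
      by measurable
    then show ?thesis by (simp add: S_def space_F)
  qed
  then have S [measurable]: "S N \<in> sets M" by (rule sets_F_M)
  define T where "T = {\<omega> \<in> space M. \<epsilon> \<le> \<bar>Y (Suc N) \<omega> - Y m \<omega>\<bar>} - S N"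
  have T [measurable]: "T \<in> sets M" unfolding T_def by measurable
  have ST: "S (Suc N) = S N \<union> T" "S N \<inter> T = {}"
    using step.hyps by (auto simp: S_def T_def atLeastAtMostSuc_conv)
  \<comment> \<open>half the coefficient of the increment \<open>Y (Suc N) - Y N\<close> in the expansion of the next square on \<open>S N\<close>\<close>
  define U where "U = (\<lambda>\<omega>. indicator (S N) \<omega> * (Y N \<omega> - Y m \<omega>))"
  have Um: "U \<in> borel_measurable (F N)"
    unfolding U_def using SF adapted step measurable_later[of m N]
    by (intro borel_measurable_times borel_measurable_diff) auto
  have [measurable]: "U \<in> borel_measurable M" by (rule measurable_M[OF Um])
  have D2: "integrable M (\<lambda>\<omega>. (Y n \<omega> - Y m \<omega>)\<^sup>2)" for n
    by (intro square_integrable_diff square_integrable_Y) auto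
  have U2: "integrable M (\<lambda>\<omega>. (U \<omega>)\<^sup>2)"
    by (rule Bochner_Integration.integrable_bound[OF D2[of N]]) (auto simp: U_def indicator_def)
  have iD: "integrable M (\<lambda>\<omega>. indicator A \<omega> * (Y n \<omega> - Y m \<omega>)\<^sup>2)" if "A \<in> sets M" for A n
    using integrable_mult_indicator[OF that D2[of n]] by simp
  have iUD: "integrable M (\<lambda>\<omega>. U \<omega> * (Y (Suc N) \<omega> - Y N \<omega>))"
    by (intro product_integrable U2 square_integrable_diff square_integrable_Y) auto
  have "(\<integral>\<omega>. U \<omega> * (Y (Suc N) \<omega> - Y N \<omega>) \<partial>M)
      = (\<integral>\<omega>. U \<omega> * Y (Suc N) \<omega> \<partial>M) - (\<integral>\<omega>. U \<omega> * Y N \<omega> \<partial>M)"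
    unfolding right_diff_distrib
    by (intro Bochner_Integration.integral_diff product_integrable U2 square_integrable_Y) auto
  then have UD: "(\<integral>\<omega>. U \<omega> * (Y (Suc N) \<omega> - Y N \<omega>) \<partial>M) = 0"
    using integral_mult_step[OF Um U2] by simp
  have "\<epsilon>\<^sup>2 * prob (S (Suc N)) = \<epsilon>\<^sup>2 * prob (S N) + \<epsilon>\<^sup>2 * prob T"
    unfolding ST(1) by (subst finite_measure_Union[OF S T ST(2)]) (simp add: algebra_simps)
  also have "\<epsilon>\<^sup>2 * prob T = (\<integral>\<omega>. indicator T \<omega> * \<epsilon>\<^sup>2 \<partial>M)"
    by simp
  also have "\<dots> \<le> (\<integral>\<omega>. indicator T \<omega> * (Y (Suc N) \<omega> - Y m \<omega>)\<^sup>2 \<partial>M)"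
  proof (intro integral_mono iD T)
    fix \<omega> assume "\<omega> \<in> space M"
    then show "indicator T \<omega> * \<epsilon>\<^sup>2 \<le> indicator T \<omega> * (Y (Suc N) \<omega> - Y m \<omega>)\<^sup>2"
      using e by (auto simp: T_def indicator_def simp flip: abs_le_square_iff)
  next
    show "integrable M (\<lambda>\<omega>. indicator T \<omega> * \<epsilon>\<^sup>2)" 
      by (rule integrable_const_bound[of _ "\<epsilon>\<^sup>2"]) (auto simp: indicator_def)
  qed
  also have "\<epsilon>\<^sup>2 * prob (S N) \<le> (\<integral>\<omega>. indicator (S N) \<omega> * (Y N \<omega> - Y m \<omega>)\<^sup>2 \<partial>M)"
    by (rule step.IH)
  also have "\<dots> = (\<integral>\<omega>. indicator (S N) \<omega> * (Y N \<omega> - Y m \<omega>)\<^sup>2 + 2 * (U \<omega> * (Y (Suc N) \<omega> - Y N \<omega>)) \<partial>M)"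
    using iD[OF S, of N] iUD UD by simp
  also have "\<dots> \<le> (\<integral>\<omega>. indicator (S N) \<omega> * (Y (Suc N) \<omega> - Y m \<omega>)\<^sup>2 \<partial>M)"
  proof (intro integral_mono iD S Bochner_Integration.integrable_add integrable_mult_right iUD)
    fix \<omega>
    have "(Y N \<omega> - Y m \<omega>)\<^sup>2 + 2 * ((Y N \<omega> - Y m \<omega>) * (Y (Suc N) \<omega> - Y N \<omega>))
        \<le> (Y (Suc N) \<omega> - Y m \<omega>)\<^sup>2"
      using zero_le_power2[of "Y (Suc N) \<omega> - Y N \<omega>"] by (simp add: power2_eq_square algebra_simps)
    then show "indicator (S N) \<omega> * (Y N \<omega> - Y m \<omega>)\<^sup>2 + 2 * (U \<omega> * (Y (Suc N) \<omega> - Y N \<omega>))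
        \<le> indicator (S N) \<omega> * (Y (Suc N) \<omega> - Y m \<omega>)\<^sup>2"
      by (auto simp: U_def indicator_def)
  qed
  finally have "\<epsilon>\<^sup>2 * prob (S (Suc N)) \<le> (\<integral>\<omega>. indicator (S N) \<omega> * (Y (Suc N) \<omega> - Y m \<omega>)\<^sup>2 \<partial>M)
      + (\<integral>\<omega>. indicator T \<omega> * (Y (Suc N) \<omega> - Y m \<omega>)\<^sup>2 \<partial>M)"
    by simp
  also have "\<dots> = (\<integral>\<omega>. indicator (S (Suc N)) \<omega> * (Y (Suc N) \<omega> - Y m \<omega>)\<^sup>2 \<partial>M)"
    unfolding ST(1) using ST(2)
    by (subst Bochner_Integration.integral_add[symmetric, OF iD[OF S] iD[OF T]])
      (auto simp: indicator_def intro!: Bochner_Integration.integral_cong)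
  finally show ?case .
qed

lemma limit_of_squares:
  obtains \<alpha> where "(\<lambda>n. \<integral>\<omega>. (Y n \<omega>)\<^sup>2 \<partial>M) \<longlonglongrightarrow> \<alpha>"
    and "\<And>n m. n \<le> m \<Longrightarrow> (\<integral>\<omega>. (Y m \<omega> - Y n \<omega>)\<^sup>2 \<partial>M) \<le> \<alpha> - (\<integral>\<omega>. (Y n \<omega>)\<^sup>2 \<partial>M)"
proof -
  let ?a = "\<lambda>n. \<integral>\<omega>. (Y n \<omega>)\<^sup>2 \<partial>M"
  have mono: "?a n \<le> ?a m" if "n \<le> m" for n m
    using integral_square_diff[OF that] integral_nonneg_AE[of "\<lambda>\<omega>. (Y m \<omega> - Y n \<omega>)\<^sup>2" M] by simp
  have "?a n \<le> 1 + C" for n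
  proof -
    have "?a n \<le> (\<integral>\<omega>. 1 + \<bar>Y n \<omega>\<bar> powr p \<partial>M)"
      by (intro integral_mono square_integrable_Y square_le_powr Bochner_Integration.integrable_add
        integrable_powr) auto
    also have "\<dots> \<le> 1 + C" using integrable_powr bounded by (simp add: prob_space)
    finally show ?thesis .
  qed
  then obtain \<alpha> where \<alpha>: "?a \<longlonglongrightarrow> \<alpha>" "\<And>n. ?a n \<le> \<alpha>"
    using incseq_convergent[of ?a "1 + C"] mono by (auto simp: incseq_def)
  show thesis
    using \<alpha> integral_square_diff by (intro that[of \<alpha>]) auto
qed

text \<open>
  The second moments increase to a finite limit, so the maximal inequality bounds the
  probability of an oscillation of size \<open>\<epsilon>\<close> after time \<open>m\<close> by a quantity that tends to 0 as \<open>m\<close>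
  grows.
\<close>

lemma AE_Cauchy: "AE \<omega> in M. Cauchy (\<lambda>n. Y n \<omega>)"
proof -
  obtain \<alpha> where \<alpha>: "(\<lambda>n. \<integral>\<omega>. (Y n \<omega>)\<^sup>2 \<partial>M) \<longlonglongrightarrow> \<alpha>"
    and le: "\<And>n m. n \<le> m \<Longrightarrow> (\<integral>\<omega>. (Y m \<omega> - Y n \<omega>)\<^sup>2 \<partial>M) \<le> \<alpha> - (\<integral>\<omega>. (Y n \<omega>)\<^sup>2 \<partial>M)"
    by (rule limit_of_squares) blast
  define E where "E \<epsilon> m = {\<omega> \<in> space M. \<exists>j\<in>{m..}. \<epsilon> \<le> \<bar>Y j \<omega> - Y m \<omega>\<bar>}" for \<epsilon> m
  have [measurable]: "E \<epsilon> m \<in> sets M" for \<epsilon> m unfolding E_def by measurable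
  have E_le: "\<epsilon>\<^sup>2 * prob (E \<epsilon> m) \<le> \<alpha> - (\<integral>\<omega>. (Y m \<omega>)\<^sup>2 \<partial>M)" if e: "0 < \<epsilon>" for \<epsilon> m
  proof -
    define S where "S N = {\<omega> \<in> space M. \<exists>j\<in>{m..N}. \<epsilon> \<le> \<bar>Y j \<omega> - Y m \<omega>\<bar>}" for N
    have [measurable]: "S N \<in> sets M" for N unfolding S_def by measurable
    have "\<epsilon>\<^sup>2 * prob (S N) \<le> \<alpha> - (\<integral>\<omega>. (Y m \<omega>)\<^sup>2 \<partial>M)" if "m \<le> N" for N
    proof -
      have i: "integrable M (\<lambda>\<omega>. (Y N \<omega> - Y m \<omega>)\<^sup>2)"
        by (intro square_integrable_diff square_integrable_Y) auto
      have "\<epsilon>\<^sup>2 * prob (S N) \<le> (\<integral>\<omega>. indicator (S N) \<omega> * (Y N \<omega> - Y m \<omega>)\<^sup>2 \<partial>M)"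
        unfolding S_def by (rule maximal_inequality[OF e that])
      also have "\<dots> \<le> (\<integral>\<omega>. (Y N \<omega> - Y m \<omega>)\<^sup>2 \<partial>M)"
        using integrable_mult_indicator[OF _ i, of "S N"]
        by (intro integral_mono i) (auto simp: indicator_def)
      also have "\<dots> \<le> \<alpha> - (\<integral>\<omega>. (Y m \<omega>)\<^sup>2 \<partial>M)" by (rule le[OF that])
      finally show ?thesis .
    qed
    moreover have "(\<lambda>N. \<epsilon>\<^sup>2 * prob (S N)) \<longlonglongrightarrow> \<epsilon>\<^sup>2 * prob (\<Union>N. S N)"
      by (intro tendsto_intros finite_Lim_measure_incseq) (auto simp: incseq_def S_def)
    moreover have "(\<Union>N. S N) = E \<epsilon> m" by (fastforce simp: S_def E_def)
    ultimately show ?thesis by (intro LIMSEQ_le_const2[of "\<lambda>N. \<epsilon>\<^sup>2 * prob (S N)"]) auto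
  qed
  have "AE \<omega> in M. \<forall>q::nat. \<exists>m. \<omega> \<notin> E (1 / Suc q) m"
    unfolding AE_all_countable
  proof
    fix q :: nat
    let ?e = "1 / real (Suc q)"
    have "(\<lambda>m. (\<alpha> - (\<integral>\<omega>. (Y m \<omega>)\<^sup>2 \<partial>M)) / ?e\<^sup>2) \<longlonglongrightarrow> (\<alpha> - \<alpha>) / ?e\<^sup>2"
      by (intro tendsto_intros \<alpha>) auto
    moreover have "prob (\<Inter>m. E ?e m) \<le> (\<alpha> - (\<integral>\<omega>. (Y m \<omega>)\<^sup>2 \<partial>M)) / ?e\<^sup>2" for m
    proof -
      have "prob (\<Inter>m. E ?e m) \<le> prob (E ?e m)" by (intro finite_measure_mono) auto
      also have "\<dots> \<le> (\<alpha> - (\<integral>\<omega>. (Y m \<omega>)\<^sup>2 \<partial>M)) / ?e\<^sup>2"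
        using E_le[of ?e m] by (simp add: pos_le_divide_eq mult.commute del: of_nat_Suc)
      finally show ?thesis .
    qed
    ultimately have "prob (\<Inter>m. E ?e m) \<le> 0"
      by (intro LIMSEQ_le_const[of "\<lambda>m. (\<alpha> - (\<integral>\<omega>. (Y m \<omega>)\<^sup>2 \<partial>M)) / ?e\<^sup>2"]) auto
    then have "(\<Inter>m. E ?e m) \<in> null_sets M"
      by (intro null_setsI) (auto simp: emeasure_eq_measure measure_le_0_iff)
    then show "AE \<omega> in M. \<exists>m. \<omega> \<notin> E ?e m"
      by (rule AE_I') auto
  qed
  with AE_space show ?thesis
  proof eventually_elim
    case (elim \<omega>)
    show ?case unfolding Cauchy_altdef2
    proof safe
      fix e :: real assume "0 < e"
      then obtain q where q: "1 / real (Suc q) < e"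
        using nat_approx_posE by blast
      obtain m where "\<omega> \<notin> E (1 / Suc q) m" using elim by blast
      then have "\<bar>Y j \<omega> - Y m \<omega>\<bar> < e" if "m \<le> j" for j
        using elim(1) q that by (force simp: E_def not_le)
      then show "\<exists>N. \<forall>n\<ge>N. dist (Y n \<omega>) (Y N \<omega>) < e"
        by (auto simp: dist_real_def)
    qed
  qed
qed

definition "Ylim = (\<lambda>\<omega>. lim (\<lambda>n. Y n \<omega>))"

lemma Ylim_measurable [measurable]: "Ylim \<in> borel_measurable M"
  unfolding Ylim_def by measurable

lemma AE_tendsto_Ylim: "AE \<omega> in M. (\<lambda>n. Y n \<omega>) \<longlonglongrightarrow> Ylim \<omega>"
  using AE_Cauchy unfolding Ylim_def
  by eventually_elim (auto simp: Cauchy_convergent_iff convergent_LIMSEQ_iff)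

lemma integrable_powr_Ylim: "integrable M (\<lambda>\<omega>. \<bar>Ylim \<omega>\<bar> powr p)"
proof (rule Fatou_integral_le(1)[where c = C])
  show "AE \<omega> in M. (\<lambda>n. \<bar>Y n \<omega>\<bar> powr p) \<longlonglongrightarrow> \<bar>Ylim \<omega>\<bar> powr p"
    using AE_tendsto_Ylim
    by eventually_elim (rule tendsto_abs_powr[OF _ p_ge_2])
qed (use integrable_powr bounded in auto)

lemma square_integrable_Ylim: "integrable M (\<lambda>\<omega>. (Ylim \<omega>)\<^sup>2)"
  by (rule square_integrable[OF Ylim_measurable integrable_powr_Ylim])

lemma integrable_Ylim: "integrable M Ylim"
  by (rule integrable_of_square[OF Ylim_measurable square_integrable_Ylim])

text \<open>
  By Fatou's lemma the second moment of \<open>Y n - Ylim\<close> is at most the limit of the second moments of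
  the increments after time \<open>n\<close>, and the first moment is at most the root of the second.
\<close>

lemma L1_convergence: "(\<lambda>n. \<integral>\<omega>. \<bar>Y n \<omega> - Ylim \<omega>\<bar> \<partial>M) \<longlonglongrightarrow> 0"
proof -
  obtain \<alpha> where \<alpha>: "(\<lambda>n. \<integral>\<omega>. (Y n \<omega>)\<^sup>2 \<partial>M) \<longlonglongrightarrow> \<alpha>"
    and le: "\<And>n m. n \<le> m \<Longrightarrow> (\<integral>\<omega>. (Y m \<omega> - Y n \<omega>)\<^sup>2 \<partial>M) \<le> \<alpha> - (\<integral>\<omega>. (Y n \<omega>)\<^sup>2 \<partial>M)"
    by (rule limit_of_squares) blast
  have sq: "(\<integral>\<omega>. (Y n \<omega> - Ylim \<omega>)\<^sup>2 \<partial>M) \<le> \<alpha> - (\<integral>\<omega>. (Y n \<omega>)\<^sup>2 \<partial>M)" for n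
  proof (rule Fatou_integral_le(2))
    show "AE \<omega> in M. (\<lambda>m. (Y m \<omega> - Y n \<omega>)\<^sup>2) \<longlonglongrightarrow> (Y n \<omega> - Ylim \<omega>)\<^sup>2"
      using AE_tendsto_Ylim
    proof eventually_elim
      case (elim \<omega>)
      then have "(\<lambda>m. (Y m \<omega> - Y n \<omega>)\<^sup>2) \<longlonglongrightarrow> (Ylim \<omega> - Y n \<omega>)\<^sup>2"
        by (intro tendsto_intros)
      then show ?case by (simp add: power2_commute)
    qed
    show "\<forall>\<^sub>F m in sequentially. (\<integral>\<omega>. (Y m \<omega> - Y n \<omega>)\<^sup>2 \<partial>M) \<le> \<alpha> - (\<integral>\<omega>. (Y n \<omega>)\<^sup>2 \<partial>M)"
      by (intro eventually_sequentiallyI le)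
    show "integrable M (\<lambda>\<omega>. (Y m \<omega> - Y n \<omega>)\<^sup>2)" for m
      by (intro square_integrable_diff square_integrable_Y) auto
  qed auto
  have "(\<lambda>n. sqrt (\<alpha> - (\<integral>\<omega>. (Y n \<omega>)\<^sup>2 \<partial>M))) \<longlonglongrightarrow> sqrt (\<alpha> - \<alpha>)"
    by (intro tendsto_intros \<alpha>)
  then have *: "(\<lambda>n. sqrt (\<alpha> - (\<integral>\<omega>. (Y n \<omega>)\<^sup>2 \<partial>M))) \<longlonglongrightarrow> 0" by simp
  show ?thesis
  proof (rule tendsto_sandwich[OF _ _ tendsto_const *])
    show "\<forall>\<^sub>F n in sequentially. (\<integral>\<omega>. \<bar>Y n \<omega> - Ylim \<omega>\<bar> \<partial>M) \<le> sqrt (\<alpha> - (\<integral>\<omega>. (Y n \<omega>)\<^sup>2 \<partial>M))"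
    proof (intro always_eventually allI real_le_rsqrt)
      fix n
      let ?D = "\<lambda>\<omega>. \<bar>Y n \<omega> - Ylim \<omega>\<bar>"
      have D2: "integrable M (\<lambda>\<omega>. (?D \<omega>)\<^sup>2)"
        unfolding power2_abs
        by (intro square_integrable_diff square_integrable_Y square_integrable_Ylim) auto
      have D: "integrable M ?D"
        using integrable_Y integrable_Ylim by auto
      have "(\<integral>\<omega>. ?D \<omega> \<partial>M)\<^sup>2 \<le> (\<integral>\<omega>. (?D \<omega>)\<^sup>2 \<partial>M)"
        using variance_eq[OF D D2] variance_positive[of ?D] by simp
      then show "(\<integral>\<omega>. ?D \<omega> \<partial>M)\<^sup>2 \<le> \<alpha> - (\<integral>\<omega>. (Y n \<omega>)\<^sup>2 \<partial>M)"
        using sq[of n] by simp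
    qed
  qed auto
qed

text \<open>
  Integrals over an event of the past are constant along the martingale and, by convergence in
  \<open>L\<^sub>1\<close>, tend to the integral of the limit.
\<close>

lemma cond_exp_Ylim: "AE \<omega> in M. real_cond_exp M (F n) Ylim \<omega> = Y n \<omega>"
proof -
  interpret sigma_finite_subalgebra M "F n" by (rule sigma_finite_F)
  show ?thesis
  proof (rule real_cond_exp_charact)
    fix A assume A: "A \<in> sets (F n)"
    then have [measurable]: "A \<in> sets M" by (rule sets_F_M)
    have iA: "integrable M (\<lambda>\<omega>. indicator A \<omega> * Y m \<omega>)" for m
      using integrable_mult_indicator[OF _ integrable_Y, of A m] by simp
    have iAL: "integrable M (\<lambda>\<omega>. indicator A \<omega> * Ylim \<omega>)"
      using integrable_mult_indicator[OF _ integrable_Ylim, of A] by simp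
    have "(\<lambda>m. (\<integral>\<omega>. indicator A \<omega> * Y m \<omega> \<partial>M) - (\<integral>\<omega>. indicator A \<omega> * Ylim \<omega> \<partial>M)) \<longlonglongrightarrow> 0"
    proof (rule tendsto_rabs_zero_cancel, rule tendsto_sandwich[OF _ _ tendsto_const L1_convergence])
      show "\<forall>\<^sub>F m in sequentially. \<bar>(\<integral>\<omega>. indicator A \<omega> * Y m \<omega> \<partial>M) - (\<integral>\<omega>. indicator A \<omega> * Ylim \<omega> \<partial>M)\<bar>
          \<le> (\<integral>\<omega>. \<bar>Y m \<omega> - Ylim \<omega>\<bar> \<partial>M)"
      proof (intro always_eventually allI)
        fix m
        have "\<bar>(\<integral>\<omega>. indicator A \<omega> * Y m \<omega> \<partial>M) - (\<integral>\<omega>. indicator A \<omega> * Ylim \<omega> \<partial>M)\<bar>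
            = \<bar>\<integral>\<omega>. indicator A \<omega> * Y m \<omega> - indicator A \<omega> * Ylim \<omega> \<partial>M\<bar>"
          using iA iAL by simp
        also have "\<dots> \<le> (\<integral>\<omega>. \<bar>indicator A \<omega> * Y m \<omega> - indicator A \<omega> * Ylim \<omega>\<bar> \<partial>M)"
          by (rule integral_abs_bound)
        also have "\<dots> \<le> (\<integral>\<omega>. \<bar>Y m \<omega> - Ylim \<omega>\<bar> \<partial>M)"
          using iA iAL integrable_Y integrable_Ylim
          by (intro integral_mono integrable_abs Bochner_Integration.integrable_diff)
            (auto simp: indicator_def)
        finally show "\<bar>(\<integral>\<omega>. indicator A \<omega> * Y m \<omega> \<partial>M) - (\<integral>\<omega>. indicator A \<omega> * Ylim \<omega> \<partial>M)\<bar>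
          \<le> (\<integral>\<omega>. \<bar>Y m \<omega> - Ylim \<omega>\<bar> \<partial>M)" .
      qed
    qed auto
    then have 1: "(\<lambda>m. \<integral>\<omega>. indicator A \<omega> * Y m \<omega> \<partial>M) \<longlonglongrightarrow> (\<integral>\<omega>. indicator A \<omega> * Ylim \<omega> \<partial>M)"
      by (simp add: LIM_zero_iff)
    have "(\<integral>\<omega>. indicator A \<omega> * Y m \<omega> \<partial>M) = (\<integral>\<omega>. indicator A \<omega> * Y n \<omega> \<partial>M)" if "n \<le> m" for m
    proof (rule integral_mult_later[OF _ _ that])
      show "indicator A \<in> borel_measurable (F n)" using A by simp
      show "integrable M (\<lambda>\<omega>. (indicator A \<omega> :: real)\<^sup>2)"
        by (rule integrable_const_bound[of _ 1]) (auto simp: indicator_def)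
    qed
    then have "(\<lambda>m. \<integral>\<omega>. indicator A \<omega> * Y m \<omega> \<partial>M) \<longlonglongrightarrow> (\<integral>\<omega>. indicator A \<omega> * Y n \<omega> \<partial>M)"
      by (intro tendsto_eventually eventually_sequentiallyI)
    then show "(\<integral>\<omega>\<in>A. Ylim \<omega> \<partial>M) = (\<integral>\<omega>\<in>A. Y n \<omega> \<partial>M)"
      using 1 LIMSEQ_unique unfolding set_lebesgue_integral_def real_scaleR_def by blast
  qed (rule integrable_Y integrable_Ylim adapted)+
qed

text \<open>
  Conditional Jensen inequality, as \<open>Y n\<close> is a conditional expectation of the limit.
\<close>

lemma integral_powr_le_Ylim: "(\<integral>\<omega>. \<bar>Y n \<omega>\<bar> powr p \<partial>M) \<le> (\<integral>\<omega>. \<bar>Ylim \<omega>\<bar> powr p \<partial>M)"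
proof -
  interpret sigma_finite_subalgebra M "F n" by (rule sigma_finite_F)
  have "AE \<omega> in M. \<bar>real_cond_exp M (F n) Ylim \<omega>\<bar> powr p
      \<le> real_cond_exp M (F n) (\<lambda>\<omega>. \<bar>Ylim \<omega>\<bar> powr p) \<omega>"
    by (rule real_cond_exp_jensens_inequality(2)[where I = UNIV])
      (use integrable_Ylim integrable_powr_Ylim convex_abs_powr p_ge_2 in auto)
  then have "AE \<omega> in M. \<bar>Y n \<omega>\<bar> powr p \<le> real_cond_exp M (F n) (\<lambda>\<omega>. \<bar>Ylim \<omega>\<bar> powr p) \<omega>"
    using cond_exp_Ylim[of n] by eventually_elim simp
  then have "(\<integral>\<omega>. \<bar>Y n \<omega>\<bar> powr p \<partial>M) \<le> (\<integral>\<omega>. real_cond_exp M (F n) (\<lambda>\<omega>. \<bar>Ylim \<omega>\<bar> powr p) \<omega> \<partial>M)"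
    by (intro integral_mono_AE integrable_powr real_cond_exp_int integrable_powr_Ylim)
  also have "\<dots> = (\<integral>\<omega>. \<bar>Ylim \<omega>\<bar> powr p \<partial>M)"
    by (rule real_cond_exp_int(2)[OF integrable_powr_Ylim])
  finally show ?thesis .
qed

text \<open>
  F. Riesz's argument.  The functions \<open>g n\<close> below are nonnegative and converge to
  \<open>2\<^sup>p \<cdot> 2 \<bar>Ylim\<bar>\<^sup>p\<close>, while their integrals fall short of the integral of that limit by at
  least \<open>?d n\<close>, since the moments of \<open>Y n\<close> do not exceed those of \<open>Ylim\<close>.  If \<open>?d n\<close> stayed
  above some \<open>\<epsilon>\<close> along a subsequence, this would contradict Fatou's lemma.
\<close>

lemma tendsto_in_Lp_Ylim: "tendsto_in_Lp M p Y Ylim"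
proof -
  let ?d = "\<lambda>n. \<integral>\<omega>. \<bar>Y n \<omega> - Ylim \<omega>\<bar> powr p \<partial>M"
  let ?e = "\<integral>\<omega>. \<bar>Ylim \<omega>\<bar> powr p \<partial>M"
  have d_nonneg: "0 \<le> ?d n" for n by (simp add: integral_nonneg_AE)
  have i_d: "integrable M (\<lambda>\<omega>. \<bar>Y n \<omega> - Ylim \<omega>\<bar> powr p)" for n
  proof (rule Bochner_Integration.integrable_bound)
    show "integrable M (\<lambda>\<omega>. 2 powr p * (\<bar>Y n \<omega>\<bar> powr p + \<bar>Ylim \<omega>\<bar> powr p))"
      using integrable_powr integrable_powr_Ylim by auto
    show "AE \<omega> in M. norm (\<bar>Y n \<omega> - Ylim \<omega>\<bar> powr p)
        \<le> norm (2 powr p * (\<bar>Y n \<omega>\<bar> powr p + \<bar>Ylim \<omega>\<bar> powr p))"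
      using abs_diff_powr_le p_ge_2 by (auto simp: abs_mult)
  qed auto
  define g where "g n \<omega> = 2 powr p * (\<bar>Y n \<omega>\<bar> powr p + \<bar>Ylim \<omega>\<bar> powr p) - \<bar>Y n \<omega> - Ylim \<omega>\<bar> powr p" for n \<omega>
  have g_int: "integrable M (g n)" for n
    unfolding g_def using integrable_powr integrable_powr_Ylim i_d by auto
  have g_nonneg: "0 \<le> g n \<omega>" for n \<omega>
    using abs_diff_powr_le[of p "Y n \<omega>" "Ylim \<omega>"] p_ge_2 by (simp add: g_def)
  have g_lim: "AE \<omega> in M. (\<lambda>n. g n \<omega>) \<longlonglongrightarrow> 2 powr p * (2 * \<bar>Ylim \<omega>\<bar> powr p)"
    using AE_tendsto_Ylim
  proof eventually_elim
    case (elim \<omega>)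
    have 1: "(\<lambda>n. \<bar>Y n \<omega>\<bar> powr p) \<longlonglongrightarrow> \<bar>Ylim \<omega>\<bar> powr p"
      using elim by (intro tendsto_abs_powr[OF _ p_ge_2] tendsto_intros)
    have "(\<lambda>n. \<bar>Y n \<omega> - Ylim \<omega>\<bar> powr p) \<longlonglongrightarrow> \<bar>Ylim \<omega> - Ylim \<omega>\<bar> powr p"
      using elim by (intro tendsto_abs_powr[OF _ p_ge_2] tendsto_intros)
    then have "(\<lambda>n. g n \<omega>) \<longlonglongrightarrow> 2 powr p * (\<bar>Ylim \<omega>\<bar> powr p + \<bar>Ylim \<omega>\<bar> powr p) - \<bar>Ylim \<omega> - Ylim \<omega>\<bar> powr p"
      unfolding g_def by (intro tendsto_diff tendsto_add tendsto_mult tendsto_const 1)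
    then show ?case by simp
  qed
  have g_integral: "(\<integral>\<omega>. g n \<omega> \<partial>M) \<le> 2 powr p * (2 * ?e) - ?d n" for n
  proof -
    have "(\<integral>\<omega>. g n \<omega> \<partial>M) = 2 powr p * ((\<integral>\<omega>. \<bar>Y n \<omega>\<bar> powr p \<partial>M) + ?e) - ?d n"
      unfolding g_def using integrable_powr integrable_powr_Ylim i_d by simp
    also have "\<dots> \<le> 2 powr p * (2 * ?e) - ?d n"
      using integral_powr_le_Ylim[of n] by simp
    finally show ?thesis .
  qed
  have "?d \<longlonglongrightarrow> 0"
  proof (rule ccontr)
    assume "\<not> ?d \<longlonglongrightarrow> 0"
    then obtain \<epsilon> where \<epsilon>: "0 < \<epsilon>" "\<And>N. \<exists>n\<ge>N. \<epsilon> \<le> ?d n"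
      unfolding LIMSEQ_iff using d_nonneg by (auto simp: not_less)
    then have "\<exists>\<^sub>\<infinity>n. \<epsilon> \<le> ?d n" by (simp add: INFM_nat_le)
    then obtain s :: "nat \<Rightarrow> nat" where s: "strict_mono s" "\<And>n. \<epsilon> \<le> ?d (s n)"
      using infinite_enumerate[of "{n. \<epsilon> \<le> ?d n}"] by (auto simp: frequently_cofinite)
    have "(\<integral>\<omega>. 2 powr p * (2 * \<bar>Ylim \<omega>\<bar> powr p) \<partial>M) \<le> 2 powr p * (2 * ?e) - \<epsilon>"
    proof (rule Fatou_integral_le(2))
      show "AE \<omega> in M. (\<lambda>n. g (s n) \<omega>) \<longlonglongrightarrow> 2 powr p * (2 * \<bar>Ylim \<omega>\<bar> powr p)"
        using g_lim by eventually_elim (use LIMSEQ_subseq_LIMSEQ[OF _ s(1)] in \<open>auto simp: comp_def\<close>)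
      show "\<forall>\<^sub>F n in sequentially. (\<integral>\<omega>. g (s n) \<omega> \<partial>M) \<le> 2 powr p * (2 * ?e) - \<epsilon>"
      proof (intro always_eventually allI)
        show "(\<integral>\<omega>. g (s n) \<omega> \<partial>M) \<le> 2 powr p * (2 * ?e) - \<epsilon>" for n
          using g_integral[of "s n"] s(2)[of n] by linarith
      qed
    qed (use g_int g_nonneg in auto)
    then show False using \<epsilon>(1) by simp
  qed
  then show ?thesis
    using integrable_powr integrable_powr_Ylim by (simp add: tendsto_in_Lp_def in_Lp_def)
qed

end

section \<open>The martingale of total masses\<close>

lemma (in prob_space) indep_var_nn_integral_mult:
  assumes ind: "indep_var N X N' Y"
    and [measurable]: "u \<in> borel_measurable N" "v \<in> borel_measurable N'"
  shows "(\<integral>\<^sup>+\<omega>. u (X \<omega>) * v (Y \<omega>) \<partial>M) = (\<integral>\<^sup>+\<omega>. u (X \<omega>) \<partial>M) * (\<integral>\<^sup>+\<omega>. v (Y \<omega>) \<partial>M)"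
proof -
  have "indep_var borel (u \<circ> X) borel (v \<circ> Y)"
    by (rule indep_var_compose[OF ind]) auto
  then have "indep_vars (\<lambda>_. borel) (case_bool (u \<circ> X) (v \<circ> Y)) UNIV"
    unfolding indep_var_def by (rule indep_vars_cong[THEN iffD1, rotated -1]) (auto split: bool.split)
  from indep_vars_nn_integral[OF _ this] show ?thesis
    by (simp add: UNIV_bool mult.commute comp_def)
qed

text \<open>
  Densities and masses are treated as extended nonnegative functions.  The coercion \<open>ennreal\<close>
  sends negative values to 0 and so changes the fields on a null event only.
\<close>

locale random_fields = prob_space M
  for M :: "'w measure" +
  fixes \<Lambda> :: "nat \<Rightarrow> 'a::euclidean_space \<Rightarrow> 'w \<Rightarrow> real"
  assumes independent: "independent_fields M \<Lambda>"
    and joint: "\<And>i. jointly_measurable M (\<Lambda> i)"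
    and nonneg: "\<And>i. AE \<omega> in M. \<forall>\<theta>\<in>sphere 0 1. 0 \<le> \<Lambda> i \<theta> \<omega>"
    and integrable: "\<And>i \<theta>. \<theta> \<in> sphere 0 1 \<Longrightarrow> integrable M (\<Lambda> i \<theta>)"
    and mean: "\<And>i \<theta>. \<theta> \<in> sphere 0 1 \<Longrightarrow> (\<integral>\<omega>. \<Lambda> i \<theta> \<omega> \<partial>M) = 1"
begin

abbreviation \<sigma> :: "'a measure" where "\<sigma> \<equiv> sphere_measure"
abbreviation S :: "'a set" where "S \<equiv> sphere 0 1"

lemma \<Lambda>_measurable [measurable (raw)]:
  assumes "f \<in> N \<rightarrow>\<^sub>M \<sigma>" "g \<in> N \<rightarrow>\<^sub>M M"
  shows "(\<lambda>x. \<Lambda> i (f x) (g x)) \<in> borel_measurable N"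
proof -
  have "f \<in> N \<rightarrow>\<^sub>M sphere_borel"
    using assms(1) by (simp cong: measurable_cong_sets)
  from measurable_compose[OF measurable_Pair[OF this assms(2)] joint[unfolded jointly_measurable_def]]
  show ?thesis by simp
qed

lemma section_measurable: "\<theta> \<in> S \<Longrightarrow> \<Lambda> i \<theta> \<in> borel_measurable M"
  using \<Lambda>_measurable[of "\<lambda>_. \<theta>" M "\<lambda>x. x"] by simp

definition partial_prod :: "nat \<Rightarrow> 'a \<Rightarrow> 'w \<Rightarrow> ennreal" where
  "partial_prod n \<theta> \<omega> = (\<Prod>i=0..n. ennreal (\<Lambda> i \<theta> \<omega>))"

lemma partial_prod_measurable [measurable (raw)]:
  assumes [measurable]: "f \<in> N \<rightarrow>\<^sub>M \<sigma>" "g \<in> N \<rightarrow>\<^sub>M M"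
  shows "(\<lambda>x. partial_prod n (f x) (g x)) \<in> borel_measurable N"
  unfolding partial_prod_def by measurable

definition mass :: "nat \<Rightarrow> 'a set \<Rightarrow> 'w \<Rightarrow> ennreal" where
  "mass n B \<omega> = (\<integral>\<^sup>+\<theta>. partial_prod n \<theta> \<omega> * indicator B \<theta> \<partial>\<sigma>)"

sublocale \<sigma>: finite_measure \<sigma>
  by (rule finite_measure_sphere_measure)

sublocale \<sigma>M: pair_sigma_finite \<sigma> M ..

lemma mass_measurable [measurable]:
  assumes [measurable]: "B \<in> sets \<sigma>"
  shows "mass n B \<in> borel_measurable M"
  unfolding mass_def by measurable

lemma nn_integral_mass_mult:
  assumes [measurable]: "B \<in> sets \<sigma>" "w \<in> borel_measurable M"
  shows "(\<integral>\<^sup>+\<omega>. mass n B \<omega> * w \<omega> \<partial>M)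
    = (\<integral>\<^sup>+\<theta>. (\<integral>\<^sup>+\<omega>. partial_prod n \<theta> \<omega> * w \<omega> \<partial>M) * indicator B \<theta> \<partial>\<sigma>)"
proof -
  have "(\<integral>\<^sup>+\<omega>. mass n B \<omega> * w \<omega> \<partial>M)
      = (\<integral>\<^sup>+\<omega>. (\<integral>\<^sup>+\<theta>. partial_prod n \<theta> \<omega> * indicator B \<theta> * w \<omega> \<partial>\<sigma>) \<partial>M)"
    unfolding mass_def by (intro nn_integral_cong nn_integral_multc[symmetric]) measurable
  also have "\<dots> = (\<integral>\<^sup>+\<theta>. (\<integral>\<^sup>+\<omega>. partial_prod n \<theta> \<omega> * indicator B \<theta> * w \<omega> \<partial>M) \<partial>\<sigma>)"
    by (rule \<sigma>M.Fubini') measurable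
  also have "\<dots> = (\<integral>\<^sup>+\<theta>. (\<integral>\<^sup>+\<omega>. partial_prod n \<theta> \<omega> * w \<omega> \<partial>M) * indicator B \<theta> \<partial>\<sigma>)"
    by (intro nn_integral_cong) (auto simp: indicator_def)
  finally show ?thesis .
qed

definition history :: "nat \<Rightarrow> 'w \<Rightarrow> nat \<Rightarrow> 'a \<Rightarrow> real" where
  "history n \<omega> = (\<lambda>i\<in>{0..n}. \<lambda>\<theta>\<in>S. \<Lambda> i \<theta> \<omega>)"

abbreviation "history_space n \<equiv> (\<Pi>\<^sub>M i\<in>{0..n}. \<Pi>\<^sub>M \<theta>\<in>S. (borel :: real measure))"

text \<open>
  Generated through the product space over the sphere, the form in which independence of the fields is
  stated; so its events are the preimages under \<open>history n\<close>.
\<close>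

definition past :: "nat \<Rightarrow> 'w measure" where
  "past n = vimage_algebra (space M) (history n) (history_space n)"

lemma history_measurable [measurable]: "history n \<in> M \<rightarrow>\<^sub>M history_space n"
  unfolding history_def by (auto intro!: measurable_restrict section_measurable)

lemma history_past_measurable: "history n \<in> past n \<rightarrow>\<^sub>M history_space n"
  unfolding past_def using measurable_space[OF history_measurable]
  by (intro measurable_vimage_algebra1) auto

lemma space_past: "space (past n) = space M" by (simp add: past_def)

lemma sets_past: "sets (past n) = {history n -` C \<inter> space M | C. C \<in> sets (history_space n)}"
  unfolding past_def using measurable_space[OF history_measurable]
  by (intro sets_vimage_algebra2) auto

lemma subalgebra_past: "subalgebra M (past n)"
  using measurable_sets[OF history_measurable]
  by (auto simp: subalgebra_def space_past sets_past)

lemma past_mono: "sets (past n) \<subseteq> sets (past (Suc n))"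
proof
  fix A assume "A \<in> sets (past n)"
  then obtain C where C: "C \<in> sets (history_space n)" "A = history n -` C \<inter> space M"
    by (auto simp: sets_past)
  have [measurable]: "(\<lambda>h. restrict h {0..n}) \<in> history_space (Suc n) \<rightarrow>\<^sub>M history_space n"
    by (rule measurable_restrict_subset) auto
  have "history n \<omega> = restrict (history (Suc n) \<omega>) {0..n}" for \<omega>
    by (auto simp: history_def restrict_def)
  then have "history n = (\<lambda>\<omega>. restrict (history (Suc n) \<omega>) {0..n})" by auto
  also have "\<dots> \<in> past (Suc n) \<rightarrow>\<^sub>M history_space n"
    using history_past_measurable[of "Suc n"] by measurable
  finally show "A \<in> sets (past (Suc n))"
    using measurable_sets[OF _ C(1), of "history n" "past (Suc n)"] by (simp add: C(2) space_past)
qed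

lemma partial_prod_history:
  assumes "\<theta> \<in> S"
  shows "partial_prod n \<theta> \<omega> = (\<Prod>i=0..n. ennreal (history n \<omega> i \<theta>))"
  using assms by (simp add: partial_prod_def history_def)

lemma evaluation_measurable:
  assumes "\<theta> \<in> S" "i \<in> I"
  shows "(\<lambda>h. h i \<theta>) \<in> borel_measurable (\<Pi>\<^sub>M i\<in>I. \<Pi>\<^sub>M \<theta>\<in>S. (borel :: real measure))"
proof -
  have "(\<lambda>h. h i) \<in> (\<Pi>\<^sub>M i\<in>I. \<Pi>\<^sub>M \<theta>\<in>S. (borel :: real measure)) \<rightarrow>\<^sub>M (\<Pi>\<^sub>M \<theta>\<in>S. borel)"
    by (rule measurable_component_singleton[OF assms(2)])
  moreover have "(\<lambda>f. f \<theta>) \<in> (\<Pi>\<^sub>M \<theta>\<in>S. (borel :: real measure)) \<rightarrow>\<^sub>M borel"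
    by (rule measurable_component_singleton[OF assms(1)])
  ultimately show ?thesis by (rule measurable_compose)
qed

lemma partial_prod_past_measurable:
  assumes "\<theta> \<in> S"
  shows "partial_prod n \<theta> \<in> borel_measurable (past n)"
proof -
  have "(\<lambda>h. \<Prod>i=0..n. ennreal (h i \<theta>)) \<in> borel_measurable (history_space n)"
    using evaluation_measurable[OF assms] by measurable
  from measurable_compose[OF history_past_measurable this]
  show ?thesis by (simp add: partial_prod_history[OF assms, abs_def])
qed

lemma nn_integral_\<Lambda>:
  assumes "\<theta> \<in> S"
  shows "(\<integral>\<^sup>+\<omega>. ennreal (\<Lambda> i \<theta> \<omega>) \<partial>M) = 1"
proof -
  have "AE \<omega> in M. 0 \<le> \<Lambda> i \<theta> \<omega>" using nonneg[of i] by eventually_elim (use assms in auto)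
  then show ?thesis
    using nn_integral_eq_integral[OF integrable[OF assms]] mean[OF assms] by simp
qed

text \<open>
  The integrand splits into a function of the fields up to \<open>n\<close>, which includes the event \<open>A\<close>, and the
  value at \<open>\<theta>\<close> of the independent field \<open>n + 1\<close>, which has mean 1.
\<close>

lemma nn_integral_partial_prod_step:
  assumes \<theta>: "\<theta> \<in> S" and A: "A \<in> sets (past n)"
  shows "(\<integral>\<^sup>+\<omega>. partial_prod (Suc n) \<theta> \<omega> * indicator A \<omega> \<partial>M)
    = (\<integral>\<^sup>+\<omega>. partial_prod n \<theta> \<omega> * indicator A \<omega> \<partial>M)"
proof -
  obtain C where C [measurable]: "C \<in> sets (history_space n)" and AC: "A = history n -` C \<inter> space M"
    using A by (auto simp: sets_past)
  define u where "u h = (\<Prod>i=0..n. ennreal (h i \<theta>)) * indicator C h" for h :: "nat \<Rightarrow> 'a \<Rightarrow> real"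
  define v where "v h = ennreal (h (Suc n) \<theta>)" for h :: "nat \<Rightarrow> 'a \<Rightarrow> real"
  define next_field where "next_field \<omega> = (\<lambda>i\<in>{Suc n}. \<lambda>\<theta>\<in>S. \<Lambda> i \<theta> \<omega>)" for \<omega>
  have [measurable]: "u \<in> borel_measurable (history_space n)"
    unfolding u_def using evaluation_measurable[OF \<theta>] by measurable
  have v: "v \<in> borel_measurable (\<Pi>\<^sub>M i\<in>{Suc n}. \<Pi>\<^sub>M \<theta>\<in>S. borel)"
    unfolding v_def using evaluation_measurable[OF \<theta>, of "Suc n" "{Suc n}"] by measurable
  have ind: "indep_var (history_space n) (history n) (\<Pi>\<^sub>M i\<in>{Suc n}. \<Pi>\<^sub>M \<theta>\<in>S. borel) next_field"
    unfolding history_def next_field_def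
    by (rule indep_var_restrict[OF independent[unfolded independent_fields_def]]) auto
  have u_eq: "u (history n \<omega>) = partial_prod n \<theta> \<omega> * indicator A \<omega>" if "\<omega> \<in> space M" for \<omega>
    using that by (auto simp: u_def AC partial_prod_history[OF \<theta>] indicator_def)
  have v_eq: "v (next_field \<omega>) = ennreal (\<Lambda> (Suc n) \<theta> \<omega>)" for \<omega>
    using \<theta> by (simp add: v_def next_field_def)
  have "(\<integral>\<^sup>+\<omega>. partial_prod (Suc n) \<theta> \<omega> * indicator A \<omega> \<partial>M)
      = (\<integral>\<^sup>+\<omega>. u (history n \<omega>) * v (next_field \<omega>) \<partial>M)"
    by (intro nn_integral_cong) (simp add: u_eq v_eq partial_prod_def mult_ac)
  also have "\<dots> = (\<integral>\<^sup>+\<omega>. u (history n \<omega>) \<partial>M) * (\<integral>\<^sup>+\<omega>. v (next_field \<omega>) \<partial>M)"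
    by (rule indep_var_nn_integral_mult[OF ind _ v]) measurable
  also have "\<dots> = (\<integral>\<^sup>+\<omega>. partial_prod n \<theta> \<omega> * indicator A \<omega> \<partial>M)"
    unfolding v_eq nn_integral_\<Lambda>[OF \<theta>] by (simp add: u_eq cong: nn_integral_cong_simp)
  finally show ?thesis .
qed

lemma nn_integral_mass_step:
  assumes B: "B \<in> sets \<sigma>" and A: "A \<in> sets (past n)"
  shows "(\<integral>\<^sup>+\<omega>. mass (Suc n) B \<omega> * indicator A \<omega> \<partial>M) = (\<integral>\<^sup>+\<omega>. mass n B \<omega> * indicator A \<omega> \<partial>M)"
proof -
  have "A \<in> sets M" using A subalgebra_past[of n] by (auto simp: subalgebra_def)
  note mass_mult = nn_integral_mass_mult[OF B borel_measurable_indicator[OF this]]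
  show ?thesis
    unfolding mass_mult
    by (intro nn_integral_cong) (metis nn_integral_partial_prod_step[OF _ A] space_sphere_measure)
qed

lemma nn_integral_mass:
  assumes B: "B \<in> sets \<sigma>"
  shows "(\<integral>\<^sup>+\<omega>. mass n B \<omega> \<partial>M) = emeasure \<sigma> B"
proof (induction n)
  case 0
  have "(\<integral>\<^sup>+\<omega>. mass 0 B \<omega> \<partial>M) = (\<integral>\<^sup>+\<theta>. (\<integral>\<^sup>+\<omega>. partial_prod 0 \<theta> \<omega> \<partial>M) * indicator B \<theta> \<partial>\<sigma>)"
    using nn_integral_mass_mult[OF B, of "\<lambda>_. 1" 0] by simp
  also have "\<dots> = (\<integral>\<^sup>+\<theta>. indicator B \<theta> \<partial>\<sigma>)"
    by (intro nn_integral_cong) (simp add: partial_prod_def nn_integral_\<Lambda>)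
  finally show ?case using B by simp
next
  case (Suc n)
  have "space M \<in> sets (past n)" using sets.top[of "past n"] by (simp add: space_past)
  from nn_integral_mass_step[OF B this] Suc show ?case
    by (simp cong: nn_integral_cong_simp)
qed

text \<open>
  The \<open>\<sigma>\<close>-algebra \<open>past n\<close> only sees countably many values of the fields at a time, so \<open>mass n B\<close>, an
  integral over uncountably many points, need not be measurable with respect to it.  It agrees
  almost surely with a function that is: against an arbitrary event \<open>A\<close>, Fubini's theorem reduces
  the claim to single points \<open>\<theta>\<close>, where the density is measurable with respect to the past and the
  indicator of \<open>A\<close> may be replaced by its conditional expectation.
\<close>

lemma nn_cond_exp_mass:
  assumes B [measurable]: "B \<in> sets \<sigma>"
  shows "AE \<omega> in M. nn_cond_exp M (past n) (mass n B) \<omega> = mass n B \<omega>"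
proof -
  interpret past: finite_measure_subalgebra M "past n"
    by unfold_locales (rule subalgebra_past)
  let ?Y = "nn_cond_exp M (past n) (mass n B)"
  show ?thesis
  proof (rule density_unique2)
    fix A assume A [measurable]: "A \<in> sets M"
    \<comment> \<open>\<open>?w\<close> may replace the indicator of \<open>A\<close> against every density and, conversely, against \<open>?Y\<close>\<close>
    let ?w = "nn_cond_exp M (past n) (indicator A)"
    have w [measurable]: "?w \<in> borel_measurable M"
      by (rule borel_measurable_nn_cond_exp2)
    have "(\<integral>\<^sup>+\<omega>. mass n B \<omega> * indicator A \<omega> \<partial>M) = (\<integral>\<^sup>+\<omega>. mass n B \<omega> * ?w \<omega> \<partial>M)"
    proof -
      have "(\<integral>\<^sup>+\<omega>. partial_prod n \<theta> \<omega> * ?w \<omega> \<partial>M) = (\<integral>\<^sup>+\<omega>. partial_prod n \<theta> \<omega> * indicator A \<omega> \<partial>M)"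
        if "\<theta> \<in> S" for \<theta>
        by (rule past.nn_cond_exp_intg[OF partial_prod_past_measurable[OF that]]) measurable
      then show ?thesis
        unfolding nn_integral_mass_mult[OF B w] nn_integral_mass_mult[OF B borel_measurable_indicator[OF A]]
        by (intro nn_integral_cong) (metis space_sphere_measure)
    qed
    also have "\<dots> = (\<integral>\<^sup>+\<omega>. ?w \<omega> * ?Y \<omega> \<partial>M)"
      by (subst past.nn_cond_exp_intg) (auto simp: mult.commute)
    also have "\<dots> = (\<integral>\<^sup>+\<omega>. ?Y \<omega> * ?w \<omega> \<partial>M)" by (simp add: mult.commute)
    also have "\<dots> = (\<integral>\<^sup>+\<omega>. ?Y \<omega> * indicator A \<omega> \<partial>M)"
      by (rule past.nn_cond_exp_intg) auto
    finally show "(\<integral>\<^sup>+\<omega>\<in>A. ?Y \<omega> \<partial>M) = (\<integral>\<^sup>+\<omega>\<in>A. mass n B \<omega> \<partial>M)" by simp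
  qed measurable
qed

lemma AE_mass_eq:
  "AE \<omega> in M. \<forall>n. \<forall>B\<in>sets \<sigma>. emeasure (cumulative_measure \<Lambda> n \<omega>) B = mass n B \<omega>"
proof -
  have "AE \<omega> in M. \<forall>i. \<forall>\<theta>\<in>S. 0 \<le> \<Lambda> i \<theta> \<omega>" unfolding AE_all_countable using nonneg by blast
  with AE_space show ?thesis
  proof eventually_elim
    case (elim \<omega>)
    note [simp] = elim(1)
    show ?case
    proof (intro allI ballI)
      fix n B assume B [measurable]: "B \<in> sets \<sigma>"
      have "(\<lambda>\<theta>. ennreal (field_prod \<Lambda> n \<theta> \<omega>)) \<in> borel_measurable \<sigma>"
        unfolding field_prod_def by measurable
      then have "emeasure (cumulative_measure \<Lambda> n \<omega>) B
          = (\<integral>\<^sup>+\<theta>. ennreal (field_prod \<Lambda> n \<theta> \<omega>) * indicator B \<theta> \<partial>\<sigma>)"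
        unfolding cumulative_measure_def using B by (rule emeasure_density)
      also have "\<dots> = mass n B \<omega>"
        unfolding mass_def partial_prod_def field_prod_def
        using elim(2) by (intro nn_integral_cong) (simp add: prod_ennreal)
      finally show "emeasure (cumulative_measure \<Lambda> n \<omega>) B = mass n B \<omega>" .
    qed
  qed
qed

lemma cumulative_measure_measurable:
  assumes B [measurable]: "B \<in> sets \<sigma>"
  shows "(\<lambda>\<omega>. measure (cumulative_measure \<Lambda> n \<omega>) B) \<in> borel_measurable M"
proof -
  have "measure (cumulative_measure \<Lambda> n \<omega>) B
      = enn2real (\<integral>\<^sup>+\<theta>. ennreal (field_prod \<Lambda> n \<theta> \<omega>) * indicator B \<theta> \<partial>\<sigma>)" if "\<omega> \<in> space M" for \<omega>
  proof -
    note [simp] = that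
    have "(\<lambda>\<theta>. ennreal (field_prod \<Lambda> n \<theta> \<omega>)) \<in> borel_measurable \<sigma>"
      unfolding field_prod_def by measurable
    then show ?thesis unfolding cumulative_measure_def measure_def
      using B by (simp add: emeasure_density)
  qed
  moreover have "(\<lambda>\<omega>. enn2real (\<integral>\<^sup>+\<theta>. ennreal (field_prod \<Lambda> n \<theta> \<omega>) * indicator B \<theta> \<partial>\<sigma>)) \<in> borel_measurable M"
    unfolding field_prod_def by measurable
  ultimately show ?thesis by (simp cong: measurable_cong)
qed

lemma AE_mass_finite: "B \<in> sets \<sigma> \<Longrightarrow> AE \<omega> in M. mass n B \<omega> \<noteq> \<infinity>"
  by (rule nn_integral_noteq_infinite) (auto simp: nn_integral_mass)

text \<open>
  The conditional expectations of the masses given the past form a martingale in the strict sense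
  and coincide with the masses almost surely, so the convergence theorem applies to them.
  The expectation of the limit is that of the initial term.
\<close>

lemma mass_limit:
  assumes B: "B \<in> sets \<sigma>" and p: "2 \<le> p"
    and bound: "\<And>n. (\<integral>\<^sup>+\<omega>. ennreal (enn2real (mass n S \<omega>) powr p) \<partial>M) \<le> ennreal C"
  obtains L where "L \<in> borel_measurable M"
    and "AE \<omega> in M. (\<lambda>n. emeasure (cumulative_measure \<Lambda> n \<omega>) B) \<longlonglongrightarrow> ennreal (L \<omega>)"
    and "(\<integral>\<^sup>+\<omega>. ennreal (L \<omega>) \<partial>M) = emeasure \<sigma> B"
    and "AE \<omega> in M. 0 \<le> L \<omega>"
    and "tendsto_in_Lp M p (\<lambda>n \<omega>. measure (cumulative_measure \<Lambda> n \<omega>) B) L"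
proof -
  note [measurable] = B
  define Y where "Y n \<omega> = enn2real (nn_cond_exp M (past n) (mass n B) \<omega>)" for n \<omega>
  have Y_past: "Y n \<in> borel_measurable (past n)" for n
    unfolding Y_def by measurable
  have Y_meas [measurable]: "Y n \<in> borel_measurable M" for n
    by (rule measurable_from_subalg[OF subalgebra_past Y_past])
  have Y_nonneg: "0 \<le> Y n \<omega>" for n \<omega> by (simp add: Y_def)
  have Y_mass: "AE \<omega> in M. \<forall>n. ennreal (Y n \<omega>) = mass n B \<omega>"
    unfolding AE_all_countable
  proof
    fix n show "AE \<omega> in M. ennreal (Y n \<omega>) = mass n B \<omega>"
      using nn_cond_exp_mass[OF B, of n] AE_mass_finite[OF B, of n]
      by eventually_elim (auto simp: Y_def top.not_eq_extremum)
  qed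
  have int_Y: "(\<integral>\<^sup>+\<omega>. ennreal (Y n \<omega>) * indicator A \<omega> \<partial>M) = (\<integral>\<^sup>+\<omega>. mass n B \<omega> * indicator A \<omega> \<partial>M)" for n A
    by (intro nn_integral_cong_AE) (use Y_mass in \<open>auto elim: eventually_mono\<close>)
  have powr_le: "(\<integral>\<^sup>+\<omega>. ennreal (\<bar>Y n \<omega>\<bar> powr p) \<partial>M) \<le> ennreal C" for n
  proof -
    have "(\<integral>\<^sup>+\<omega>. ennreal (\<bar>Y n \<omega>\<bar> powr p) \<partial>M) \<le> (\<integral>\<^sup>+\<omega>. ennreal (enn2real (mass n S \<omega>) powr p) \<partial>M)"
    proof (rule nn_integral_mono_AE)
      have "S \<in> sets \<sigma>" using sets.top[of \<sigma>] by simp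
      from Y_mass AE_mass_finite[OF this, of n]
      show "AE \<omega> in M. ennreal (\<bar>Y n \<omega>\<bar> powr p) \<le> ennreal (enn2real (mass n S \<omega>) powr p)"
      proof eventually_elim
        case (elim \<omega>)
        have "mass n B \<omega> \<le> mass n S \<omega>"
          unfolding mass_def by (intro nn_integral_mono) (auto simp: indicator_def)
        then have "enn2real (ennreal (Y n \<omega>)) \<le> enn2real (mass n S \<omega>)"
          using elim by (intro enn2real_mono) (auto simp: top.not_eq_extremum)
        then show ?case
          using p Y_nonneg[of n \<omega>] by (intro ennreal_leI powr_mono2) auto
      qed
    qed
    also have "\<dots> \<le> ennreal C" by (rule bound)
    finally show ?thesis .
  qed
  have Y_powr: "integrable M (\<lambda>\<omega>. \<bar>Y n \<omega>\<bar> powr p)" for n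
    by (rule integrableI_nonneg) (use powr_le[of n] in \<open>auto intro: le_less_trans\<close>)
  have Y_bound: "(\<integral>\<omega>. \<bar>Y n \<omega>\<bar> powr p \<partial>M) \<le> max C 0" for n
  proof -
    have "ennreal (\<integral>\<omega>. \<bar>Y n \<omega>\<bar> powr p \<partial>M) \<le> ennreal (max C 0)"
      using powr_le[of n] nn_integral_eq_integral[OF Y_powr, of n] by (auto simp: max_def ennreal_neg)
    then show ?thesis by (subst (asm) ennreal_le_iff) auto
  qed
  have martingale: "(\<integral>\<omega>. indicator A \<omega> * Y (Suc n) \<omega> \<partial>M) = (\<integral>\<omega>. indicator A \<omega> * Y n \<omega> \<partial>M)"
    if A: "A \<in> sets (past n)" for n A
  proof -
    have [measurable]: "A \<in> sets M" using A subalgebra_past[of n] by (auto simp: subalgebra_def)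
    have "(\<integral>\<omega>. indicator A \<omega> * Y m \<omega> \<partial>M) = enn2real (\<integral>\<^sup>+\<omega>. mass m B \<omega> * indicator A \<omega> \<partial>M)" for m
      unfolding int_Y[symmetric] using Y_nonneg
      by (subst integral_eq_nn_integral)
        (auto intro!: arg_cong[of _ _ enn2real] nn_integral_cong simp: indicator_def)
    then show ?thesis using nn_integral_mass_step[OF B A] by simp
  qed
  \<comment> \<open>\<open>ennreal C\<close> is 0 for negative \<open>C\<close>, hence the maximum with 0\<close>
  interpret Y: Lp_bounded_martingale M past Y p "max C 0"
    by unfold_locales (fact subalgebra_past past_mono Y_past martingale p Y_powr Y_bound)+
  let ?X = "\<lambda>n \<omega>. measure (cumulative_measure \<Lambda> n \<omega>) B"
  have XY: "AE \<omega> in M. \<forall>n. ?X n \<omega> = Y n \<omega>"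
    using AE_mass_eq Y_mass
  proof eventually_elim
    case (elim \<omega>)
    then have "emeasure (cumulative_measure \<Lambda> n \<omega>) B = ennreal (Y n \<omega>)" for n using B by simp
    then show ?case using Y_nonneg by (simp add: measure_def)
  qed
  have X_meas: "?X n \<in> borel_measurable M" for n
    by (rule cumulative_measure_measurable[OF B])
  have XYn: "AE \<omega> in M. ?X n \<omega> = Y n \<omega>" for n using XY by eventually_elim simp
  have "tendsto_in_Lp M p ?X Y.Ylim"
    using Y.tendsto_in_Lp_Ylim unfolding tendsto_in_Lp_def in_Lp_def
  proof (elim conjE, intro conjI allI)
    fix n
    assume "\<forall>n. Y n \<in> borel_measurable M \<and> integrable M (\<lambda>\<omega>. \<bar>Y n \<omega>\<bar> powr p)"
    then have "integrable M (\<lambda>\<omega>. \<bar>Y n \<omega>\<bar> powr p)" by blast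
    then show "integrable M (\<lambda>\<omega>. \<bar>?X n \<omega>\<bar> powr p)"
    proof (rule integrable_cong_AE_imp)
      show "AE \<omega> in M. \<bar>Y n \<omega>\<bar> powr p = \<bar>?X n \<omega>\<bar> powr p"
        using XYn[of n] by eventually_elim simp
    qed (use X_meas in measurable)
  next
    assume "(\<lambda>n. \<integral>\<omega>. \<bar>Y n \<omega> - Y.Ylim \<omega>\<bar> powr p \<partial>M) \<longlonglongrightarrow> 0"
    moreover have "(\<integral>\<omega>. \<bar>?X n \<omega> - Y.Ylim \<omega>\<bar> powr p \<partial>M) = (\<integral>\<omega>. \<bar>Y n \<omega> - Y.Ylim \<omega>\<bar> powr p \<partial>M)" for n
    proof (rule integral_cong_AE)
      show "AE \<omega> in M. \<bar>?X n \<omega> - Y.Ylim \<omega>\<bar> powr p = \<bar>Y n \<omega> - Y.Ylim \<omega>\<bar> powr p"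
        using XYn[of n] by eventually_elim simp
    qed (use X_meas in measurable)
    ultimately show "(\<lambda>n. \<integral>\<omega>. \<bar>?X n \<omega> - Y.Ylim \<omega>\<bar> powr p \<partial>M) \<longlonglongrightarrow> 0" by simp
  qed (use X_meas in auto)
  moreover have "AE \<omega> in M. (\<lambda>n. emeasure (cumulative_measure \<Lambda> n \<omega>) B) \<longlonglongrightarrow> ennreal (Y.Ylim \<omega>)"
    using Y.AE_tendsto_Ylim AE_mass_eq Y_mass
  proof eventually_elim
    case (elim \<omega>)
    have "(\<lambda>n. ennreal (Y n \<omega>)) \<longlonglongrightarrow> ennreal (Y.Ylim \<omega>)" by (intro tendsto_ennrealI elim)
    then show ?case using elim B by simp
  qed
  moreover have nonneg: "AE \<omega> in M. 0 \<le> Y.Ylim \<omega>"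
    using Y.AE_tendsto_Ylim by eventually_elim (rule LIMSEQ_le_const, assumption, use Y_nonneg in blast)
  moreover have "(\<integral>\<^sup>+\<omega>. ennreal (Y.Ylim \<omega>) \<partial>M) = emeasure \<sigma> B"
  proof -
    have EY: "(\<integral>\<omega>. Y n \<omega> \<partial>M) = measure \<sigma> B" for n
      using Y_nonneg Y_mass
      by (subst integral_eq_nn_integral)
        (auto simp: measure_def nn_integral_mass[OF B, of n, symmetric] intro!: arg_cong[of _ _ enn2real] nn_integral_cong_AE
          elim: eventually_mono)
    interpret past: sigma_finite_subalgebra M "past 0" by (rule Y.sigma_finite_F)
    have "(\<integral>\<omega>. Y.Ylim \<omega> \<partial>M) = (\<integral>\<omega>. real_cond_exp M (past 0) Y.Ylim \<omega> \<partial>M)"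
      by (rule past.real_cond_exp_int(2)[OF Y.integrable_Ylim, symmetric])
    also have "\<dots> = (\<integral>\<omega>. Y 0 \<omega> \<partial>M)"
      by (rule integral_cong_AE[OF _ _ Y.cond_exp_Ylim]) measurable
    finally have "(\<integral>\<omega>. Y.Ylim \<omega> \<partial>M) = measure \<sigma> B" using EY by simp
    then show ?thesis
      using nn_integral_eq_integral[OF Y.integrable_Ylim nonneg] by (simp add: \<sigma>.emeasure_eq_measure)
  qed
  ultimately show thesis by (intro that[of Y.Ylim]) auto
qed

end

section \<open>Moments of the total mass\<close>

text \<open>
  The graph of \<open>x\<^sup>q\<close> lies above its tangent at \<open>m\<close>.
\<close>

lemma powr_tangent_le:
  fixes x m q :: real
  assumes "0 \<le> x" "0 < m" "1 \<le> q"
  shows "q * m powr (q - 1) * x \<le> x powr q + (q - 1) * m powr q"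
proof (cases "x = 0")
  case False
  have "(x powr q) powr (1 / q) * (m powr q) powr (1 - 1 / q) \<le> (1 / q) * x powr q + (1 - 1 / q) * m powr q"
    using assms False by (intro Youngs_inequality_0) auto
  then have "x * m powr (q - 1) \<le> (1 / q) * x powr q + (1 - 1 / q) * m powr q"
    using assms by (simp add: powr_powr right_diff_distrib)
  then have "q * (x * m powr (q - 1)) \<le> q * ((1 / q) * x powr q + (1 - 1 / q) * m powr q)"
    using assms by (intro mult_left_mono) auto
  also have "\<dots> = x powr q + (q - 1) * m powr q" using assms by (simp add: field_simps)
  finally show ?thesis by (simp add: mult_ac)
qed (use assms in auto)

text \<open>
  Jensen's inequality for a finite measure, by integrating the tangent at the mean value
  \<open>m = a / ?c\<close>.  An infinite integral of \<open>f\<close> makes no trouble, because \<open>enn2real\<close> sends it to 0.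
\<close>

lemma (in finite_measure) powr_nn_integral_le:
  fixes f :: "'a \<Rightarrow> real"
  assumes [measurable]: "f \<in> borel_measurable M" and f: "\<And>x. x \<in> space M \<Longrightarrow> 0 \<le> f x" and q: "1 \<le> q"
  shows "ennreal (enn2real (\<integral>\<^sup>+x. ennreal (f x) \<partial>M) powr q)
    \<le> ennreal (measure M (space M) powr (q - 1)) * (\<integral>\<^sup>+x. ennreal (f x powr q) \<partial>M)"
proof -
  let ?c = "measure M (space M)"
  define a where "a = enn2real (\<integral>\<^sup>+x. ennreal (f x) \<partial>M)"
  show ?thesis
  proof (cases "a = 0")
    case True
    then show ?thesis by (simp add: a_def)
  next
    case False
    then have a: "0 < a" by (simp add: a_def less_le)
    then have I: "(\<integral>\<^sup>+x. ennreal (f x) \<partial>M) = ennreal a"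
      using enn2real_positive_iff[of "\<integral>\<^sup>+x. ennreal (f x) \<partial>M"] by (auto simp: a_def)
    have c: "0 < ?c"
    proof (rule ccontr)
      assume "\<not> 0 < ?c"
      then have "emeasure M (space M) = 0"
        using measure_nonneg[of M "space M"] by (simp add: emeasure_eq_measure)
      then have "(\<integral>\<^sup>+x. ennreal (f x) \<partial>M) = 0"
        by (intro nn_integral_0_iff_AE[THEN iffD2] AE_I[of _ _ "space M"]) auto
      then show False using I a by simp
    qed
    define m where "m = a / ?c"
    have m: "0 < m" using a c by (simp add: m_def)
    show ?thesis
    proof (cases "(\<integral>\<^sup>+x. ennreal (f x powr q) \<partial>M) = \<infinity>")
      case True
      then show ?thesis using c by (simp add: ennreal_mult_top)
    next
      case False
      then obtain J where J: "0 \<le> J" "(\<integral>\<^sup>+x. ennreal (f x powr q) \<partial>M) = ennreal J"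
        by (cases "\<integral>\<^sup>+x. ennreal (f x powr q) \<partial>M") auto
      have "ennreal (q * m powr (q - 1)) * ennreal a = (\<integral>\<^sup>+x. ennreal (q * m powr (q - 1) * f x) \<partial>M)"
        unfolding I[symmetric] using q by (subst nn_integral_cmult[symmetric]) (auto intro!: nn_integral_cong simp: f ennreal_mult)
      also have "\<dots> \<le> (\<integral>\<^sup>+x. ennreal (f x powr q) + ennreal ((q - 1) * m powr q) \<partial>M)"
        using f m q powr_tangent_le
        by (intro nn_integral_mono) (auto simp flip: ennreal_plus intro!: ennreal_leI)
      also have "\<dots> = ennreal (J + (q - 1) * m powr q * ?c)"
        using J q by (simp add: nn_integral_add emeasure_eq_measure flip: ennreal_mult')
      also have "ennreal (q * m powr (q - 1)) * ennreal a = ennreal (q * m powr (q - 1) * a)"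
        using q by (simp add: ennreal_mult')
      finally have "q * m powr (q - 1) * a \<le> J + (q - 1) * m powr q * ?c"
        using q J by (subst (asm) ennreal_le_iff) auto
      moreover have "m powr (q - 1) * a = m powr q * ?c"
        using m c a by (simp add: powr_diff m_def field_simps)
      ultimately have "q * (m powr q * ?c) \<le> J + (q - 1) * m powr q * ?c"
        by (simp add: mult.assoc)
      then have "m powr q * ?c \<le> J" by (simp add: algebra_simps)
      then have "?c powr (q - 1) * (m powr q * ?c) \<le> ?c powr (q - 1) * J"
        by (intro mult_left_mono) auto
      moreover have "?c powr (q - 1) * (m powr q * ?c) = a powr q"
        using c a by (simp add: m_def powr_divide powr_diff)
      ultimately show ?thesis
        unfolding a_def[symmetric] J using J by (simp add: ennreal_leI flip: ennreal_mult')
    qed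
  qed
qed

context random_fields
begin

sublocale \<sigma>P: product_sigma_finite "\<lambda>_::nat. \<sigma>" ..

abbreviation points :: "nat set \<Rightarrow> (nat \<Rightarrow> 'a) measure" where
  "points I \<equiv> (\<Pi>\<^sub>M j\<in>I. \<sigma>)"

lemma emeasure_points: "finite I \<Longrightarrow> emeasure (points I) (space (points I)) = emeasure \<sigma> S ^ card I"
  using \<sigma>P.emeasure_PiM[of I "\<lambda>_. S"] sets.top[of \<sigma>] by (simp add: space_PiM)

lemma pointsD: "\<theta> \<in> space (points I) \<Longrightarrow> j \<in> I \<Longrightarrow> \<theta> j \<in> S"
  by (auto simp: space_PiM PiE_def Pi_def)

text \<open>
  For fixed points \<open>\<theta> j\<close> the product over \<open>j\<close> is a function of the \<open>i\<close>-th field alone, so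
  independence exchanges expectation and the product over \<open>i\<close>.
\<close>

lemma nn_integral_partial_moment:
  assumes \<theta>: "\<And>j. j \<in> J \<Longrightarrow> \<theta> j \<in> S"
  shows "(\<integral>\<^sup>+\<omega>. (\<Prod>j\<in>J. ennreal (\<bar>field_prod \<Lambda> n (\<theta> j) \<omega>\<bar> powr ps j)) \<partial>M)
    = (\<Prod>i=0..n. \<integral>\<^sup>+\<omega>. (\<Prod>j\<in>J. ennreal (\<bar>\<Lambda> i (\<theta> j) \<omega>\<bar> powr ps j)) \<partial>M)"
proof -
  define v where "v h = (\<Prod>j\<in>J. ennreal (\<bar>h (\<theta> j)\<bar> powr ps j))" for h :: "'a \<Rightarrow> real"
  have [measurable]: "v \<in> borel_measurable (\<Pi>\<^sub>M \<theta>\<in>S. borel)"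
    unfolding v_def using \<theta> by measurable
  define V where "V i \<omega> = v (\<lambda>\<theta>\<in>S. \<Lambda> i \<theta> \<omega>)" for i \<omega>
  have V: "V i \<omega> = (\<Prod>j\<in>J. ennreal (\<bar>\<Lambda> i (\<theta> j) \<omega>\<bar> powr ps j))" for i \<omega>
    unfolding V_def v_def using \<theta> by (intro prod.cong) auto
  have "indep_vars (\<lambda>_. borel) V UNIV"
    unfolding V_def
    by (rule indep_vars_compose2[OF independent[unfolded independent_fields_def]]) simp
  then have "indep_vars (\<lambda>_. borel) V {0..n}" by (rule indep_vars_subset) simp
  have "(\<integral>\<^sup>+\<omega>. (\<Prod>j\<in>J. ennreal (\<bar>field_prod \<Lambda> n (\<theta> j) \<omega>\<bar> powr ps j)) \<partial>M)
      = (\<integral>\<^sup>+\<omega>. (\<Prod>i=0..n. V i \<omega>) \<partial>M)"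
    unfolding V field_prod_def
    by (subst prod.swap) (simp add: abs_prod prod_powr_distrib prod_ennreal)
  also have "\<dots> = (\<Prod>i=0..n. \<integral>\<^sup>+\<omega>. V i \<omega> \<partial>M)"
    by (rule indep_vars_nn_integral) (use \<open>indep_vars _ V {0..n}\<close> in auto)
  finally show ?thesis by (simp add: V)
qed

text \<open>
  The power \<open>p\<close> is distributed over the indices: each factor \<open>mass\<close> to the power \<open>ps j\<close> is estimated
  by Jensen's inequality, and the product of the resulting integrals is one integral
  over the tuples of points.
\<close>

lemma moment_mass_le:
  assumes J: "finite J" and ps: "\<And>j. j \<in> J \<Longrightarrow> 1 \<le> ps j" and p: "p = (\<Sum>j\<in>J. ps j)"  "0 < p"
  shows "(\<integral>\<^sup>+\<omega>. ennreal (enn2real (mass n S \<omega>) powr p) \<partial>M)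
    \<le> ennreal (\<Prod>j\<in>J. measure \<sigma> S powr (ps j - 1)) *
       (\<integral>\<^sup>+\<theta>. (\<Prod>i=0..n. \<integral>\<^sup>+\<omega>. (\<Prod>j\<in>J. ennreal (\<bar>\<Lambda> i (\<theta> j) \<omega>\<bar> powr ps j)) \<partial>M) \<partial>points J)"
proof -
  let ?c = "\<Prod>j\<in>J. measure \<sigma> S powr (ps j - 1)"
  let ?f = "\<lambda>\<theta> \<omega>. \<bar>field_prod \<Lambda> n \<theta> \<omega>\<bar>"
  let ?g = "\<lambda>\<theta> \<omega>. \<Prod>j\<in>J. ennreal (?f (\<theta> j) \<omega> powr ps j)"
  interpret P: pair_sigma_finite "points J" M
    by (intro pair_sigma_finite.intro \<sigma>P.sigma_finite J sigma_finite_measure_axioms)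
  have [measurable]: "(\<lambda>x. ?g (fst x) (snd x)) \<in> borel_measurable (points J \<Otimes>\<^sub>M M)"
    unfolding field_prod_def by measurable
  have "AE \<omega> in M. \<forall>i. \<forall>\<theta>\<in>S. 0 \<le> \<Lambda> i \<theta> \<omega>" unfolding AE_all_countable using nonneg by blast
  with AE_space have "AE \<omega> in M. ennreal (enn2real (mass n S \<omega>) powr p) \<le> ennreal ?c * (\<integral>\<^sup>+\<theta>. ?g \<theta> \<omega> \<partial>points J)"
  proof eventually_elim
    case (elim \<omega>)
    note [simp] = elim(1)
    have [measurable]: "(\<lambda>\<theta>. ?f \<theta> \<omega>) \<in> borel_measurable \<sigma>"
      unfolding field_prod_def by measurable
    have m: "mass n S \<omega> = (\<integral>\<^sup>+\<theta>. ennreal (?f \<theta> \<omega>) \<partial>\<sigma>)"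
      unfolding mass_def partial_prod_def field_prod_def
      using elim(2) by (intro nn_integral_cong) (simp add: prod_ennreal prod_nonneg)
    have "ennreal (enn2real (mass n S \<omega>) powr p) = (\<Prod>j\<in>J. ennreal (enn2real (mass n S \<omega>) powr ps j))"
    proof (cases "enn2real (mass n S \<omega>) = 0")
      case True
      have "J \<noteq> {}" using p by auto
      then show ?thesis using True p J by (auto simp: card_gt_0_iff)
    next
      case False
      then show ?thesis using J unfolding p by (simp add: powr_sum prod_ennreal)
    qed
    also have "\<dots> \<le> (\<Prod>j\<in>J. ennreal (measure \<sigma> S powr (ps j - 1)) * (\<integral>\<^sup>+\<theta>. ennreal (?f \<theta> \<omega> powr ps j) \<partial>\<sigma>))"
      unfolding m using \<sigma>.powr_nn_integral_le[of "\<lambda>\<theta>. ?f \<theta> \<omega>"] ps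
      by (intro prod_mono_ennreal) auto
    also have "\<dots> = ennreal ?c * (\<Prod>j\<in>J. \<integral>\<^sup>+\<theta>. ennreal (?f \<theta> \<omega> powr ps j) \<partial>\<sigma>)"
      by (simp add: prod.distrib prod_ennreal)
    also have "(\<Prod>j\<in>J. \<integral>\<^sup>+\<theta>. ennreal (?f \<theta> \<omega> powr ps j) \<partial>\<sigma>) = (\<integral>\<^sup>+\<theta>. ?g \<theta> \<omega> \<partial>points J)"
      by (rule \<sigma>P.product_nn_integral_prod[symmetric, OF J]) measurable
    finally show ?case .
  qed
  then have "(\<integral>\<^sup>+\<omega>. ennreal (enn2real (mass n S \<omega>) powr p) \<partial>M)
      \<le> (\<integral>\<^sup>+\<omega>. ennreal ?c * (\<integral>\<^sup>+\<theta>. ?g \<theta> \<omega> \<partial>points J) \<partial>M)"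
    by (rule nn_integral_mono_AE)
  also have "\<dots> = ennreal ?c * (\<integral>\<^sup>+\<omega>. \<integral>\<^sup>+\<theta>. ?g \<theta> \<omega> \<partial>points J \<partial>M)"
    unfolding field_prod_def by (rule nn_integral_cmult) measurable
  also have "(\<integral>\<^sup>+\<omega>. \<integral>\<^sup>+\<theta>. ?g \<theta> \<omega> \<partial>points J \<partial>M) = (\<integral>\<^sup>+\<theta>. \<integral>\<^sup>+\<omega>. ?g \<theta> \<omega> \<partial>M \<partial>points J)"
    by (rule P.Fubini') (simp add: case_prod_beta)
  also have "\<dots> = (\<integral>\<^sup>+\<theta>. (\<Prod>i=0..n. \<integral>\<^sup>+\<omega>. (\<Prod>j\<in>J. ennreal (\<bar>\<Lambda> i (\<theta> j) \<omega>\<bar> powr ps j)) \<partial>M) \<partial>points J)"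
    by (intro nn_integral_cong nn_integral_partial_moment pointsD) auto
  finally show ?thesis .
qed

text \<open>
  Fubini's theorem: with all coordinates but the \<open>m\<close>-th fixed, the \<open>m\<close>-th ranges over a cap around
  the \<open>h\<close>-th.
\<close>

lemma emeasure_close_pair_le:
  assumes J: "finite J" and mh: "m \<in> J" "h \<in> J" "m \<noteq> h"
    and cap: "\<And>x. x \<in> S \<Longrightarrow> emeasure \<sigma> {y \<in> S. angular_dist y x < s} \<le> \<delta>"
  shows "emeasure (points J) {\<theta> \<in> space (points J). angular_dist (\<theta> m) (\<theta> h) < s}
    \<le> \<delta> * emeasure \<sigma> S ^ (card J - 1)"
proof -
  define I where "I = J - {m}"
  have I: "finite I" "m \<notin> I" "J = insert m I" "h \<in> I" "card I = card J - 1"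
    using J mh by (auto simp: I_def)
  let ?E = "{\<theta> \<in> space (points J). angular_dist (\<theta> m) (\<theta> h) < s}"
  have [measurable]: "(\<lambda>\<theta>. angular_dist (\<theta> m) (\<theta> h)) \<in> borel_measurable (points J)"
    using mh by (intro angular_dist_measurable measurable_component_singleton)
  have E: "?E \<in> sets (points J)" by measurable
  have "emeasure (points J) ?E = (\<integral>\<^sup>+\<theta>. indicator ?E \<theta> \<partial>points (insert m I))"
    using E I(3) by simp
  also have "\<dots> = (\<integral>\<^sup>+\<theta>. (\<integral>\<^sup>+y. indicator ?E (\<theta>(m := y)) \<partial>\<sigma>) \<partial>points I)"
    by (rule \<sigma>P.product_nn_integral_insert[OF I(1,2)]) (use E I(3) in simp)
  also have "\<dots> \<le> (\<integral>\<^sup>+\<theta>. \<delta> \<partial>points I)"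
  proof (rule nn_integral_mono)
    fix \<theta> assume \<theta>: "\<theta> \<in> space (points I)"
    then have hS: "\<theta> h \<in> S" using I(4) by (rule pointsD)
    have "(\<lambda>y. angular_dist y (\<theta> h)) \<in> borel_measurable \<sigma>"
      using hS by (intro angular_dist_measurable) auto
    then have "{y \<in> space \<sigma>. angular_dist y (\<theta> h) < s} \<in> sets \<sigma>" by measurable
    moreover have "(\<integral>\<^sup>+y. indicator ?E (\<theta>(m := y)) \<partial>\<sigma>) \<le> (\<integral>\<^sup>+y. indicator {y \<in> space \<sigma>. angular_dist y (\<theta> h) < s} y \<partial>\<sigma>)"
      using mh by (intro nn_integral_mono) (auto simp: indicator_def)
    ultimately show "(\<integral>\<^sup>+y. indicator ?E (\<theta>(m := y)) \<partial>\<sigma>) \<le> \<delta>"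
      using cap[OF hS] by auto
  qed
  also have "\<dots> = \<delta> * emeasure \<sigma> S ^ (card J - 1)"
    using emeasure_points[OF I(1)] I(5) by simp
  finally show ?thesis .
qed

text \<open>
  Points at minimal distance below \<open>b\<close> to the power \<open>-n\<close> form a set of measure at most a constant
  times \<open>b\<close> to the power \<open>-n d\<close>.  The weight of the scale \<open>n\<close> in the bound for the product is
  \<open>r 0 ^ Suc n\<close>, so the scales sum up to a geometric series of ratio \<open>r 0 / b ^ d\<close>.
\<close>

lemma moment_bounded:
  fixes r :: "real \<Rightarrow> real" and k :: nat and ps :: "nat \<Rightarrow> real"
  assumes D: "DIM('a) = d + 1" and k: "2 \<le> k"
    and ps: "\<And>j. j \<in> {1..k} \<Longrightarrow> 1 \<le> ps j"
    and r1: "\<And>x. 1 \<le> r x" and anti: "\<And>x y. 0 \<le> x \<Longrightarrow> x \<le> y \<Longrightarrow> r y \<le> r x" and b: "1 < b"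
    and K: "\<And>N. (\<Prod>i<N. r (b ^ i)) \<le> K" and R: "r 0 < b ^ d"
    and moment: "\<And>i \<theta>. (\<And>j. j \<in> {1..k} \<Longrightarrow> \<theta> j \<in> S) \<Longrightarrow>
      (\<integral>\<^sup>+\<omega>. (\<Prod>j=1..k. ennreal (\<bar>\<Lambda> i (\<theta> j) \<omega>\<bar> powr ps j)) \<partial>M) \<le> ennreal (r (b ^ i * min_angular_dist k \<theta>))"
  obtains C where "\<And>n. (\<integral>\<^sup>+\<omega>. ennreal (enn2real (mass n S \<omega>) powr (\<Sum>j=1..k. ps j)) \<partial>M) \<le> ennreal C"
proof -
  let ?J = "{1..k}"
  define pairs where "pairs = {(m, h). m \<in> ?J \<and> h \<in> ?J \<and> m \<noteq> h}"
  have fin_pairs: "finite pairs" by (rule finite_subset[of _ "?J \<times> ?J"]) (auto simp: pairs_def)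
  have "(1, 2) \<in> pairs" using k by (auto simp: pairs_def)
  then have ne_pairs: "pairs \<noteq> {}" by auto
  define t :: "(nat \<Rightarrow> 'a) \<Rightarrow> real" where "t = min_angular_dist k"
  have t_eq: "t \<theta> = Min ((\<lambda>(m, h). angular_dist (\<theta> m) (\<theta> h)) ` pairs)" for \<theta> :: "nat \<Rightarrow> 'a"
    unfolding t_def min_angular_dist_def pairs_def by (intro arg_cong[of _ _ Min]) auto
  have t_nonneg: "0 \<le> t \<theta>" if \<theta>: "\<And>j. j \<in> ?J \<Longrightarrow> \<theta> j \<in> S" for \<theta>
  proof -
    have "0 \<le> angular_dist (\<theta> m) (\<theta> h)" if "(m, h) \<in> pairs" for m h
    proof -
      have "0 \<le> dist (\<theta> m) (\<theta> h)" by simp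
      also have "\<dots> \<le> angular_dist (\<theta> m) (\<theta> h)"
        using \<theta> that by (intro dist_le_angular_dist) (auto simp: pairs_def)
      finally show ?thesis .
    qed
    then show ?thesis unfolding t_eq using fin_pairs ne_pairs by (auto simp: Min_ge_iff)
  qed
  have r0: "0 \<le> r x" for x using r1[of x] by linarith
  have K0: "0 \<le> K" using K[of 0] by simp
  define E where "E n z = {\<theta> \<in> space (points ?J). angular_dist (\<theta> (fst z)) (\<theta> (snd z)) < (1 / b) ^ n}"
    for n :: nat and z
  have E_sets [measurable]: "E n z \<in> sets (points ?J)" if "z \<in> pairs" for n z
  proof -
    have [measurable]: "(\<lambda>\<theta>. angular_dist (\<theta> (fst z)) (\<theta> (snd z))) \<in> borel_measurable (points ?J)"
      using that by (intro angular_dist_measurable measurable_component_singleton) (auto simp: pairs_def)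
    show ?thesis unfolding E_def by measurable
  qed
  have prod_le: "(\<Prod>i<N. ennreal (r (b ^ i * t \<theta>)))
      \<le> ennreal K * (1 + (\<Sum>n<N. ennreal (r 0 ^ Suc n) * (\<Sum>z\<in>pairs. indicator (E n z) \<theta>)))"
    if \<theta>: "\<theta> \<in> space (points ?J)" for N \<theta>
  proof -
    have \<theta>S: "\<And>j. j \<in> ?J \<Longrightarrow> \<theta> j \<in> S" using \<theta> by (rule pointsD)
    \<comment> \<open>if the least distance is below the scale \<open>n\<close>, some pair realizes it\<close>
    have close: "of_bool (t \<theta> * b ^ n < 1) \<le> (\<Sum>z\<in>pairs. indicator (E n z) \<theta> :: real)" for n
    proof (cases "t \<theta> * b ^ n < 1")
      case True
      have "t \<theta> \<in> (\<lambda>(m, h). angular_dist (\<theta> m) (\<theta> h)) ` pairs"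
        unfolding t_eq using fin_pairs ne_pairs by (intro Min_in) auto
      then obtain z where z: "z \<in> pairs" "t \<theta> = angular_dist (\<theta> (fst z)) (\<theta> (snd z))"
        by auto
      have "t \<theta> < (1 / b) ^ n" using True b by (simp add: field_simps power_one_over)
      then have "\<theta> \<in> E n z" using z \<theta> by (simp add: E_def)
      then have "1 = (indicator (E n z) \<theta> :: real)" by simp
      also have "\<dots> \<le> (\<Sum>z\<in>pairs. indicator (E n z) \<theta>)"
        using z fin_pairs by (intro member_le_sum) auto
      finally show ?thesis using True by simp
    qed (auto intro: sum_nonneg)
    have "(\<Prod>i<N. r (b ^ i * t \<theta>)) \<le> K * (1 + (\<Sum>n<N. r 0 ^ (Suc n) * of_bool (t \<theta> * b ^ n < 1)))"
      by (rule prod_dilations_le[OF r1 anti b K t_nonneg[OF \<theta>S]])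
    also have "\<dots> \<le> K * (1 + (\<Sum>n<N. r 0 ^ (Suc n) * (\<Sum>z\<in>pairs. indicator (E n z) \<theta>)))"
      by (intro mult_left_mono add_left_mono sum_mono close K0 zero_le_power r0)
    finally have "ennreal (\<Prod>i<N. r (b ^ i * t \<theta>))
        \<le> ennreal (K * (1 + (\<Sum>n<N. r 0 ^ (Suc n) * (\<Sum>z\<in>pairs. indicator (E n z) \<theta>))))"
      by (rule ennreal_leI)
    also have "\<dots> = ennreal K * (1 + (\<Sum>n<N. ennreal (r 0 ^ Suc n) * (\<Sum>z\<in>pairs. indicator (E n z) \<theta>)))"
      using K0 r0
      by (simp add: ennreal_mult' ennreal_plus sum_nonneg ennreal_indicator del: power_Suc flip: sum_ennreal)
    finally show ?thesis using r0 by (simp add: prod_ennreal)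
  qed
  define c where "c = measure \<sigma> S"
  have c: "0 \<le> c" "emeasure \<sigma> S = ennreal c" by (auto simp: c_def \<sigma>.emeasure_eq_measure)
  define V where "V = real DIM('a) * (3 * (unit_ball_vol (real DIM('a)) * 2 ^ (d + 1)))"
  have V: "0 \<le> V" by (simp add: V_def unit_ball_vol_nonneg)
  define a where "a = real (card pairs) * V * c ^ (k - 1)"
  have a: "0 \<le> a" using V c by (simp add: a_def)
  define q where "q = r 0 / b ^ d"
  have q: "0 \<le> q" "q < 1" using R r0[of 0] b by (auto simp: q_def)
  have E_le: "(\<Sum>z\<in>pairs. emeasure (points ?J) (E n z)) \<le> ennreal (a * (1 / b ^ d) ^ n)" for n
  proof -
    have "emeasure (points ?J) (E n z) \<le> ennreal (V * ((1 / b) ^ n) ^ d * c ^ (k - 1))" if "z \<in> pairs" for z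
    proof -
      have "emeasure (points ?J) (E n z) \<le> ennreal (V * ((1 / b) ^ n) ^ d) * emeasure \<sigma> S ^ (card ?J - 1)"
        unfolding E_def
      proof (rule emeasure_close_pair_le)
        show "emeasure \<sigma> {y \<in> S. angular_dist y x < (1 / b) ^ n} \<le> ennreal (V * ((1 / b) ^ n) ^ d)"
          if "x \<in> S" for x
          unfolding V_def using b by (intro sphere_measure_cap_le that D) (auto intro: power_le_one)
      qed (use that in \<open>auto simp: pairs_def\<close>)
      also have "\<dots> = ennreal (V * ((1 / b) ^ n) ^ d * c ^ (k - 1))"
        using V b c by (simp add: ennreal_mult' ennreal_power)
      finally show ?thesis .
    qed
    then have "(\<Sum>z\<in>pairs. emeasure (points ?J) (E n z)) \<le> (\<Sum>z\<in>pairs. ennreal (V * ((1 / b) ^ n) ^ d * c ^ (k - 1)))"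
      by (rule sum_mono)
    also have "\<dots> = ennreal (\<Sum>z\<in>pairs. V * ((1 / b) ^ n) ^ d * c ^ (k - 1))"
      using V b c by (intro sum_ennreal) auto
    also have "(\<Sum>z\<in>pairs. V * ((1 / b) ^ n) ^ d * c ^ (k - 1)) = a * (1 / b ^ d) ^ n"
      by (simp add: a_def power_one_over mult_ac flip: power_mult)
    finally show ?thesis .
  qed
  define C0 where "C0 = K * (c ^ k + a * r 0 * (1 / (1 - q)))"
  have int_le: "(\<integral>\<^sup>+\<theta>. (\<Prod>i<N. ennreal (r (b ^ i * t \<theta>))) \<partial>points ?J) \<le> ennreal C0" for N
  proof -
    have "(\<integral>\<^sup>+\<theta>. (\<Prod>i<N. ennreal (r (b ^ i * t \<theta>))) \<partial>points ?J)
      \<le> (\<integral>\<^sup>+\<theta>. ennreal K * (1 + (\<Sum>n<N. ennreal (r 0 ^ Suc n) * (\<Sum>z\<in>pairs. indicator (E n z) \<theta>))) \<partial>points ?J)"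
      by (intro nn_integral_mono prod_le)
    also have "\<dots> = ennreal K * (emeasure \<sigma> S ^ k + (\<Sum>n<N. ennreal (r 0 ^ Suc n) * (\<Sum>z\<in>pairs. emeasure (points ?J) (E n z))))"
    proof -
      let ?s = "\<lambda>n \<theta>. \<Sum>z\<in>pairs. indicator (E n z) \<theta> :: ennreal"
      have m [measurable]: "?s n \<in> borel_measurable (points ?J)" for n
        by (intro borel_measurable_sum borel_measurable_indicator E_sets)
      have s: "(\<integral>\<^sup>+\<theta>. ennreal (r 0 ^ Suc n) * ?s n \<theta> \<partial>points ?J)
          = ennreal (r 0 ^ Suc n) * (\<Sum>z\<in>pairs. emeasure (points ?J) (E n z))" for n
      proof -
        have "(\<integral>\<^sup>+\<theta>. ?s n \<theta> \<partial>points ?J) = (\<Sum>z\<in>pairs. \<integral>\<^sup>+\<theta>. indicator (E n z) \<theta> \<partial>points ?J)"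
          by (intro nn_integral_sum borel_measurable_indicator E_sets)
        also have "\<dots> = (\<Sum>z\<in>pairs. emeasure (points ?J) (E n z))"
          by (intro sum.cong refl nn_integral_indicator E_sets)
        finally show ?thesis by (subst nn_integral_cmult[OF m]) simp
      qed
      have "(\<integral>\<^sup>+\<theta>. ennreal K * (1 + (\<Sum>n<N. ennreal (r 0 ^ Suc n) * ?s n \<theta>)) \<partial>points ?J)
          = ennreal K * (\<integral>\<^sup>+\<theta>. 1 + (\<Sum>n<N. ennreal (r 0 ^ Suc n) * ?s n \<theta>) \<partial>points ?J)"
        by (rule nn_integral_cmult) measurable
      also have "(\<integral>\<^sup>+\<theta>. 1 + (\<Sum>n<N. ennreal (r 0 ^ Suc n) * ?s n \<theta>) \<partial>points ?J)
          = (\<integral>\<^sup>+\<theta>. 1 \<partial>points ?J) + (\<integral>\<^sup>+\<theta>. (\<Sum>n<N. ennreal (r 0 ^ Suc n) * ?s n \<theta>) \<partial>points ?J)"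
        by (rule nn_integral_add) measurable
      also have "(\<integral>\<^sup>+\<theta>. 1 \<partial>points ?J) = emeasure \<sigma> S ^ k"
        using emeasure_points[of ?J] by (subst nn_integral_const) simp
      also have "(\<integral>\<^sup>+\<theta>. (\<Sum>n<N. ennreal (r 0 ^ Suc n) * ?s n \<theta>) \<partial>points ?J)
          = (\<Sum>n<N. ennreal (r 0 ^ Suc n) * (\<Sum>z\<in>pairs. emeasure (points ?J) (E n z)))"
        by (subst nn_integral_sum) (measurable, simp only: s)
      finally show ?thesis .
    qed
    also have "\<dots> \<le> ennreal K * (emeasure \<sigma> S ^ k + (\<Sum>n<N. ennreal (r 0 ^ Suc n) * ennreal (a * (1 / b ^ d) ^ n)))"
      by (intro mult_left_mono add_left_mono sum_mono E_le) auto
    also have "\<dots> = ennreal (K * (c ^ k + (\<Sum>n<N. r 0 ^ Suc n * (a * (1 / b ^ d) ^ n))))"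
      using K0 c a b r0
      by (simp add: ennreal_mult' ennreal_plus sum_nonneg ennreal_power del: power_Suc flip: sum_ennreal)
    also have "\<dots> \<le> ennreal C0"
    proof (intro ennreal_leI)
      have "(\<Sum>n<N. r 0 ^ Suc n * (a * (1 / b ^ d) ^ n)) = a * r 0 * (\<Sum>n<N. q ^ n)"
        by (simp add: sum_distrib_left q_def power_divide mult_ac)
      also have "\<dots> \<le> a * r 0 * (1 / (1 - q))"
      proof (intro mult_left_mono)
        have "(\<Sum>n<N. q ^ n) \<le> (\<Sum>n. q ^ n)"
          using q by (intro sum_le_suminf summable_geometric) auto
        then show "(\<Sum>n<N. q ^ n) \<le> 1 / (1 - q)" using q by (simp add: suminf_geometric)
      qed (use a r0 in auto)
      finally show "K * (c ^ k + (\<Sum>n<N. r 0 ^ Suc n * (a * (1 / b ^ d) ^ n))) \<le> C0"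
        unfolding C0_def using K0 by (intro mult_left_mono add_left_mono)
    qed
    finally show ?thesis .
  qed
  let ?c = "\<Prod>j\<in>?J. measure \<sigma> S powr (ps j - 1)"
  have "(\<integral>\<^sup>+\<omega>. ennreal (enn2real (mass n S \<omega>) powr (\<Sum>j=1..k. ps j)) \<partial>M) \<le> ennreal (?c * C0)" for n
  proof -
    have "real k \<le> (\<Sum>j=1..k. ps j)" using sum_mono[of ?J "\<lambda>_. 1" ps] ps by simp
    then have "0 < (\<Sum>j=1..k. ps j)" using k by linarith
    then have "(\<integral>\<^sup>+\<omega>. ennreal (enn2real (mass n S \<omega>) powr (\<Sum>j=1..k. ps j)) \<partial>M)
      \<le> ennreal ?c * (\<integral>\<^sup>+\<theta>. (\<Prod>i=0..n. \<integral>\<^sup>+\<omega>. (\<Prod>j\<in>?J. ennreal (\<bar>\<Lambda> i (\<theta> j) \<omega>\<bar> powr ps j)) \<partial>M) \<partial>points ?J)"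
      by (intro moment_mass_le ps) auto
    also have "\<dots> \<le> ennreal ?c * (\<integral>\<^sup>+\<theta>. (\<Prod>i<Suc n. ennreal (r (b ^ i * t \<theta>))) \<partial>points ?J)"
    proof (intro mult_left_mono nn_integral_mono)
      fix \<theta> assume \<theta>: "\<theta> \<in> space (points ?J)"
      show "(\<Prod>i=0..n. \<integral>\<^sup>+\<omega>. (\<Prod>j\<in>?J. ennreal (\<bar>\<Lambda> i (\<theta> j) \<omega>\<bar> powr ps j)) \<partial>M)
          \<le> (\<Prod>i<Suc n. ennreal (r (b ^ i * t \<theta>)))"
        unfolding lessThan_Suc_atMost atLeast0AtMost t_def
        by (intro prod_mono_ennreal moment pointsD[OF \<theta>]) auto
    qed simp
    also have "\<dots> \<le> ennreal ?c * ennreal C0"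
      by (intro mult_left_mono int_le) simp
    also have "\<dots> = ennreal (?c * C0)"
      by (intro ennreal_mult'[symmetric] prod_nonneg) simp
    finally show ?thesis .
  qed
  then show thesis by (rule that)
qed

end

section \<open>A random measure from setwise limits\<close>

text \<open>
  Base 4 with digits 0 and 1 only: the tail after any digit is at most \<open>1 / 3\<close> of a unit of that
  digit, so the code determines its digits and the decoding needs no exceptional points.
\<close>

definition base4_code :: "(nat \<Rightarrow> bool) \<Rightarrow> real" where
  "base4_code a = (\<Sum>n. of_bool (a n) * (1/4) ^ Suc n)"

text \<open>
  Deletes the first digit; that digit is 1 precisely if the number is at least \<open>1 / 4\<close>.
\<close>

definition base4_shift :: "real \<Rightarrow> real" where
  "base4_shift t = 4 * t - of_bool (1/4 \<le> t)"

lemma base4_code_summable: "summable (\<lambda>n. of_bool (a n) * (1/4 :: real) ^ Suc n)"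
proof (rule summable_comparison_test')
  show "summable (\<lambda>n. (1/4 :: real) ^ Suc n)"
    by (intro summable_Suc_iff[THEN iffD2] summable_geometric) simp
  show "norm (of_bool (a n) * (1/4 :: real) ^ Suc n) \<le> (1/4) ^ Suc n" for n by simp
qed

lemma base4_code_bounds: "0 \<le> base4_code a" "base4_code a \<le> 1/3"
proof -
  show "0 \<le> base4_code a"
    unfolding base4_code_def by (intro suminf_nonneg base4_code_summable) simp
  have g: "(\<lambda>n. (1/4 :: real) ^ Suc n) sums (1/3)"
    using sums_mult[OF geometric_sums[of "1/4 :: real"], of "1/4"] by simp
  have "base4_code a \<le> (\<Sum>n. (1/4 :: real) ^ Suc n)"
    unfolding base4_code_def
    by (intro suminf_le base4_code_summable sums_summable[OF g]) simp
  then show "base4_code a \<le> 1/3" using sums_unique[OF g] by simp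
qed

lemma base4_code_rec: "base4_code a = (of_bool (a 0) + base4_code (\<lambda>n. a (Suc n))) / 4"
proof -
  have "base4_code a = of_bool (a 0) / 4 + (\<Sum>n. of_bool (a (Suc n)) * (1/4) ^ Suc (Suc n))"
    unfolding base4_code_def using suminf_split_head[OF base4_code_summable[of a]] by simp
  also have "(\<Sum>n. of_bool (a (Suc n)) * (1/4 :: real) ^ Suc (Suc n)) = base4_code (\<lambda>n. a (Suc n)) / 4"
    unfolding base4_code_def
    using suminf_mult[OF base4_code_summable[of "\<lambda>n. a (Suc n)"], of "1/4"] by (simp add: mult_ac)
  finally show ?thesis by simp
qed

lemma base4_code_ge_iff: "1/4 \<le> base4_code a \<longleftrightarrow> a 0"
  using base4_code_rec[of a] base4_code_bounds[of "\<lambda>n. a (Suc n)"] by auto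

lemma base4_shift_code: "base4_shift (base4_code a) = base4_code (\<lambda>n. a (Suc n))"
  using base4_code_rec[of a] unfolding base4_shift_def base4_code_ge_iff by simp

lemma base4_digit: "1/4 \<le> (base4_shift ^^ n) (base4_code a) \<longleftrightarrow> a n"
proof (induction n arbitrary: a)
  case (Suc n)
  show ?case unfolding funpow_Suc_right comp_def base4_shift_code Suc.IH ..
qed (simp only: funpow_0 base4_code_ge_iff)

lemma base4_shift_measurable [measurable]: "(base4_shift ^^ n) \<in> borel_measurable borel"
proof (induction n)
  case (Suc n)
  have [measurable]: "base4_shift \<in> borel_measurable borel"
    unfolding base4_shift_def by measurable
  show ?case unfolding funpow.simps using Suc by measurable
qed (simp add: id_def)

text \<open>
  A point is coded by the truth values of \<open>q < x \<bullet> i\<close>, where \<open>i\<close> runs through the basis and \<open>q\<close> through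
  the rationals of \<open>[-1, 1]\<close>.  The coordinate \<open>x \<bullet> i\<close> is recovered as a supremum of
  rationals.  A left inverse \<open>g\<close> defined on the whole line makes it unnecessary to know that
  the range of \<open>\<phi>\<close> is a Borel set.
\<close>

lemma real_code_of_unit_ball:
  obtains \<phi> :: "'a::euclidean_space \<Rightarrow> real" and g :: "real \<Rightarrow> 'a"
  where "\<phi> \<in> borel_measurable borel" "\<And>x. 0 \<le> \<phi> x" "\<And>x. \<phi> x \<le> 1"
    "g \<in> borel_measurable borel" "\<And>x. norm x \<le> 1 \<Longrightarrow> g (\<phi> x) = x"
proof -
  define I where "I = (Basis :: 'a set) \<times> (\<rat> \<inter> {-1..1::real})"
  define e where "e n = fst (from_nat_into I n)" for n
  define q where "q n = snd (from_nat_into I n)" for n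
  have I: "countable I" "I \<noteq> {}"
    unfolding I_def by (auto intro!: countable_SIGMA countable_Int1 countable_rat simp: nonempty_Basis countable_finite)
  have q: "-1 \<le> q n" "q n \<le> 1" for n
    using from_nat_into[OF I(2), of n] by (auto simp: q_def I_def)
  define \<phi> where "\<phi> x = base4_code (\<lambda>n. q n < x \<bullet> e n)" for x
  define g where "g t = (\<Sum>i\<in>Basis. (SUP n. if e n = i \<and> 1/4 \<le> (base4_shift ^^ n) t then q n else -1) *\<^sub>R i)" for t
  have bdd: "bdd_above (range (\<lambda>n. if e n = i \<and> P n then q n else -1))" for i P
    using q by (intro bdd_aboveI[of _ 1]) auto
  have "\<phi> \<in> borel_measurable borel"
    unfolding \<phi>_def base4_code_def by measurable
  moreover have "0 \<le> \<phi> x" "\<phi> x \<le> 1" for x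
    using base4_code_bounds[of "\<lambda>n. q n < x \<bullet> e n"] by (auto simp: \<phi>_def)
  moreover have "g \<in> borel_measurable borel"
    unfolding g_def using bdd
    by (intro borel_measurable_sum borel_measurable_scaleR borel_measurable_cSUP) auto
  moreover have "g (\<phi> x) = x" if x: "norm x \<le> 1" for x
  proof -
    have "(SUP n. if e n = i \<and> q n < x \<bullet> e n then q n else -1) = x \<bullet> i" (is "?S = _") if i: "i \<in> Basis" for i
    proof (rule antisym)
      have xi: "-1 \<le> x \<bullet> i" "x \<bullet> i \<le> 1" using Basis_le_norm[OF i, of x] x by auto
      show "?S \<le> x \<bullet> i" using xi by (intro cSUP_least) auto
      show "x \<bullet> i \<le> ?S"
      proof (rule dense_le)
        fix y assume y: "y < x \<bullet> i"
        show "y \<le> ?S"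
        proof (cases "y < -1")
          case True
          have "-1 \<le> ?S" using q by (intro cSUP_upper2[OF bdd UNIV_I, of _ 0]) auto
          then show ?thesis using True by simp
        next
          case False
          obtain r where r: "r \<in> \<rat>" "y < r" "r < x \<bullet> i" using Rats_dense_in_real[OF y] by auto
          then have "(i, r) \<in> I" using i False xi by (auto simp: I_def)
          then obtain n where "from_nat_into I n = (i, r)"
            using from_nat_into_surj[OF I(1)] by blast
          then have "e n = i" "q n = r" by (auto simp: e_def q_def)
          then show ?thesis using r
            by (intro cSUP_upper2[OF bdd UNIV_I, of _ n]) auto
        qed
      qed
    qed
    then have "g (\<phi> x) = (\<Sum>i\<in>Basis. (x \<bullet> i) *\<^sub>R i)"
      unfolding g_def \<phi>_def base4_digit by simp
    then show ?thesis by (simp add: euclidean_representation)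
  qed
  ultimately show thesis by (rule that)
qed

lemma AE_eq_of_le_of_nn_integral_le:
  fixes f h :: "'w \<Rightarrow> ennreal"
  assumes [measurable]: "f \<in> borel_measurable M" "h \<in> borel_measurable M"
    and le: "AE x in M. f x \<le> h x" and fin: "(\<integral>\<^sup>+x. f x \<partial>M) \<noteq> \<infinity>"
    and ge: "(\<integral>\<^sup>+x. h x \<partial>M) \<le> (\<integral>\<^sup>+x. f x \<partial>M)"
  shows "AE x in M. f x = h x"
proof -
  have "(\<integral>\<^sup>+x. h x - f x \<partial>M) = (\<integral>\<^sup>+x. h x \<partial>M) - (\<integral>\<^sup>+x. f x \<partial>M)"
    by (rule nn_integral_diff) (use le fin in auto)
  also have "\<dots> = 0" using ge fin by (simp add: diff_eq_0_iff_ennreal top.not_eq_extremum)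
  finally have "AE x in M. h x - f x = 0" by (subst (asm) nn_integral_0_iff_AE) auto
  moreover have "AE x in M. f x \<noteq> \<infinity>" by (rule nn_integral_noteq_infinite) (use fin in auto)
  ultimately show ?thesis using le
    by eventually_elim (auto simp: diff_eq_0_iff_ennreal)
qed

text \<open>
  \<open>L C\<close> is the almost sure limit of the masses of \<open>C\<close>; the exceptional event may depend on \<open>C\<close>.  That the
  expected limits form the measure \<open>\<sigma>\<close> is the only trace of countable additivity, and it is what
  makes the construction of a measure possible.
\<close>

locale setwise_limit = prob_space M + finite_measure \<sigma>
  for M :: "'w measure" and \<sigma> :: "real measure" +
  fixes \<kappa> :: "nat \<Rightarrow> 'w \<Rightarrow> real measure" and L :: "real set \<Rightarrow> 'w \<Rightarrow> ennreal"
  assumes sets_\<sigma> [simp, measurable_cong]: "sets \<sigma> = sets borel"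
    and sets_\<kappa> [simp, measurable_cong]: "\<And>n \<omega>. sets (\<kappa> n \<omega>) = sets borel"
    and \<kappa>_support: "\<And>n \<omega> C. C \<in> sets borel \<Longrightarrow> emeasure (\<kappa> n \<omega>) C = emeasure (\<kappa> n \<omega>) (C \<inter> {0..1})"
    and L_measurable [measurable]: "\<And>C. C \<in> sets borel \<Longrightarrow> L C \<in> borel_measurable M"
    and L_limit: "\<And>C. C \<in> sets borel \<Longrightarrow> AE \<omega> in M. (\<lambda>n. emeasure (\<kappa> n \<omega>) C) \<longlonglongrightarrow> L C \<omega>"
    and L_integral: "\<And>C. C \<in> sets borel \<Longrightarrow> (\<integral>\<^sup>+\<omega>. L C \<omega> \<partial>M) = emeasure \<sigma> C"
begin

text \<open>
  The event that the limits along the rational half-lines are the values of the distribution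
  function of a finite measure on \<open>[0, 1]\<close>.  It only involves countably many of the \<open>L C\<close>.
\<close>

definition "good = {\<omega> \<in> space M.
  (\<forall>q::rat. L {..of_rat q} \<omega> < \<infinity>) \<and>
  (\<forall>q r::rat. q \<le> r \<longrightarrow> L {..of_rat q} \<omega> \<le> L {..of_rat r} \<omega>) \<and>
  (\<forall>q::rat. q < 0 \<longrightarrow> L {..of_rat q} \<omega> = 0) \<and>
  (\<forall>q::rat. 1 \<le> q \<longrightarrow> L {..of_rat q} \<omega> = L {..1} \<omega>)}"

lemma good_measurable [measurable]: "good \<in> sets M"
  unfolding good_def by measurable

lemma AE_good: "AE \<omega> in M. \<omega> \<in> good"
proof -
  have lim: "AE \<omega> in M. \<forall>q::rat. (\<lambda>n. emeasure (\<kappa> n \<omega>) {..of_rat q}) \<longlonglongrightarrow> L {..of_rat q} \<omega>"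
    unfolding AE_all_countable by (auto intro!: L_limit)
  have fin: "AE \<omega> in M. \<forall>q::rat. L {..of_rat q} \<omega> \<noteq> \<infinity>"
    unfolding AE_all_countable
    by (intro allI nn_integral_noteq_infinite) (auto simp: L_integral)
  from lim fin AE_space show ?thesis
  proof eventually_elim
    case (elim \<omega>)
    have l: "(\<lambda>n. emeasure (\<kappa> n \<omega>) {..of_rat q}) \<longlonglongrightarrow> L {..of_rat q} \<omega>" for q
      using elim by blast
    have "L {..of_rat q} \<omega> \<le> L {..of_rat r} \<omega>" if "q \<le> r" for q r :: rat
      by (rule LIMSEQ_le[OF l l]) (use that in \<open>auto intro!: exI emeasure_mono simp: of_rat_less_eq\<close>)
    moreover have "L {..of_rat q} \<omega> = 0" if "q < 0" for q
    proof -
      have "of_rat q < (0::real)" using that by simp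
      then have "{..of_rat q} \<inter> {0..1} = ({} :: real set)" by auto
      then have "emeasure (\<kappa> n \<omega>) {..of_rat q} = 0" for n
        using \<kappa>_support[of "{..of_rat q}" n \<omega>] by simp
      then show ?thesis using l[of q] by (simp add: LIMSEQ_const_iff)
    qed
    moreover have "L {..of_rat q} \<omega> = L {..1} \<omega>" if "1 \<le> q" for q
    proof -
      have "(1::real) \<le> of_rat q" using that by simp
      then have "{..of_rat q} \<inter> {0..1} = {..1} \<inter> {0..1::real}" by auto
      then have "emeasure (\<kappa> n \<omega>) {..of_rat q} = emeasure (\<kappa> n \<omega>) {..1}" for n
        using \<kappa>_support[of "{..of_rat q}" n \<omega>] \<kappa>_support[of "{..1}" n \<omega>] by simp
      then show ?thesis using l[of q] l[of 1] LIMSEQ_unique by auto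
    qed
    ultimately show ?case using elim by (auto simp: good_def top.not_eq_extremum)
  qed
qed

text \<open>
  Right continuity is enforced by taking the infimum over larger rationals.  Outside \<open>good\<close> the
  zero measure is used.
\<close>

definition dist_fun :: "'w \<Rightarrow> real \<Rightarrow> ennreal" where
  "dist_fun \<omega> x = (if \<omega> \<in> good then INF q\<in>{q::rat. x < of_rat q}. L {..of_rat q} \<omega> else 0)"

lemma dist_fun_measurable [measurable]: "(\<lambda>\<omega>. dist_fun \<omega> x) \<in> borel_measurable M"
  unfolding dist_fun_def by measurable

lemma dist_fun_le: "x < of_rat q \<Longrightarrow> dist_fun \<omega> x \<le> L {..of_rat q} \<omega>"
  unfolding dist_fun_def by (auto intro: INF_lower)

lemma dist_fun_mono: "x \<le> y \<Longrightarrow> dist_fun \<omega> x \<le> dist_fun \<omega> y"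
  unfolding dist_fun_def by (auto intro!: INF_superset_mono)

lemma dist_fun_finite: "dist_fun \<omega> x < \<infinity>"
proof (cases "\<omega> \<in> good")
  case True
  obtain q where "x < of_rat q" using of_rat_dense[of x "x + 1"] by auto
  then have "dist_fun \<omega> x \<le> L {..of_rat q} \<omega>" by (rule dist_fun_le)
  also have "\<dots> < \<infinity>" using True by (simp add: good_def)
  finally show ?thesis .
qed (simp add: dist_fun_def)

lemma dist_fun_neg: "x < 0 \<Longrightarrow> dist_fun \<omega> x = 0"
proof (cases "\<omega> \<in> good")
  assume "x < 0" "\<omega> \<in> good"
  obtain q where q: "x < of_rat q" "of_rat q < (0::real)" using of_rat_dense[OF \<open>x < 0\<close>] by auto
  then show ?thesis using dist_fun_le[OF q(1), of \<omega>] \<open>\<omega> \<in> good\<close> by (simp add: good_def)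
qed (simp add: dist_fun_def)

lemma dist_fun_ge_1: "1 \<le> x \<Longrightarrow> dist_fun \<omega> x = (if \<omega> \<in> good then L {..1} \<omega> else 0)"
proof (cases "\<omega> \<in> good")
  assume x: "1 \<le> x" and "\<omega> \<in> good"
  have "(INF q\<in>{q::rat. x < of_rat q}. L {..of_rat q} \<omega>) = (INF q\<in>{q::rat. x < of_rat q}. L {..1} \<omega>)"
  proof (intro INF_cong refl)
    fix q assume "q \<in> {q::rat. x < of_rat q}"
    then have "x < of_rat q" by simp
    with x have "(1::real) \<le> of_rat q" by linarith
    then have "1 \<le> q" by simp
    then show "L {..of_rat q} \<omega> = L {..1} \<omega>" using \<open>\<omega> \<in> good\<close> by (simp add: good_def)
  qed
  also have "\<dots> = L {..1} \<omega>"
    using of_rat_dense[of x "x + 1"] by (intro cINF_const) auto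
  finally show ?thesis using \<open>\<omega> \<in> good\<close> by (simp add: dist_fun_def)
qed (simp add: dist_fun_def)

definition "F \<omega> x = enn2real (dist_fun \<omega> x)"

lemma ennreal_F: "ennreal (F \<omega> x) = dist_fun \<omega> x"
  using dist_fun_finite by (simp add: F_def)

lemma F_mono: "x \<le> y \<Longrightarrow> F \<omega> x \<le> F \<omega> y"
  unfolding F_def using dist_fun_mono dist_fun_finite by (intro enn2real_mono) auto

lemma F_right_continuous: "continuous (at_right a) (F \<omega>)"
proof -
  have "(dist_fun \<omega> \<longlongrightarrow> dist_fun \<omega> a) (at_right a)"
  proof (rule order_tendstoI)
    fix y assume "y < dist_fun \<omega> a"
    then show "\<forall>\<^sub>F x in at_right a. y < dist_fun \<omega> x"
      using dist_fun_mono[of a _ \<omega>] by (auto simp: eventually_at_filter intro!: always_eventually elim: less_le_trans)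
  next
    fix y assume y: "dist_fun \<omega> a < y"
    show "\<forall>\<^sub>F x in at_right a. dist_fun \<omega> x < y"
    proof (cases "\<omega> \<in> good")
      case True
      then obtain q where q: "a < of_rat q" "L {..of_rat q} \<omega> < y"
        using y by (auto simp: dist_fun_def INF_less_iff)
      then show ?thesis
        using dist_fun_le[of _ q \<omega>] unfolding eventually_at_right_field
        by (intro exI[of _ "of_rat q"]) (auto intro: le_less_trans)
    qed (use y in \<open>auto simp: dist_fun_def\<close>)
  qed
  then have "((\<lambda>x. enn2real (dist_fun \<omega> x)) \<longlongrightarrow> enn2real (dist_fun \<omega> a)) (at_right a)"
    using dist_fun_finite by (intro tendsto_enn2real) auto
  then show ?thesis by (simp add: continuous_within F_def[abs_def])
qed

lemma F_at_bot: "(F \<omega> \<longlongrightarrow> 0) at_bot"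
  using dist_fun_neg[of _ \<omega>]
  by (intro tendsto_eventually) (auto simp: eventually_at_bot_dense F_def intro!: exI[of _ 0])

lemma F_at_top: "(F \<omega> \<longlongrightarrow> F \<omega> 1) at_top"
  using dist_fun_ge_1[of _ \<omega>]
  by (intro tendsto_eventually) (auto simp: eventually_at_top_linorder F_def intro!: exI[of _ 1])

definition "\<nu> \<omega> = interval_measure (F \<omega>)"

lemma sets_\<nu> [simp, measurable_cong]: "sets (\<nu> \<omega>) = sets borel"
  by (simp add: \<nu>_def)

lemma space_\<nu> [simp]: "space (\<nu> \<omega>) = UNIV"
  by (simp add: \<nu>_def)

lemma emeasure_\<nu>_atMost: "emeasure (\<nu> \<omega>) {..x} = dist_fun \<omega> x"
  unfolding \<nu>_def
  by (subst emeasure_interval_measure_Iic[OF F_mono F_right_continuous F_at_bot]) (auto simp: ennreal_F)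

lemma emeasure_\<nu>_UNIV: "emeasure (\<nu> \<omega>) UNIV = dist_fun \<omega> 1"
  unfolding \<nu>_def
  by (subst interval_measure_UNIV[OF F_mono F_right_continuous F_at_bot F_at_top])
    (auto simp: ennreal_F, auto simp: F_def)

lemma finite_measure_\<nu>: "finite_measure (\<nu> \<omega>)"
  by (rule finite_measureI) (use dist_fun_finite[of \<omega> 1] in \<open>auto simp: emeasure_\<nu>_UNIV\<close>)

definition "realized C \<longleftrightarrow> (\<lambda>\<omega>. emeasure (\<nu> \<omega>) C) \<in> borel_measurable M \<and>
  (AE \<omega> in M. L C \<omega> = emeasure (\<nu> \<omega>) C)"

lemma L_add:
  assumes [measurable]: "A \<in> sets borel" "B \<in> sets borel" and "A \<inter> B = {}"
  shows "AE \<omega> in M. L (A \<union> B) \<omega> = L A \<omega> + L B \<omega>"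
  using L_limit[OF assms(1)] L_limit[OF assms(2)] L_limit[OF sets.Un[OF assms(1,2)]]
proof eventually_elim
  case (elim \<omega>)
  have "(\<lambda>n. emeasure (\<kappa> n \<omega>) A + emeasure (\<kappa> n \<omega>) B) \<longlonglongrightarrow> L A \<omega> + L B \<omega>"
    by (intro tendsto_add elim)
  then have "(\<lambda>n. emeasure (\<kappa> n \<omega>) (A \<union> B)) \<longlonglongrightarrow> L A \<omega> + L B \<omega>"
    using assms by (simp add: plus_emeasure)
  then show ?case using elim(3) LIMSEQ_unique by blast
qed

lemma L_mono:
  assumes [measurable]: "A \<in> sets borel" "B \<in> sets borel" and "A \<subseteq> B"
  shows "AE \<omega> in M. L A \<omega> \<le> L B \<omega>"
  using L_limit[OF assms(1)] L_limit[OF assms(2)]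
  by eventually_elim (rule LIMSEQ_le, assumption, assumption,
    use assms in \<open>auto intro!: exI emeasure_mono\<close>)

text \<open>
  The infimum in the distribution function gives one inequality.  For the expectations the converse
  holds by continuity of \<open>\<sigma>\<close> from above, and so both sides agree almost surely.
\<close>

lemma realized_atMost: "realized {..x}"
proof -
  have [measurable]: "(\<lambda>\<omega>. emeasure (\<nu> \<omega>) {..x}) \<in> borel_measurable M"
    unfolding emeasure_\<nu>_atMost by measurable
  have "AE \<omega> in M. \<forall>q::rat. x < of_rat q \<longrightarrow> L {..x} \<omega> \<le> L {..of_rat q} \<omega>"
    unfolding AE_all_countable using L_mono[of "{..x}" "{..of_rat _}"] by (auto simp: AE_impI)
  with AE_good have le: "AE \<omega> in M. L {..x} \<omega> \<le> emeasure (\<nu> \<omega>) {..x}"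
    by eventually_elim (auto simp: emeasure_\<nu>_atMost dist_fun_def intro!: INF_greatest)
  have "(\<lambda>m. emeasure \<sigma> {..x + inverse (Suc m)}) \<longlonglongrightarrow> emeasure \<sigma> (\<Inter>m. {..x + inverse (Suc m)})"
    by (intro Lim_emeasure_decseq) (auto simp: decseq_def le_imp_inverse_le)
  also have "(\<Inter>m. {..x + inverse (real (Suc m))}) = {..x}"
  proof safe
    fix y assume y: "y \<in> (\<Inter>m. {..x + inverse (real (Suc m))})"
    show "y \<le> x"
    proof (rule ccontr)
      assume "\<not> y \<le> x"
      then obtain m where "inverse (real (Suc m)) < y - x"
        using reals_Archimedean[of "y - x"] by auto
      moreover have "y \<le> x + inverse (real (Suc m))" using y by blast
      ultimately show False by simp
    qed
  qed (auto intro: add_increasing2)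
  finally have lim: "(\<lambda>m. emeasure \<sigma> {..x + inverse (Suc m)}) \<longlonglongrightarrow> emeasure \<sigma> {..x}" .
  have "(\<integral>\<^sup>+\<omega>. emeasure (\<nu> \<omega>) {..x} \<partial>M) \<le> emeasure \<sigma> {..x + inverse (Suc m)}" for m
  proof -
    obtain q where q: "x < of_rat q" "of_rat q < x + inverse (Suc m)"
      using of_rat_dense[of x "x + inverse (Suc m)"] by auto
    have "(\<integral>\<^sup>+\<omega>. emeasure (\<nu> \<omega>) {..x} \<partial>M) \<le> (\<integral>\<^sup>+\<omega>. L {..of_rat q} \<omega> \<partial>M)"
      unfolding emeasure_\<nu>_atMost by (intro nn_integral_mono dist_fun_le q)
    also have "\<dots> = emeasure \<sigma> {..of_rat q}" by (rule L_integral) simp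
    also have "\<dots> \<le> emeasure \<sigma> {..x + inverse (Suc m)}" using q by (intro emeasure_mono) auto
    finally show ?thesis .
  qed
  then have "(\<integral>\<^sup>+\<omega>. emeasure (\<nu> \<omega>) {..x} \<partial>M) \<le> (\<integral>\<^sup>+\<omega>. L {..x} \<omega> \<partial>M)"
    using LIMSEQ_le_const[OF lim] by (simp add: L_integral)
  then show ?thesis
    using le AE_eq_of_le_of_nn_integral_le[of "L {..x}" M "\<lambda>\<omega>. emeasure (\<nu> \<omega>) {..x}"]
    by (simp add: realized_def L_integral)
qed

lemma realized_UNIV: "realized UNIV"
proof -
  have borel_UNIV: "UNIV \<in> sets (borel :: real measure)" by simp
  have "AE \<omega> in M. L UNIV \<omega> = L {..1} \<omega>"
    using L_limit[OF borel_UNIV] L_limit[OF atMost_borel[of 1]]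
  proof eventually_elim
    case (elim \<omega>)
    have "emeasure (\<kappa> n \<omega>) UNIV = emeasure (\<kappa> n \<omega>) {..1}" for n
      using \<kappa>_support[of UNIV n \<omega>] \<kappa>_support[of "{..1}" n \<omega>] by (simp add: Int_absorb1)
    then show ?case using elim LIMSEQ_unique by auto
  qed
  with realized_atMost[of 1] show ?thesis
    unfolding realized_def emeasure_\<nu>_UNIV emeasure_\<nu>_atMost by auto
qed

lemma realized_compl:
  assumes C [measurable]: "C \<in> sets borel" and "realized C"
  shows "realized (UNIV - C)"
proof -
  have m [measurable]: "(\<lambda>\<omega>. emeasure (\<nu> \<omega>) C) \<in> borel_measurable M"
    "(\<lambda>\<omega>. emeasure (\<nu> \<omega>) UNIV) \<in> borel_measurable M"
    using assms realized_UNIV by (auto simp: realized_def)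
  have fin: "emeasure (\<nu> \<omega>) A \<noteq> \<infinity>" for \<omega> A
    using finite_measure.emeasure_finite[OF finite_measure_\<nu>] by simp
  have diff: "emeasure (\<nu> \<omega>) (UNIV - C) = emeasure (\<nu> \<omega>) UNIV - emeasure (\<nu> \<omega>) C" for \<omega>
    using emeasure_compl[of C "\<nu> \<omega>"] fin by simp
  have L: "AE \<omega> in M. L UNIV \<omega> = L C \<omega> + L (UNIV - C) \<omega>"
    using L_add[of C "UNIV - C"] by simp
  have "AE \<omega> in M. L (UNIV - C) \<omega> = emeasure (\<nu> \<omega>) (UNIV - C)"
    using L assms(2)[unfolded realized_def, THEN conjunct2] realized_UNIV[unfolded realized_def, THEN conjunct2]
  proof eventually_elim
    case (elim \<omega>)
    have "emeasure (\<nu> \<omega>) C + L (UNIV - C) \<omega> = emeasure (\<nu> \<omega>) UNIV"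
      using elim by simp
    then show ?case
      unfolding diff using fin by (metis ennreal_add_diff_cancel_left infinity_ennreal_def)
  qed
  then show ?thesis unfolding realized_def diff by simp
qed

text \<open>
  A limit of measures is superadditive over countably many disjoint sets.  Both sides have
  expectation \<open>\<sigma> (\<Union>i. A i)\<close>, so the inequality is an equality almost surely.
\<close>

lemma realized_disjoint_union:
  fixes A :: "nat \<Rightarrow> real set"
  assumes disj: "disjoint_family A" and A: "\<And>i. A i \<in> sets borel" and R: "\<And>i. realized (A i)"
  shows "realized (\<Union>i. A i)"
proof -
  note [measurable] = A
  let ?U = "\<Union>i. A i"
  have [measurable]: "(\<lambda>\<omega>. emeasure (\<nu> \<omega>) (A i)) \<in> borel_measurable M" for i
    using R by (simp add: realized_def)
  have sum: "emeasure (\<nu> \<omega>) ?U = (\<Sum>i. emeasure (\<nu> \<omega>) (A i))" for \<omega>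
    by (rule suminf_emeasure[symmetric]) (use disj A in auto)
  have [measurable]: "(\<lambda>\<omega>. emeasure (\<nu> \<omega>) ?U) \<in> borel_measurable M"
    unfolding sum by measurable
  have eq: "AE \<omega> in M. \<forall>i. L (A i) \<omega> = emeasure (\<nu> \<omega>) (A i)"
    unfolding AE_all_countable using R by (simp add: realized_def)
  have lim: "AE \<omega> in M. \<forall>i. (\<lambda>n. emeasure (\<kappa> n \<omega>) (A i)) \<longlonglongrightarrow> L (A i) \<omega>"
    unfolding AE_all_countable using L_limit A by blast
  have U: "?U \<in> sets borel" by measurable
  have le: "AE \<omega> in M. emeasure (\<nu> \<omega>) ?U \<le> L ?U \<omega>"
    using eq lim L_limit[OF U]
  proof eventually_elim
    case (elim \<omega>)
    have "(\<Sum>i<m. emeasure (\<nu> \<omega>) (A i)) \<le> L ?U \<omega>" for m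
    proof (rule LIMSEQ_le)
      show "(\<lambda>n. \<Sum>i<m. emeasure (\<kappa> n \<omega>) (A i)) \<longlonglongrightarrow> (\<Sum>i<m. emeasure (\<nu> \<omega>) (A i))"
        using elim by (intro tendsto_sum) auto
      show "(\<lambda>n. emeasure (\<kappa> n \<omega>) ?U) \<longlonglongrightarrow> L ?U \<omega>" by (fact elim)
      show "\<exists>N. \<forall>n\<ge>N. (\<Sum>i<m. emeasure (\<kappa> n \<omega>) (A i)) \<le> emeasure (\<kappa> n \<omega>) ?U"
      proof (intro exI allI impI)
        fix n
        have "(\<Sum>i<m. emeasure (\<kappa> n \<omega>) (A i)) = emeasure (\<kappa> n \<omega>) (\<Union>i<m. A i)"
          using disj A by (intro sum_emeasure) (auto intro: disjoint_family_on_mono)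
        also have "\<dots> \<le> emeasure (\<kappa> n \<omega>) ?U" by (intro emeasure_mono) auto
        finally show "(\<Sum>i<m. emeasure (\<kappa> n \<omega>) (A i)) \<le> emeasure (\<kappa> n \<omega>) ?U" .
      qed
    qed
    then show ?case unfolding sum suminf_eq_SUP by (intro SUP_least)
  qed
  have int: "(\<integral>\<^sup>+\<omega>. emeasure (\<nu> \<omega>) ?U \<partial>M) = emeasure \<sigma> ?U"
  proof -
    have "(\<integral>\<^sup>+\<omega>. emeasure (\<nu> \<omega>) ?U \<partial>M) = (\<Sum>i. \<integral>\<^sup>+\<omega>. emeasure (\<nu> \<omega>) (A i) \<partial>M)"
      unfolding sum by (rule nn_integral_suminf) measurable
    also have "\<dots> = (\<Sum>i. \<integral>\<^sup>+\<omega>. L (A i) \<omega> \<partial>M)"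
      by (intro suminf_cong nn_integral_cong_AE) (use eq in \<open>auto elim: eventually_mono\<close>)
    also have "\<dots> = (\<Sum>i. emeasure \<sigma> (A i))" by (simp add: L_integral A)
    also have "\<dots> = emeasure \<sigma> ?U" by (rule suminf_emeasure) (use disj A in auto)
    finally show ?thesis .
  qed
  have "AE \<omega> in M. emeasure (\<nu> \<omega>) ?U = L ?U \<omega>"
    by (rule AE_eq_of_le_of_nn_integral_le) (use le in \<open>auto simp: int L_integral\<close>)
  then show ?thesis by (auto simp: realized_def elim: eventually_mono)
qed

lemma realized_borel:
  assumes "C \<in> sets borel"
  shows "realized C"
proof -
  let ?G = "range (\<lambda>a::real. {..a})"
  have gen: "sets borel = sigma_sets UNIV ?G"
    by (subst borel_eq_atMost) simp
  have "Int_stable ?G" by (auto simp: Int_stable_def)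
  moreover have "?G \<subseteq> Pow UNIV" by simp
  moreover have "C \<in> sigma_sets UNIV ?G" using assms unfolding gen .
  ultimately show ?thesis
  proof (induction rule: sigma_sets_induct_disjoint)
    case empty
    have "realized (UNIV - UNIV)" by (rule realized_compl[OF _ realized_UNIV]) simp
    then show ?case by simp
  next
    case (compl A)
    then show ?case unfolding gen[symmetric] by (intro realized_compl)
  next
    case (union A)
    then show ?case unfolding gen[symmetric] by (intro realized_disjoint_union) auto
  qed (auto simp: realized_atMost)
qed

end

text \<open>
  Everything is transported to the line by \<open>\<phi>\<close> and the constructed measure is brought back by its
  left inverse \<open>g\<close>.  The preimage under \<open>\<phi>\<close> of \<open>g -` B\<close> is \<open>B\<close> itself, so the limits are the right
  ones.
\<close>

lemma random_measure_of_setwise_limits: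
  fixes \<sigma> :: "'a::euclidean_space measure" and \<kappa> :: "nat \<Rightarrow> 'w \<Rightarrow> 'a measure"
  assumes M: "prob_space M" and fin: "finite_measure \<sigma>"
    and S: "S \<in> sets borel" "S \<noteq> {}" "S \<subseteq> cball 0 1"
    and base_sets: "sets \<sigma> = sets (restrict_space borel S)"
    and approx_sets: "\<And>n \<omega>. sets (\<kappa> n \<omega>) = sets (restrict_space borel S)"
    and lim: "\<And>B. B \<in> sets \<sigma> \<Longrightarrow> \<exists>L\<in>borel_measurable M.
       (AE \<omega> in M. (\<lambda>n. emeasure (\<kappa> n \<omega>) B) \<longlonglongrightarrow> L \<omega>) \<and> (\<integral>\<^sup>+\<omega>. L \<omega> \<partial>M) = emeasure \<sigma> B"
  obtains \<mu> where "finite_random_measure M (restrict_space borel S) \<mu>"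
    and "\<And>B. B \<in> sets \<sigma> \<Longrightarrow> AE \<omega> in M. (\<lambda>n. emeasure (\<kappa> n \<omega>) B) \<longlonglongrightarrow> emeasure (\<mu> \<omega>) B"
proof -
  let ?S = "restrict_space borel S"
  obtain \<phi> :: "'a \<Rightarrow> real" and g0 :: "real \<Rightarrow> 'a" where code:
    "\<phi> \<in> borel_measurable borel" "\<And>x. 0 \<le> \<phi> x" "\<And>x. \<phi> x \<le> 1"
    "g0 \<in> borel_measurable borel" "\<And>x. norm x \<le> 1 \<Longrightarrow> g0 (\<phi> x) = x"
    by (rule real_code_of_unit_ball) blast
  obtain s where s: "s \<in> S" using S(2) by blast
  define g where "g t = (if g0 t \<in> S then g0 t else s)" for t
  have g [measurable]: "g \<in> borel \<rightarrow>\<^sub>M ?S"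
  proof (rule measurable_restrict_space2)
    show "g \<in> space borel \<rightarrow> S" using s by (auto simp: g_def)
    note [measurable] = code(4) S(1)
    show "g \<in> borel \<rightarrow>\<^sub>M borel" unfolding g_def by measurable
  qed
  have g\<phi>: "g (\<phi> x) = x" if "x \<in> S" for x
    using that S(3) code(5)[of x] by (auto simp: g_def)
  have [measurable]: "\<phi> \<in> ?S \<rightarrow>\<^sub>M borel"
    by (rule measurable_restrict_space1[OF code(1)])
  have \<phi>\<sigma>: "\<phi> \<in> \<sigma> \<rightarrow>\<^sub>M borel" and \<phi>\<kappa>: "\<phi> \<in> \<kappa> n \<omega> \<rightarrow>\<^sub>M borel" for n \<omega>
    unfolding measurable_cong_sets[OF base_sets refl] measurable_cong_sets[OF approx_sets refl] by measurable
  have space: "space \<sigma> = S" "space (\<kappa> n \<omega>) = S" for n \<omega>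
    using sets_eq_imp_space_eq[OF base_sets] sets_eq_imp_space_eq[OF approx_sets] by (auto simp: space_restrict_space)
  define D where "D C = \<phi> -` C \<inter> S" for C
  have D: "D C \<in> sets \<sigma>" if "C \<in> sets borel" for C
    using measurable_sets[OF \<phi>\<sigma> that] by (simp add: D_def space)
  have "\<forall>C\<in>sets borel. \<exists>L. L \<in> borel_measurable M \<and>
     (AE \<omega> in M. (\<lambda>n. emeasure (\<kappa> n \<omega>) (D C)) \<longlonglongrightarrow> L \<omega>) \<and> (\<integral>\<^sup>+\<omega>. L \<omega> \<partial>M) = emeasure \<sigma> (D C)"
    using lim[OF D] by blast
  then obtain L where L': "\<forall>C\<in>sets borel. L C \<in> borel_measurable M \<and>
     (AE \<omega> in M. (\<lambda>n. emeasure (\<kappa> n \<omega>) (D C)) \<longlonglongrightarrow> L C \<omega>) \<and> (\<integral>\<^sup>+\<omega>. L C \<omega> \<partial>M) = emeasure \<sigma> (D C)"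
    unfolding bchoice_iff ..
  have L: "\<And>C. C \<in> sets borel \<Longrightarrow> L C \<in> borel_measurable M"
    "\<And>C. C \<in> sets borel \<Longrightarrow> AE \<omega> in M. (\<lambda>n. emeasure (\<kappa> n \<omega>) (D C)) \<longlonglongrightarrow> L C \<omega>"
    "\<And>C. C \<in> sets borel \<Longrightarrow> (\<integral>\<^sup>+\<omega>. L C \<omega> \<partial>M) = emeasure \<sigma> (D C)"
    using L' by blast+
  have e\<sigma>: "emeasure (distr \<sigma> borel \<phi>) C = emeasure \<sigma> (D C)" if "C \<in> sets borel" for C
    using that by (simp add: emeasure_distr \<phi>\<sigma> D_def space)
  have e\<kappa>: "emeasure (distr (\<kappa> n \<omega>) borel \<phi>) C = emeasure (\<kappa> n \<omega>) (D C)" if "C \<in> sets borel" for C n \<omega>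
    using that by (simp add: emeasure_distr \<phi>\<kappa> D_def space)
  \<comment> \<open>the codes lie in \<open>[0, 1]\<close>, so the image measures do too\<close>
  have D01: "D (C \<inter> {0..1}) = D C" for C
    using code(2,3) by (auto simp: D_def)
  interpret setwise_limit M "distr \<sigma> borel \<phi>" "\<lambda>n \<omega>. distr (\<kappa> n \<omega>) borel \<phi>" L
  proof (intro setwise_limit.intro setwise_limit_axioms.intro M)
    show "finite_measure (distr \<sigma> borel \<phi>)"
      by (rule finite_measure.finite_measure_distr[OF fin \<phi>\<sigma>])
    show "emeasure (distr (\<kappa> n \<omega>) borel \<phi>) C = emeasure (distr (\<kappa> n \<omega>) borel \<phi>) (C \<inter> {0..1})"
      if "C \<in> sets borel" for n \<omega> C
      using that by (simp add: e\<kappa> D01)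
  qed (use L in \<open>auto simp: e\<sigma> e\<kappa>\<close>)
  define \<mu> where "\<mu> \<omega> = distr (\<nu> \<omega>) ?S g" for \<omega>
  have g\<nu>: "g \<in> \<nu> \<omega> \<rightarrow>\<^sub>M ?S" for \<omega>
    by measurable
  have g_sets: "g -` B \<in> sets borel" if "B \<in> sets ?S" for B
    using measurable_sets[OF g that] by simp
  have e\<mu>: "emeasure (\<mu> \<omega>) B = emeasure (\<nu> \<omega>) (g -` B)" if "B \<in> sets ?S" for B \<omega>
    using that by (simp add: \<mu>_def emeasure_distr[OF g\<nu>])
  show thesis
  proof (rule that)
    show "finite_random_measure M ?S \<mu>"
      unfolding finite_random_measure_def
    proof (intro conjI ballI)
      fix \<omega>
      show "finite_measure (\<mu> \<omega>)"
        unfolding \<mu>_def by (rule finite_measure.finite_measure_distr[OF finite_measure_\<nu> g\<nu>])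
      show "sets (\<mu> \<omega>) = sets ?S" by (simp add: \<mu>_def)
    next
      fix B assume B: "B \<in> sets ?S"
      show "(\<lambda>\<omega>. emeasure (\<mu> \<omega>) B) \<in> borel_measurable M"
        unfolding e\<mu>[OF B] using realized_borel[OF g_sets[OF B]] by (simp add: realized_def)
    qed
    fix B assume "B \<in> sets \<sigma>"
    then have B: "B \<in> sets ?S" using base_sets by simp
    have "B \<subseteq> S" using sets.sets_into_space[OF B] by (simp add: space_restrict_space)
    then have DB: "D (g -` B) = B" using g\<phi> by (auto simp: D_def)
    show "AE \<omega> in M. (\<lambda>n. emeasure (\<kappa> n \<omega>) B) \<longlonglongrightarrow> emeasure (\<mu> \<omega>) B"
      using L(2)[OF g_sets[OF B]] realized_borel[OF g_sets[OF B], unfolded realized_def, THEN conjunct2]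
      by eventually_elim (simp add: DB e\<mu>[OF B])
  qed
qed

section \<open>Convergence of the cascade\<close>

theorem theorem1:
  fixes M :: "'w measure"
    and \<Lambda> :: "nat \<Rightarrow> 'a::euclidean_space \<Rightarrow> 'w \<Rightarrow> real"
    and d k :: nat
    and ps :: "nat \<Rightarrow> real"
    and p b :: real
    and \<rho> :: "real \<Rightarrow> real"
    and \<BB> :: "'a set set"
  assumes "prob_space M"
    and "d \<ge> 1" and "DIM('a) = d + 1"
    and "independent_fields M \<Lambda>"
    and "\<And>i. jointly_measurable M (\<Lambda> i)"
    and "\<And>i. AE \<omega> in M. \<forall>\<theta>\<in>sphere 0 1. \<Lambda> i \<theta> \<omega> \<ge> 0"
    and "\<And>i \<theta>. \<theta> \<in> sphere 0 1 \<Longrightarrow> integrable M (\<Lambda> i \<theta>) \<and> (\<integral>\<omega>. \<Lambda> i \<theta> \<omega> \<partial>M) = 1"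
    and "\<And>i \<theta>. \<theta> \<in> sphere 0 1 \<Longrightarrow> integrable M (\<lambda>\<omega>. (\<Lambda> i \<theta> \<omega>)\<^sup>2)"
    and "k \<ge> 2"
    and "\<And>j. j \<in> {1..k} \<Longrightarrow> ps j \<ge> 1"
    and "(\<Sum>j=1..k. ps j) = p" and "p \<ge> 2"
    and "antimono_on {0..} \<rho>" and "b > 1"
    and "\<And>i \<theta>. (\<And>j. j \<in> {1..k} \<Longrightarrow> \<theta> j \<in> sphere 0 1) \<Longrightarrow>
           integrable M (\<lambda>\<omega>. \<Prod>j=1..k. \<Lambda> i (\<theta> j) \<omega> powr ps j) \<and>
           \<rho> (b ^ i * min_angular_dist k \<theta>) \<ge> (\<integral>\<omega>. (\<Prod>j=1..k. \<Lambda> i (\<theta> j) \<omega> powr ps j) \<partial>M)"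
    and "b > \<rho> 0 powr (1 / real d)"
    and "summable (\<lambda>i. ln (\<rho> (b ^ i)))"
    and "countable \<BB>" and "\<BB> \<subseteq> sets sphere_borel"
  shows "\<exists>\<mu> :: 'w \<Rightarrow> 'a measure.
           finite_random_measure M sphere_borel \<mu> \<and>
           (AE \<omega> in M. \<forall>B\<in>\<BB>.
              (\<lambda>n. measure (cumulative_measure \<Lambda> n \<omega>) B) \<longlonglongrightarrow> measure (\<mu> \<omega>) B) \<and>
           (\<forall>B\<in>\<BB>. tendsto_in_Lp M p
              (\<lambda>n \<omega>. measure (cumulative_measure \<Lambda> n \<omega>) B) (\<lambda>\<omega>. measure (\<mu> \<omega>) B))"
proof -
  let ?S = "sphere 0 1 :: 'a set" and ?\<sigma> = "sphere_measure :: 'a measure"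
  interpret prob_space M by (rule assms(1))
  interpret random_fields M \<Lambda>
    using assms by unfold_locales auto
  \<comment> \<open>raising \<open>\<rho>\<close> to at least 1 keeps the moment bound; \<open>b > 1\<close> keeps the condition at 0\<close>
  define r where "r x = max 1 (\<rho> x)" for x
  have anti: "r y \<le> r x" if "0 \<le> x" "x \<le> y" for x y
  proof -
    have "\<rho> y \<le> \<rho> x" using assms(13) that by (auto simp: monotone_on_def)
    then show ?thesis by (auto simp: r_def max_def)
  qed
  obtain K where K: "\<And>N. (\<Prod>i<N. max 1 (\<rho> (b ^ i))) \<le> K"
    using bounded_prod_max_1[OF assms(13) \<open>b > 1\<close> assms(17)] by blast
  have R: "r 0 < b ^ d"
  proof -
    have "\<rho> 0 < b ^ d"
    proof (cases "0 < \<rho> 0")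
      case True
      have "\<rho> 0 = (\<rho> 0 powr (1 / real d)) ^ d"
        using True \<open>d \<ge> 1\<close> by (simp add: powr_powr flip: powr_realpow)
      also have "\<dots> < b ^ d"
        using assms(16) \<open>d \<ge> 1\<close> by (intro power_strict_mono) auto
      finally show ?thesis .
    next
      case False
      then show ?thesis using zero_less_power[of b d] \<open>b > 1\<close> by linarith
    qed
    then show ?thesis using one_less_power[OF \<open>b > 1\<close>, of d] \<open>d \<ge> 1\<close> by (simp add: r_def)
  qed
  have moment: "(\<integral>\<^sup>+\<omega>. (\<Prod>j=1..k. ennreal (\<bar>\<Lambda> i (\<theta> j) \<omega>\<bar> powr ps j)) \<partial>M)
      \<le> ennreal (r (b ^ i * min_angular_dist k \<theta>))"
    if \<theta>: "\<And>j. j \<in> {1..k} \<Longrightarrow> \<theta> j \<in> ?S" for i \<theta>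
  proof -
    have "(\<integral>\<^sup>+\<omega>. (\<Prod>j=1..k. ennreal (\<bar>\<Lambda> i (\<theta> j) \<omega>\<bar> powr ps j)) \<partial>M)
        = (\<integral>\<^sup>+\<omega>. ennreal (\<Prod>j=1..k. \<Lambda> i (\<theta> j) \<omega> powr ps j) \<partial>M)"
    proof (rule nn_integral_cong_AE)
      show "AE \<omega> in M. (\<Prod>j=1..k. ennreal (\<bar>\<Lambda> i (\<theta> j) \<omega>\<bar> powr ps j))
          = ennreal (\<Prod>j=1..k. \<Lambda> i (\<theta> j) \<omega> powr ps j)"
        using assms(6)[of i]
      proof eventually_elim
        case (elim \<omega>)
        then have "\<bar>\<Lambda> i (\<theta> j) \<omega>\<bar> = \<Lambda> i (\<theta> j) \<omega>" if "j \<in> {1..k}" for j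
          using \<theta>[OF that] by simp
        then show ?case by (simp add: prod_ennreal)
      qed
    qed
    also have "\<dots> = ennreal (\<integral>\<omega>. (\<Prod>j=1..k. \<Lambda> i (\<theta> j) \<omega> powr ps j) \<partial>M)"
      using assms(15)[of \<theta> i] \<theta> by (intro nn_integral_eq_integral AE_I2 prod_nonneg) auto
    also have "\<dots> \<le> ennreal (r (b ^ i * min_angular_dist k \<theta>))"
      using assms(15)[of \<theta> i] \<theta> by (intro ennreal_leI) (auto simp: r_def)
    finally show ?thesis .
  qed
  have r1: "1 \<le> r x" for x by (simp add: r_def)
  have Kr: "(\<Prod>i<N. r (b ^ i)) \<le> K" for N using K by (simp add: r_def)
  obtain C where C: "\<And>n. (\<integral>\<^sup>+\<omega>. ennreal (enn2real (mass n ?S \<omega>) powr p) \<partial>M) \<le> ennreal C"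
  proof (rule moment_bounded[OF \<open>DIM('a) = d + 1\<close> \<open>k \<ge> 2\<close> assms(10) r1 anti \<open>b > 1\<close> Kr R moment])
    fix C assume "\<And>n. (\<integral>\<^sup>+\<omega>. ennreal (enn2real (mass n ?S \<omega>) powr (\<Sum>j=1..k. ps j)) \<partial>M) \<le> ennreal C"
    then show thesis unfolding assms(11) by (rule that)
  qed
  have lim: "\<exists>L. L \<in> borel_measurable M \<and>
      (AE \<omega> in M. (\<lambda>n. emeasure (cumulative_measure \<Lambda> n \<omega>) B) \<longlonglongrightarrow> ennreal (L \<omega>)) \<and>
      (\<integral>\<^sup>+\<omega>. ennreal (L \<omega>) \<partial>M) = emeasure ?\<sigma> B \<and> (AE \<omega> in M. 0 \<le> L \<omega>) \<and>
      tendsto_in_Lp M p (\<lambda>n \<omega>. measure (cumulative_measure \<Lambda> n \<omega>) B) L"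
    if B: "B \<in> sets ?\<sigma>" for B
    by (rule mass_limit[OF B \<open>p \<ge> 2\<close> C]) blast
  obtain \<mu> where \<mu>: "finite_random_measure M (sphere_borel :: 'a measure) \<mu>"
    and \<mu>_lim: "\<And>B. B \<in> sets ?\<sigma> \<Longrightarrow>
      AE \<omega> in M. (\<lambda>n. emeasure (cumulative_measure \<Lambda> n \<omega>) B) \<longlonglongrightarrow> emeasure (\<mu> \<omega>) B"
  proof (rule random_measure_of_setwise_limits[of M ?\<sigma> ?S "cumulative_measure \<Lambda>"])
    show "\<exists>L\<in>borel_measurable M. (AE \<omega> in M. (\<lambda>n. emeasure (cumulative_measure \<Lambda> n \<omega>) B) \<longlonglongrightarrow> L \<omega>) \<and>
        (\<integral>\<^sup>+\<omega>. L \<omega> \<partial>M) = emeasure ?\<sigma> B" if B: "B \<in> sets ?\<sigma>" for B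
    proof -
      obtain L where L: "L \<in> borel_measurable M"
        "AE \<omega> in M. (\<lambda>n. emeasure (cumulative_measure \<Lambda> n \<omega>) B) \<longlonglongrightarrow> ennreal (L \<omega>)"
        "(\<integral>\<^sup>+\<omega>. ennreal (L \<omega>) \<partial>M) = emeasure ?\<sigma> B"
        using lim[OF B] by blast
      then show ?thesis by (intro bexI[of _ "\<lambda>\<omega>. ennreal (L \<omega>)"]) auto
    qed
  qed (use prob_space_axioms \<sigma>.finite_measure_axioms in
      \<open>auto simp: cumulative_measure_def\<close>)
  have \<mu>_meas: "(\<lambda>\<omega>. measure (\<mu> \<omega>) B) \<in> borel_measurable M" if "B \<in> sets ?\<sigma>" for B
  proof -
    have [measurable]: "(\<lambda>\<omega>. emeasure (\<mu> \<omega>) B) \<in> borel_measurable M"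
      using \<mu> that by (simp add: finite_random_measure_def)
    show ?thesis unfolding measure_def by measurable
  qed
  have conv: "(AE \<omega> in M. (\<lambda>n. measure (cumulative_measure \<Lambda> n \<omega>) B) \<longlonglongrightarrow> measure (\<mu> \<omega>) B) \<and>
      tendsto_in_Lp M p (\<lambda>n \<omega>. measure (cumulative_measure \<Lambda> n \<omega>) B) (\<lambda>\<omega>. measure (\<mu> \<omega>) B)"
    if B: "B \<in> sets ?\<sigma>" for B
  proof
    obtain L where L: "L \<in> borel_measurable M"
      "AE \<omega> in M. (\<lambda>n. emeasure (cumulative_measure \<Lambda> n \<omega>) B) \<longlonglongrightarrow> ennreal (L \<omega>)"
      "AE \<omega> in M. 0 \<le> L \<omega>"
      "tendsto_in_Lp M p (\<lambda>n \<omega>. measure (cumulative_measure \<Lambda> n \<omega>) B) L"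
      using lim[OF B] by blast
    show "AE \<omega> in M. (\<lambda>n. measure (cumulative_measure \<Lambda> n \<omega>) B) \<longlonglongrightarrow> measure (\<mu> \<omega>) B"
      using \<mu>_lim[OF B] L(2)
    proof eventually_elim
      case (elim \<omega>)
      then have "emeasure (\<mu> \<omega>) B = ennreal (L \<omega>)" by (rule LIMSEQ_unique)
      then show ?case unfolding measure_def using elim by (intro tendsto_enn2real) auto
    qed
    have L\<mu>: "AE \<omega> in M. L \<omega> = measure (\<mu> \<omega>) B"
      using \<mu>_lim[OF B] L(2,3)
    proof eventually_elim
      case (elim \<omega>)
      then have "emeasure (\<mu> \<omega>) B = ennreal (L \<omega>)" by (intro LIMSEQ_unique)
      then show ?case using elim(3) by (simp add: measure_def)
    qed
    show "tendsto_in_Lp M p (\<lambda>n \<omega>. measure (cumulative_measure \<Lambda> n \<omega>) B) (\<lambda>\<omega>. measure (\<mu> \<omega>) B)"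
      by (rule tendsto_in_Lp_cong_limit[OF L(4) L\<mu> \<mu>_meas[OF B]])
  qed
  have \<BB>: "B \<in> sets ?\<sigma>" if "B \<in> \<BB>" for B using that assms(19) by auto
  show ?thesis
  proof (intro exI[of _ \<mu>] conjI \<mu>)
    show "AE \<omega> in M. \<forall>B\<in>\<BB>. (\<lambda>n. measure (cumulative_measure \<Lambda> n \<omega>) B) \<longlonglongrightarrow> measure (\<mu> \<omega>) B"
      using conv \<BB> by (subst AE_ball_countable[OF \<open>countable \<BB>\<close>]) blast
  qed (use conv \<BB> in blast)
qed

end
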